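(* Let $R$ be a commutative ring with unit and let $K$ be an oriented virtual diagram whose corresponding atom is orientable. Then the homology $Kh(K)$ with coefficients in $R$ coincides with (is isomorphic, as a bigraded $R$-module, to) the usual Khovanov homology $Kh'(K)$ of $K$.
   Context: Virtual diagrams. A virtual diagram is a four-valent graph immersed generically in the plane (possibly with closed components without vertices) in which each crossing is either classical (with over/under information) or virtual (no extra structure). Atom of a diagram. An atom is a pair $(M,\Gamma)$, where $M$ is a closed 2-manifold and $\Gamma\subset M$ is a four-valent graph (the frame) dividing $M$ into black and white cells, together with a checkerboard coloring of these cells. It is orientable if $M$ is orientable. The atom of a virtual diagram has one vertex for each classical crossing, edges given by the branches of the diagram connecting classical crossings (virtual crossings ignored), opposite half-edges as in the diagram, and at each classical crossing, if $x_1,x_2,x_3,x_4$ are the half-edges in clockwise order with $x_1,x_3$ forming the undercrossing and $x_2,x_4$ the overcrossing, the angles $(x_1,x_2)$ and $(x_3,x_4)$ are black and the other two are white; this determines how black and white cells are attached to the frame. State cube. Let $K$ be an oriented virtual diagram with $n$ classical crossings, enumerated arbitrarily. Each classical crossing can be smoothed in two ways: the $A$-smoothing joins the two regions (locally at the crossing) swept out by rotating the overcrossing strand counterclockwise to the undercrossing strand, and the $B$-smoothing joins the other two. (Thus at a positive crossing the $A$-smoothing is the one respecting the orientation, and at a negative crossing the $B$-smoothing is.) A state is a vertex $s\in\{0,1\}^n$, with $0$ meaning $A$-smoothing and $1$ meaning $B$-smoothing. Its circles are the closed curves obtained after smoothing all classical crossings according to $s$, where virtual crossings are ignored (curves go straight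 through them). The height of $s$ is its number of $1$'s. Edges of the cube change one coordinate from $0$ to $1$. Along an edge the two arcs at the corresponding crossing are resmoothed, so either two circles merge into one ($2\to1$), or one circle splits into two ($1\to2$), or one circle is transformed into one circle ($1\to1$); all other circles are unchanged. Chain spaces of $[[K]]$. To each circle $C$ of a state associate the free rank-2 $R$-module $V_C$ with basis $1$ and $X_{C,o}$, where $o$ is an orientation of $C$, and $X_{C,-o}=-X_{C,o}$ for the opposite orientation $-o$. To a state $s$ with circles $C_1,\dots,C_k$ associate the ordered tensor product $C_s$ of $V_{C_1},\dots,V_{C_k}$. It is the module generated by the tensor products in all orders of the factors, modulo the identification that permuting the factors by $\sigma$ multiplies by $\mathrm{sign}(\sigma)$. Its elements are written $p^1_{C_{a_1}}\wedge\dots\wedge p^k_{C_{a_k}}$, with $p_{C_i}\wedge q_{C_j}=-q_{C_j}\wedge p_{C_i}$ for different circles. It is free of rank $2^k$; $X\wedge X$ with factors in two different spaces is nonzero. The chain space of $[[K]]$ in height $i$ is $\bigoplus_{s} C_s$ over the states $s$ of height $i$. A basis element of $C_s$ with $a$ factors equal to $1$ and $b$ factors equal to $\pm X$ has grading $a-b+(\text{height of }s)$. Local conventions at a crossing. At each classical crossing $v$, rotate the picture so that both strands are oriented upwards; this gives upper-left, upper-right, lower-left and lower-right half-edges at $v$. Orient the upper-right and lower-left half-edges away from $v$, and the upper-left and lower-right half-edges towards $v$. For an edge of the cube at $v$ of type $2\to1$ or $1\to2$, these local directions are compatible and orient every circle incident to $v$ in both states of the edge. For such a circle, $X$ (in the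 formulas below) denotes the generator $X_{C,o}$ for this orientation $o$. When two different circles are incident to $v$ in one state, they are numbered locally as first and second: the upper one is first and the lower one second if the smoothing at $v$ consists of an upper and a lower arc; the left one is first and the right one second if the smoothing consists of a left and a right arc. Partial differentials. The partial differential along an edge of type $1\to1$ is zero. Along an edge of type $2\to1$, rewrite elements (with the appropriate permutation sign) so that the first and the second circle occupy the first and second position, and replace these two factors by their image, put in first position, under $$m(1_1\wedge1_2)=1,\quad m(X_1\wedge1_2)=m(1_1\wedge X_2)=X,\quad m(X_1\wedge X_2)=0.$$ Along an edge of type $1\to2$, rewrite elements so that the splitting circle occupies the first position, and replace this factor by its image, put in the first two positions, under $$\Delta(1)=1_1\wedge X_2+X_1\wedge1_2,\quad \Delta(X)=X_1\wedge X_2,$$ where the indices $1,2$ denote the locally first and second circle. All remaining factors are left unchanged and in the same order. The differential $\partial$ of $[[K]]$ is the sum of the partial differentials over all edges of the cube (no further signs are inserted). It satisfies $\partial^2=0$, raises the height by one and preserves the grading. Normalization. Let $n_+$ and $n_-$ be the numbers of positive and negative classical crossings of $K$. Set $\mathcal{C}(K)=[[K]][-n_-]\{n_+-2n_-\}$, i.e. $\mathcal{C}(K)^{i,j}=[[K]]^{\,i+n_-,\;j-n_++2n_-}$, where $i$ is the height and $j$ the grading. $Kh(K)$ is the (bigraded) homology of $\mathcal{C}(K)$. Usual Khovanov homology. If the atom of $K$ is orientable, no edge of the cube is of type $1\to1$. The usual Khovanov complex is then built from the same state cube as follows. Let $V$ be the free $R$-module with basis $1,X$ in gradings $1,-1$.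 To a state with $k$ circles associate the usual (unordered) tensor product $V^{\otimes k}$, one factor for each circle, with grading shifted up by the height. Edges of type $2\to1$ carry $m(1\otimes1)=1$, $m(X\otimes1)=m(1\otimes X)=X$, $m(X\otimes X)=0$. Edges of type $1\to2$ carry $\Delta(1)=1\otimes X+X\otimes1$, $\Delta(X)=X\otimes X$. Each is tensored with the identity on the other factors. For a fixed enumeration of the crossings, the edge changing the coordinate $\alpha_j$ is multiplied by $(-1)^{\alpha_1+\dots+\alpha_{j-1}}$, which makes the cube anticommutative. The differential is the sum over all edges, and the complex is normalized by the same shift $[-n_-]\{n_+-2n_-\}$. $Kh'(K)$ is its bigraded homology. *)

theory Defs
  imports
    "HOL-Algebra.Module"
    "HOL-Algebra.AbelCoset"
    "HOL-Combinatorics.Permutations"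
    "HOL-Combinatorics.Orbits"
begin

section \<open>Modules\<close>

definition mod_hom ::
    "('r, 'x) ring_scheme \<Rightarrow> ('r, 'm, 'y) module_scheme \<Rightarrow> ('r, 'n, 'z) module_scheme \<Rightarrow> ('m \<Rightarrow> 'n) set"
  where "mod_hom R M N =
    {f \<in> carrier M \<rightarrow> carrier N.
       (\<forall>x\<in>carrier M. \<forall>y\<in>carrier M. f (x \<oplus>\<^bsub>M\<^esub> y) = f x \<oplus>\<^bsub>N\<^esub> f y) \<and>
       (\<forall>a\<in>carrier R. \<forall>x\<in>carrier M. f (a \<odot>\<^bsub>M\<^esub> x) = a \<odot>\<^bsub>N\<^esub> f x)}"

definition mod_isomorphic ::
    "('r, 'x) ring_scheme \<Rightarrow> ('r, 'm, 'y) module_scheme \<Rightarrow> ('r, 'n, 'z) module_scheme \<Rightarrow> bool"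
  where "mod_isomorphic R M N \<longleftrightarrow> (\<exists>f\<in>mod_hom R M N. bij_betw f (carrier M) (carrier N))"

text \<open>The record \<^type>\<open>module\<close> extends the ring record; the multiplication and the unit of that
  record play no role for modules and are left unspecified below.\<close>

definition quotient_module :: "('r, 'm, 'y) module_scheme \<Rightarrow> 'm set \<Rightarrow> ('r, 'm set) module"
  where "quotient_module M N =
    \<lparr>carrier = a_rcosets\<^bsub>M\<^esub> N, monoid.mult = (\<lambda>_ _. undefined), one = undefined,
     zero = N, add = set_add M,
     smult = (\<lambda>a X. \<Union>x\<in>X. N +>\<^bsub>M\<^esub> (a \<odot>\<^bsub>M\<^esub> x))\<rparr>"

definition span_module :: "('r, 'x) ring_scheme \<Rightarrow> ('r, 'm) module \<Rightarrow> 'm set \<Rightarrow> 'm set"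
  where "span_module R M S = \<Inter>{N. submodule N R M \<and> S \<subseteq> N}"

text \<open>The two constructions below are used for finite index sets only, where the product is the
  direct sum and all functions on a set form the free module on it.\<close>

definition direct_sum :: "'i set \<Rightarrow> ('i \<Rightarrow> ('r, 'm) module) \<Rightarrow> ('r, 'i \<Rightarrow> 'm) module"
  where "direct_sum I M =
    \<lparr>carrier = (\<Pi>\<^sub>E i\<in>I. carrier (M i)), monoid.mult = (\<lambda>_ _. undefined), one = undefined,
     zero = (\<lambda>i\<in>I. \<zero>\<^bsub>M i\<^esub>), add = (\<lambda>x y. \<lambda>i\<in>I. x i \<oplus>\<^bsub>M i\<^esub> y i),
     smult = (\<lambda>a x. \<lambda>i\<in>I. a \<odot>\<^bsub>M i\<^esub> x i)\<rparr>"

definition free_module :: "('r, 'x) ring_scheme \<Rightarrow> 'g set \<Rightarrow> ('r, 'g \<Rightarrow> 'r) module"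
  where "free_module R S =
    \<lparr>carrier = (S \<rightarrow>\<^sub>E carrier R), monoid.mult = (\<lambda>_ _. undefined), one = undefined,
     zero = (\<lambda>g\<in>S. \<zero>\<^bsub>R\<^esub>), add = (\<lambda>x y. \<lambda>g\<in>S. x g \<oplus>\<^bsub>R\<^esub> y g),
     smult = (\<lambda>a x. \<lambda>g\<in>S. a \<otimes>\<^bsub>R\<^esub> x g)\<rparr>"

definition basis_vector :: "('r, 'x) ring_scheme \<Rightarrow> 'g set \<Rightarrow> 'g \<Rightarrow> 'g \<Rightarrow> 'r"
  where "basis_vector R S g = (\<lambda>h\<in>S. if h = g then \<one>\<^bsub>R\<^esub> else \<zero>\<^bsub>R\<^esub>)"

definition linear_extension ::
    "'g set \<Rightarrow> ('r, 'm, 'y) module_scheme \<Rightarrow> ('g \<Rightarrow> 'm) \<Rightarrow> ('g \<Rightarrow> 'r) \<Rightarrow> 'm"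
  where "linear_extension S M b x = (\<Oplus>\<^bsub>M\<^esub> g\<in>S. x g \<odot>\<^bsub>M\<^esub> b g)"


section \<open>Oriented virtual diagrams\<close>

text \<open>
  Every crossing of an oriented diagram, classical or virtual, can be rotated in exactly one way so
  that both strands run upwards. This names its four half-edges: the strands are \<open>LL \<rightarrow> UR\<close> and
  \<open>LR \<rightarrow> UL\<close>. In this position the overcrossing strand of a positive crossing is \<open>LL \<rightarrow> UR\<close> and
  that of a negative crossing is \<open>LR \<rightarrow> UL\<close>.
\<close>

datatype corner = UL | UR | LL | LR

fun ccw :: "corner \<Rightarrow> corner" where
  "ccw UR = UL" | "ccw UL = LL" | "ccw LL = LR" | "ccw LR = UR"

fun cw :: "corner \<Rightarrow> corner" where
  "cw UL = UR" | "cw LL = UL" | "cw LR = LL" | "cw UR = LR"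

fun opposite :: "corner \<Rightarrow> corner" where
  "opposite UR = LL" | "opposite LL = UR" | "opposite UL = LR" | "opposite LR = UL"

datatype crossing_kind = Positive | Negative | Virtual

definition over_corners :: "crossing_kind \<Rightarrow> corner set"
  where "over_corners k = (if k = Positive then {LL, UR} else {LR, UL})"

text \<open>
  \<^term>\<open>Loop l b\<close> are the two ends of the closed component number \<open>l\<close> without crossings, cut open
  at a point.
\<close>

datatype 'v half_edge = At 'v corner | Loop nat bool

fun outgoing :: "'v half_edge \<Rightarrow> bool" where
  "outgoing (At v c) \<longleftrightarrow> c \<in> {UL, UR}"
| "outgoing (Loop l b) \<longleftrightarrow> b"

text \<open>\<open>mate\<close> sends a half-edge to the other half of the same edge.\<close>

record 'v diagram =
  crossings :: "'v set"
  kind :: "'v \<Rightarrow> crossing_kind"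
  mate :: "'v half_edge \<Rightarrow> 'v half_edge"
  loops :: nat

definition vertex_half_edges :: "'v diagram \<Rightarrow> 'v half_edge set"
  where "vertex_half_edges K = {At v c |v c. v \<in> crossings K}"

definition half_edges :: "'v diagram \<Rightarrow> 'v half_edge set"
  where "half_edges K = vertex_half_edges K \<union> {Loop l b |l b. l < loops K}"

text \<open>
  The diagram is given by its vertices, edges and the cyclic order of half-edges at each vertex.
  Such data come from a drawing in the plane if and only if Euler's formula for plane graphs holds,
  where faces are traced by the permutation sending a half-edge to the one counterclockwise after
  its mate.
\<close>

definition next_at_face :: "'v diagram \<Rightarrow> 'v half_edge \<Rightarrow> 'v half_edge"
  where "next_at_face K h = (case mate K h of At v c \<Rightarrow> At v (ccw c) | Loop l b \<Rightarrow> Loop l b)"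

definition faces :: "'v diagram \<Rightarrow> 'v half_edge set set"
  where "faces K = orbit (next_at_face K) ` vertex_half_edges K"

definition graph_edges :: "'v diagram \<Rightarrow> 'v half_edge set set"
  where "graph_edges K = (\<lambda>h. {h, mate K h}) ` vertex_half_edges K"

definition adjacency :: "'v diagram \<Rightarrow> ('v \<times> 'v) set"
  where "adjacency K = {(v, w). v \<in> crossings K \<and> (\<exists>c d. mate K (At v c) = At w d)}"

definition graph_components :: "'v diagram \<Rightarrow> 'v set set"
  where "graph_components K = crossings K // (adjacency K)\<^sup>*"

definition planar :: "'v diagram \<Rightarrow> bool"
  where "planar K \<longleftrightarrow>
    int (card (crossings K)) - int (card (graph_edges K)) + int (card (faces K))
      = 2 * int (card (graph_components K))"

definition virtual_diagram :: "'v diagram \<Rightarrow> bool"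
  where "virtual_diagram K \<longleftrightarrow>
    finite (crossings K) \<and>
    (\<forall>h\<in>half_edges K. mate K h \<in> half_edges K \<and> mate K (mate K h) = h \<and>
                        (outgoing (mate K h) \<longleftrightarrow> \<not> outgoing h)) \<and>
    (\<forall>l<loops K. \<forall>b. mate K (Loop l b) = Loop l (\<not> b)) \<and>
    planar K"

definition classical :: "'v diagram \<Rightarrow> 'v set"
  where "classical K = {v \<in> crossings K. kind K v \<noteq> Virtual}"

definition n_plus :: "'v diagram \<Rightarrow> nat"
  where "n_plus K = card {v \<in> crossings K. kind K v = Positive}"

definition n_minus :: "'v diagram \<Rightarrow> nat"
  where "n_minus K = card {v \<in> crossings K. kind K v = Negative}"


section \<open>The atom of a diagram\<close>

text \<open>
  An atom is presented by its frame and by the two angles, one black and one white, that each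
  half-edge bounds at its vertex: \<open>black_angle h\<close> is the other half-edge bounding the black angle
  at \<open>h\<close>, and likewise \<open>white_angle h\<close>. The surface is obtained from the frame by attaching a disc
  along each closed walk that turns through black angles only, and along each closed walk that
  turns through white angles only.
\<close>

record 'h atom =
  frame :: "'h set"
  other_end :: "'h \<Rightarrow> 'h"
  black_angle :: "'h \<Rightarrow> 'h"
  white_angle :: "'h \<Rightarrow> 'h"

text \<open>
  A closed walk in a given direction is identified with the set of half-edges along which it leaves
  a vertex. Every cell has two boundary walks \<open>b\<close> and \<open>other_end A ` b\<close>, one for each orientation
  of the cell.
\<close>

definition cell_boundaries :: "'h atom \<Rightarrow> ('h \<Rightarrow> 'h) \<Rightarrow> 'h set set"
  where "cell_boundaries A angle = (\<lambda>h. orbit (\<lambda>x. angle (other_end A x)) h) ` frame A"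

definition cells_orientation :: "'h atom \<Rightarrow> ('h \<Rightarrow> 'h) \<Rightarrow> 'h set set \<Rightarrow> bool"
  where "cells_orientation A angle Os \<longleftrightarrow>
    Os \<subseteq> cell_boundaries A angle \<and>
    (\<forall>b\<in>cell_boundaries A angle. b \<in> Os \<longleftrightarrow> other_end A ` b \<notin> Os)"

text \<open>Coherent orientations of adjacent cells: they induce opposite directions on each edge. The two
  cells at an edge are always a black one and a white one.\<close>

definition orientable_atom :: "'h atom \<Rightarrow> bool"
  where "orientable_atom A \<longleftrightarrow>
    (\<exists>Bs Ws. cells_orientation A (black_angle A) Bs \<and> cells_orientation A (white_angle A) Ws \<and>
       (\<forall>h\<in>frame A. h \<in> \<Union>Bs \<longleftrightarrow> other_end A h \<in> \<Union>Ws))"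

fun straight :: "'v half_edge \<Rightarrow> 'v half_edge" where
  "straight (At v c) = At v (opposite c)"
| "straight (Loop l b) = Loop l b"

definition classical_half_edges :: "'v diagram \<Rightarrow> 'v half_edge set"
  where "classical_half_edges K = {At v c |v c. v \<in> classical K}"

text \<open>Leave along \<open>h\<close> and go straight through virtual crossings up to the first classical one.\<close>

definition branch_end :: "'v diagram \<Rightarrow> 'v half_edge \<Rightarrow> 'v half_edge"
  where "branch_end K h =
    (let walk = (\<lambda>n. ((\<lambda>x. mate K (straight x)) ^^ n) (mate K h))
     in walk (LEAST n. walk n \<in> classical_half_edges K))"

text \<open>An angle is black if its overcrossing half-edge follows its undercrossing one clockwise.\<close>

fun black_at :: "'v diagram \<Rightarrow> 'v half_edge \<Rightarrow> 'v half_edge" where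
  "black_at K (At v c) = At v (if c \<in> over_corners (kind K v) then ccw c else cw c)"
| "black_at K (Loop l b) = Loop l b"

fun white_at :: "'v diagram \<Rightarrow> 'v half_edge \<Rightarrow> 'v half_edge" where
  "white_at K (At v c) = At v (if c \<in> over_corners (kind K v) then cw c else ccw c)"
| "white_at K (Loop l b) = Loop l b"

definition atom_of :: "'v diagram \<Rightarrow> 'v half_edge atom"
  where "atom_of K =
    \<lparr>frame = classical_half_edges K, other_end = branch_end K,
     black_angle = black_at K, white_angle = white_at K\<rparr>"


section \<open>States and circles\<close>

text \<open>
  A state is the set of classical crossings whose coordinate is \<open>1\<close> (\<open>B\<close>-smoothing).
  \<^term>\<open>turn K s h\<close> is the half-edge joined to \<open>h\<close> at its crossing in the state \<open>s\<close>. The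
  \<open>A\<close>-smoothing joins the two regions swept out by rotating the overcrossing strand
  counterclockwise; hence it joins each overcrossing half-edge with its clockwise neighbour.
\<close>

fun turn :: "'v diagram \<Rightarrow> 'v set \<Rightarrow> 'v half_edge \<Rightarrow> 'v half_edge" where
  "turn K s (At v c) = At v
     (if kind K v = Virtual then opposite c
      else if v \<in> s then (if c \<in> over_corners (kind K v) then ccw c else cw c)
      else (if c \<in> over_corners (kind K v) then cw c else ccw c))"
| "turn K s (Loop l b) = Loop l (\<not> b)"

text \<open>
  An oriented circle is identified with the set of half-edges along which it leaves their vertices;
  the opposite orientation is the image under \<open>mate\<close>, and the circle itself is the union of both.
\<close>

definition oriented_circle :: "'v diagram \<Rightarrow> 'v set \<Rightarrow> 'v half_edge \<Rightarrow> 'v half_edge set"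
  where "oriented_circle K s h = orbit (\<lambda>x. turn K s (mate K x)) h"

definition circle_at :: "'v diagram \<Rightarrow> 'v set \<Rightarrow> 'v half_edge \<Rightarrow> 'v half_edge set"
  where "circle_at K s h = oriented_circle K s h \<union> mate K ` oriented_circle K s h"

definition circles :: "'v diagram \<Rightarrow> 'v set \<Rightarrow> 'v half_edge set set"
  where "circles K s = circle_at K s ` half_edges K"

definition orientations :: "'v diagram \<Rightarrow> 'v set \<Rightarrow> 'v half_edge set \<Rightarrow> 'v half_edge set set"
  where "orientations K s C = oriented_circle K s ` C"

text \<open>
  The locally first circle at \<open>v\<close> is the left or the upper one, the second is the right or the lower
  one, depending on the smoothing. The left and the upper arc both contain the half-edge \<open>UL\<close>; the
  right and the lower arc both contain \<open>LR\<close>.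
\<close>

definition first_circle :: "'v diagram \<Rightarrow> 'v set \<Rightarrow> 'v \<Rightarrow> 'v half_edge set"
  where "first_circle K s v = circle_at K s (At v UL)"

definition second_circle :: "'v diagram \<Rightarrow> 'v set \<Rightarrow> 'v \<Rightarrow> 'v half_edge set"
  where "second_circle K s v = circle_at K s (At v LR)"

text \<open>The edges of the cube from \<open>s\<close> to \<^term>\<open>insert v s\<close> of type \<open>2 \<rightarrow> 1\<close> and \<open>1 \<rightarrow> 2\<close>.\<close>

definition merges :: "'v diagram \<Rightarrow> 'v set \<Rightarrow> 'v \<Rightarrow> bool"
  where "merges K s v \<longleftrightarrow>
    first_circle K s v \<noteq> second_circle K s v \<and>
    first_circle K (insert v s) v = second_circle K (insert v s) v"

definition splits :: "'v diagram \<Rightarrow> 'v set \<Rightarrow> 'v \<Rightarrow> bool"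
  where "splits K s v \<longleftrightarrow>
    first_circle K s v = second_circle K s v \<and>
    first_circle K (insert v s) v \<noteq> second_circle K (insert v s) v"

definition local_orientation ::
    "'v diagram \<Rightarrow> 'v set \<Rightarrow> 'v \<Rightarrow> 'v half_edge set \<Rightarrow> 'v half_edge set"
  where "local_orientation K s v C =
    (THE ori. ori \<in> orientations K s C \<and>
       (\<forall>c. At v c \<in> C \<longrightarrow> (At v c \<in> ori \<longleftrightarrow> c \<in> {UR, LL})))"


section \<open>The homology of a cube\<close>

text \<open>
  A cube over the finite set \<open>V\<close> has a module \<open>M s j\<close> for each state \<open>s \<subseteq> V\<close> and each grading \<open>j\<close>,
  and a map \<open>\<delta> s v j\<close> from \<open>M s j\<close> to \<open>M (insert v s) j\<close> for each edge.
\<close>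

definition states_of_height :: "'v set \<Rightarrow> int \<Rightarrow> 'v set set"
  where "states_of_height V i = {s. s \<subseteq> V \<and> int (card s) = i}"

definition cube_chains ::
    "'v set \<Rightarrow> ('v set \<Rightarrow> int \<Rightarrow> ('r, 'm) module) \<Rightarrow> int \<Rightarrow> int \<Rightarrow> ('r, 'v set \<Rightarrow> 'm) module"
  where "cube_chains V M i j = direct_sum (states_of_height V i) (\<lambda>s. M s j)"

definition cube_differential ::
    "'v set \<Rightarrow> ('v set \<Rightarrow> int \<Rightarrow> ('r, 'm) module) \<Rightarrow> ('v set \<Rightarrow> 'v \<Rightarrow> int \<Rightarrow> 'm \<Rightarrow> 'm)
      \<Rightarrow> int \<Rightarrow> int \<Rightarrow> ('v set \<Rightarrow> 'm) \<Rightarrow> ('v set \<Rightarrow> 'm)"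
  where "cube_differential V M \<delta> i j x =
    (\<lambda>t\<in>states_of_height V (i + 1). \<Oplus>\<^bsub>M t j\<^esub> v\<in>t. \<delta> (t - {v}) v j (x (t - {v})))"

definition cube_homology ::
    "'v set \<Rightarrow> ('v set \<Rightarrow> int \<Rightarrow> ('r, 'm) module) \<Rightarrow> ('v set \<Rightarrow> 'v \<Rightarrow> int \<Rightarrow> 'm \<Rightarrow> 'm)
      \<Rightarrow> int \<Rightarrow> int \<Rightarrow> ('r, ('v set \<Rightarrow> 'm) set) module"
  where "cube_homology V M \<delta> i j =
    (let C = cube_chains V M
     in quotient_module
          (C i j \<lparr>carrier := a_kernel (C i j) (C (i + 1) j) (cube_differential V M \<delta> i j)\<rparr>)
          (cube_differential V M \<delta> (i - 1) j ` carrier (C (i - 1) j)))"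


section \<open>Labels\<close>

datatype label = Lab_1 | Lab_X

definition label_degree :: "label \<Rightarrow> int"
  where "label_degree p = (case p of Lab_1 \<Rightarrow> 1 | Lab_X \<Rightarrow> - 1)"

text \<open>The sets of summands of \<open>m(p \<otimes> q)\<close> and \<open>\<Delta>(p)\<close>; all coefficients are \<open>1\<close>.\<close>

fun m_terms :: "label \<Rightarrow> label \<Rightarrow> label set" where
  "m_terms Lab_1 Lab_1 = {Lab_1}"
| "m_terms Lab_X Lab_1 = {Lab_X}"
| "m_terms Lab_1 Lab_X = {Lab_X}"
| "m_terms Lab_X Lab_X = {}"

fun Delta_terms :: "label \<Rightarrow> (label \<times> label) set" where
  "Delta_terms Lab_1 = {(Lab_1, Lab_X), (Lab_X, Lab_1)}"
| "Delta_terms Lab_X = {(Lab_X, Lab_X)}"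


section \<open>Khovanov homology with ordered tensor products\<close>

text \<open>
  The factors \<open>1\<^sub>C\<close> and \<open>X\<^sub>C\<^sub>,\<^sub>o\<close>; a word lists the factors of a tensor product in one of the orders of
  the circles.
\<close>

datatype 'h factor = One_at "'h set" | X_at "'h set" "'h set"

fun factor_circle :: "'h factor \<Rightarrow> 'h set" where
  "factor_circle (One_at C) = C"
| "factor_circle (X_at C ori) = C"

fun factor_label :: "'h factor \<Rightarrow> label" where
  "factor_label (One_at C) = Lab_1"
| "factor_label (X_at C ori) = Lab_X"

definition words :: "'v diagram \<Rightarrow> 'v set \<Rightarrow> int \<Rightarrow> 'v half_edge factor list set"
  where "words K s j =
    {w. distinct (map factor_circle w) \<and> factor_circle ` set w = circles K s \<and>
        (\<forall>C ori. X_at C ori \<in> set w \<longrightarrow> ori \<in> orientations K s C) \<and>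
        (\<Sum>f\<leftarrow>w. label_degree (factor_label f)) + int (card s) = j}"

definition word_vector ::
    "('r, 'x) ring_scheme \<Rightarrow> 'v diagram \<Rightarrow> 'v set \<Rightarrow> int \<Rightarrow> 'v half_edge factor list
      \<Rightarrow> 'v half_edge factor list \<Rightarrow> 'r"
  where "word_vector R K s j w = basis_vector R (words K s j) w"

definition word_relations ::
    "('r, 'x) ring_scheme \<Rightarrow> 'v diagram \<Rightarrow> 'v set \<Rightarrow> int \<Rightarrow> ('v half_edge factor list \<Rightarrow> 'r) set"
  where "word_relations R K s j =
    (let F = free_module R (words K s j); e = word_vector R K s j
     in {e (permute_list \<sigma> w) \<ominus>\<^bsub>F\<^esub> [sign \<sigma>] \<cdot>\<^bsub>F\<^esub> e w |\<sigma> w.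
           w \<in> words K s j \<and> \<sigma> permutes {..<length w}}
        \<union> {e (w[k := X_at C (mate K ` ori)]) \<oplus>\<^bsub>F\<^esub> e w |w k C ori.
           w \<in> words K s j \<and> k < length w \<and> w ! k = X_at C ori})"

text \<open>The part of grading \<open>j\<close> of the ordered tensor product at the state \<open>s\<close>.\<close>

definition ordered_tensor ::
    "('r, 'x) ring_scheme \<Rightarrow> 'v diagram \<Rightarrow> 'v set \<Rightarrow> int
      \<Rightarrow> ('r, ('v half_edge factor list \<Rightarrow> 'r) set) module"
  where "ordered_tensor R K s j =
    (let F = free_module R (words K s j)
     in quotient_module F (span_module R F (word_relations R K s j)))"

definition wedge ::
    "('r, 'x) ring_scheme \<Rightarrow> 'v diagram \<Rightarrow> 'v set \<Rightarrow> int \<Rightarrow> 'v half_edge factor list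
      \<Rightarrow> ('v half_edge factor list \<Rightarrow> 'r) set"
  where "wedge R K s j w =
    (let F = free_module R (words K s j)
     in span_module R F (word_relations R K s j) +>\<^bsub>F\<^esub> word_vector R K s j w)"

definition local_factor ::
    "'v diagram \<Rightarrow> 'v set \<Rightarrow> 'v \<Rightarrow> 'v half_edge set \<Rightarrow> label \<Rightarrow> 'v half_edge factor"
  where "local_factor K s v C p =
    (case p of Lab_1 \<Rightarrow> One_at C | Lab_X \<Rightarrow> X_at C (local_orientation K s v C))"

text \<open>
  The wedges with the incident circles in front, written with the local orientations, generate the
  ordered tensor product, so each linear map below is determined by its values on them.
\<close>

definition partial_differential ::
    "('r, 'x) ring_scheme \<Rightarrow> 'v diagram \<Rightarrow> 'v set \<Rightarrow> 'v \<Rightarrow> int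
      \<Rightarrow> ('v half_edge factor list \<Rightarrow> 'r) set \<Rightarrow> ('v half_edge factor list \<Rightarrow> 'r) set"
  where "partial_differential R K s v j =
    (let t = insert v s;
         M = ordered_tensor R K s j;
         N = ordered_tensor R K t j;
         f1 = local_factor K s v (first_circle K s v);
         f2 = local_factor K s v (second_circle K s v);
         g1 = local_factor K t v (first_circle K t v);
         g2 = local_factor K t v (second_circle K t v)
     in if merges K s v then
          (THE d. d \<in> mod_hom R M N \<and> d \<in> extensional (carrier M) \<and>
             (\<forall>p q w. f1 p # f2 q # w \<in> words K s j \<longrightarrow>
                d (wedge R K s j (f1 p # f2 q # w)) =
                  (\<Oplus>\<^bsub>N\<^esub> r\<in>m_terms p q. wedge R K t j (g1 r # w))))
        else if splits K s v then
          (THE d. d \<in> mod_hom R M N \<and> d \<in> extensional (carrier M) \<and>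
             (\<forall>p w. f1 p # w \<in> words K s j \<longrightarrow>
                d (wedge R K s j (f1 p # w)) =
                  (\<Oplus>\<^bsub>N\<^esub> r\<in>Delta_terms p. wedge R K t j (g1 (fst r) # g2 (snd r) # w))))
        else (\<lambda>x\<in>carrier M. \<zero>\<^bsub>N\<^esub>))"

definition Kh ::
    "('r, 'x) ring_scheme \<Rightarrow> 'v diagram \<Rightarrow> int \<Rightarrow> int
      \<Rightarrow> ('r, ('v set \<Rightarrow> ('v half_edge factor list \<Rightarrow> 'r) set) set) module"
  where "Kh R K i j =
    cube_homology (classical K) (ordered_tensor R K) (partial_differential R K)
      (i + int (n_minus K)) (j - int (n_plus K) + 2 * int (n_minus K))"


section \<open>The usual Khovanov homology\<close>

text \<open>The standard basis of the unordered tensor product of one copy of \<open>V\<close> for each circle.\<close>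

definition labellings :: "'v diagram \<Rightarrow> 'v set \<Rightarrow> int \<Rightarrow> ('v half_edge set \<Rightarrow> label) set"
  where "labellings K s j =
    {l \<in> circles K s \<rightarrow>\<^sub>E UNIV. (\<Sum>C\<in>circles K s. label_degree (l C)) + int (card s) = j}"

definition usual_tensor ::
    "('r, 'x) ring_scheme \<Rightarrow> 'v diagram \<Rightarrow> 'v set \<Rightarrow> int
      \<Rightarrow> ('r, ('v half_edge set \<Rightarrow> label) \<Rightarrow> 'r) module"
  where "usual_tensor R K s j = free_module R (labellings K s j)"

text \<open>No edge of type \<open>1 \<rightarrow> 1\<close> occurs if the atom is orientable; the value there is immaterial.\<close>

definition usual_partial ::
    "('r, 'x) ring_scheme \<Rightarrow> 'v diagram \<Rightarrow> 'v set \<Rightarrow> 'v \<Rightarrow> int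
      \<Rightarrow> (('v half_edge set \<Rightarrow> label) \<Rightarrow> 'r) \<Rightarrow> (('v half_edge set \<Rightarrow> label) \<Rightarrow> 'r)"
  where "usual_partial R K s v j =
    (let t = insert v s;
         N = usual_tensor R K t j;
         C1 = first_circle K s v; C2 = second_circle K s v;
         D1 = first_circle K t v; D2 = second_circle K t v;
         e = (\<lambda>l. basis_vector R (labellings K t j) (restrict l (circles K t)))
     in linear_extension (labellings K s j) N
          (\<lambda>l. if merges K s v then \<Oplus>\<^bsub>N\<^esub> r\<in>m_terms (l C1) (l C2). e (l(D1 := r))
               else if splits K s v then
                 \<Oplus>\<^bsub>N\<^esub> r\<in>Delta_terms (l C1). e (l(D1 := fst r, D2 := snd r))
               else \<zero>\<^bsub>N\<^esub>))"

text \<open>The number of crossings with coordinate \<open>1\<close> that precede \<open>v\<close> in the enumeration \<open>vs\<close>.\<close>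

definition ones_before :: "'v list \<Rightarrow> 'v set \<Rightarrow> 'v \<Rightarrow> nat"
  where "ones_before vs s v = card {u \<in> set (takeWhile (\<lambda>u. u \<noteq> v) vs). u \<in> s}"

definition usual_Kh ::
    "('r, 'x) ring_scheme \<Rightarrow> 'v diagram \<Rightarrow> 'v list \<Rightarrow> int \<Rightarrow> int
      \<Rightarrow> ('r, ('v set \<Rightarrow> ('v half_edge set \<Rightarrow> label) \<Rightarrow> 'r) set) module"
  where "usual_Kh R K vs i j =
    cube_homology (classical K) (usual_tensor R K)
      (\<lambda>s v d x. [((- 1 :: int) ^ ones_before vs s v)] \<cdot>\<^bsub>usual_tensor R K (insert v s) d\<^esub>
                   usual_partial R K s v d x)
      (i + int (n_minus K)) (j - int (n_plus K) + 2 * int (n_minus K))"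

end

theory Submission
  imports Defs
begin

text \<open>
  An orientable atom carries a set \<open>G\<close> of half-edges that contains one end of every edge and, at
  every classical crossing, one end of every arc of either smoothing. Each circle of each state
  thereby gets a preferred orientation and a preferred generator \<open>X\<close>, and no edge of the cube has
  type \<open>1 \<rightarrow> 1\<close>. Once the circles of each state are ordered, the ordered tensor products become the
  usual ones, and each partial differential becomes plus or minus the usual one without its sign.
  It remains to see that these signs, like the usual ones, have product \<open>- 1\<close> around every face of
  the cube: two such systems of signs differ by a change of sign in each state.

  An ordering of the circles is a generator of the top exterior power of the free module on them.
  Let \<open>a\<close>, \<open>b\<close> be the locally first and second circle at a crossing. Up to sign, a merge removes a
  factor \<open>b - a\<close> and a split inserts it. Since \<open>(b - a) \<and> (d - c) = - (d - c) \<and> (b - a)\<close>, almost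
  all faces anticommute. What is left are the faces in which both crossings join the same two
  circles in two opposite states. There the claim is a statement on permutations: if \<open>(a \<dots> c \<dots>)\<close>
  and \<open>(b \<dots> d \<dots>)\<close> are two cycles, then \<open>a\<close> and \<open>d\<close> lie on one cycle after both crossings have been
  resmoothed.
\<close>

section \<open>Alternating functions of lists\<close>

text \<open>The obstacle is that the local generators \<open>X\<close> at a crossing need not be the
  preferred ones. Local orientations leave along \<open>UR\<close> and \<open>LL\<close>; if
  \<open>UL\<close> lies in \<open>G\<close>, they are opposite to the preferred ones for all
  circles at the crossing, before and after resmoothing. A merge preserves the number of factors
  \<open>X\<close> and does not notice, but a split creates one more \<open>X\<close> and acquires
  the sign \<open>corner_sign v\<close>. Around most faces these signs cancel. In the exceptional
  faces (the ladybug configuration) the product of the two corner signs survives. It is compensated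
  because the names "first" and "second" of the circles in the opposite state depend on the same two
  corners.

  Circles of different states cannot be compared directly. Exterior powers are therefore replaced by
  integer-valued alternating functions of lists, pulled back to lists of half-edges, which make
  sense in every state.

  A partial differential is specified as the unique linear map with prescribed values. Its existence
  is obtained together with the freeness of the ordered tensor products, by transport from the usual
  complex.\<close>

definition alternating :: "('a list \<Rightarrow> int) \<Rightarrow> bool"
  where "alternating F \<longleftrightarrow>
    (\<forall>xs \<sigma>. \<sigma> permutes {..<length xs} \<longrightarrow> F (permute_list \<sigma> xs) = sign \<sigma> * F xs)"

text \<open>The coordinate of the wedge of \<open>xs\<close> in the top exterior power on
  \<open>cs\<close>, relative to the wedge of \<open>cs\<close>. The value \<open>0\<close> covers
  lists with repetitions, wrong length or foreign entries.\<close>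

definition list_sign :: "'a list \<Rightarrow> 'a list \<Rightarrow> int"
  where "list_sign cs xs =
    (if mset xs = mset cs then sign (SOME \<sigma>. \<sigma> permutes {..<length cs} \<and> xs = permute_list \<sigma> cs) else 0)"

lemma alternatingD:
  "alternating F \<Longrightarrow> \<sigma> permutes {..<length xs} \<Longrightarrow> F (permute_list \<sigma> xs) = sign \<sigma> * F xs"
  by (simp add: alternating_def)

lemma alternating_swap:
  assumes "alternating F"
  shows "F (ps @ x # ms @ y # qs) = - F (ps @ y # ms @ x # qs)"
proof -
  let ?i = "length ps" and ?j = "length ps + Suc (length ms)"
  let ?xs = "ps @ x # ms @ y # qs"
  have p: "transpose ?i ?j permutes {..<length ?xs}"
    by (intro permutes_swap_id) auto
  have "permute_list (transpose ?i ?j) ?xs = ps @ y # ms @ x # qs"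
    by (rule nth_equalityI)
       (use p in \<open>auto simp: permute_list_nth nth_append nth_Cons transpose_def split: nat.splits\<close>)
  then show ?thesis
    using alternatingD[OF assms p] by (simp add: sign_swap_id)
qed

text \<open>Exchanging two equal entries leaves the list unchanged but negates the value, and an
  integer equal to its negative is \<open>0\<close>.\<close>

lemma alternating_not_distinct:
  assumes "alternating F" "\<not> distinct xs"
  shows "F xs = 0"
proof -
  obtain ps x ms qs where "xs = ps @ x # ms @ x # qs"
    using not_distinct_decomp[OF assms(2)] by auto
  then show ?thesis
    using alternating_swap[OF assms(1), of ps x ms x qs] by simp
qed

lemma permute_list_inj:
  assumes "distinct cs" "\<sigma> permutes {..<length cs}" "\<tau> permutes {..<length cs}"
    and "permute_list \<sigma> cs = permute_list \<tau> cs"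
  shows "\<sigma> = \<tau>"
proof
  fix i
  show "\<sigma> i = \<tau> i"
  proof (cases "i < length cs")
    case True
    then have "cs ! \<sigma> i = cs ! \<tau> i" "\<sigma> i < length cs" "\<tau> i < length cs"
      using assms(4) permute_list_nth[OF assms(2)] permute_list_nth[OF assms(3)]
        permutes_in_image[OF assms(2), of i] permutes_in_image[OF assms(3), of i] by auto
    then show ?thesis
      using assms(1) nth_eq_iff_index_eq by blast
  next
    case False
    then show ?thesis
      using assms(2,3) by (auto simp: permutes_def)
  qed
qed

lemma list_sign_permute:
  assumes "distinct cs" "\<sigma> permutes {..<length cs}"
  shows "list_sign cs (permute_list \<sigma> cs) = sign \<sigma>"
proof -
  have "(SOME \<tau>. \<tau> permutes {..<length cs} \<and> permute_list \<sigma> cs = permute_list \<tau> cs) = \<sigma>"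
    by (rule some_equality) (use assms permute_list_inj[OF assms(1)] in auto)
  then show ?thesis
    using assms by (simp add: list_sign_def)
qed

lemma list_sign_cases:
  fixes cs :: "'a list"
  assumes "distinct cs"
  obtains \<sigma> where "\<sigma> permutes {..<length cs}" "xs = permute_list \<sigma> cs" "list_sign cs xs = sign \<sigma>"
  | "mset xs \<noteq> mset cs" "list_sign cs xs = 0"
proof (cases "mset xs = mset cs")
  case True
  then obtain \<sigma> where "\<sigma> permutes {..<length cs}" "permute_list \<sigma> cs = xs"
    by (rule mset_eq_permutation)
  with that(1) assms show ?thesis
    by (metis list_sign_permute)
qed (use that(2) in \<open>simp add: list_sign_def\<close>)

lemma mset_eq_iff_distinct:
  assumes "distinct cs"
  shows "mset xs = mset cs \<longleftrightarrow> distinct xs \<and> set xs = set cs"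
  using assms by (metis mset_eq_imp_distinct_iff set_eq_iff_mset_eq_distinct)

lemma list_sign_unit:
  assumes "distinct cs" "distinct xs" "set xs = set cs"
  shows "list_sign cs xs \<in> {1, - 1}"
  by (rule list_sign_cases[OF assms(1), of xs])
     (use assms in \<open>auto simp: mset_eq_iff_distinct sign_def\<close>)

lemma list_sign_eq_0:
  assumes "distinct cs" "\<not> (distinct xs \<and> set xs = set cs)"
  shows "list_sign cs xs = 0"
  using assms by (simp add: list_sign_def mset_eq_iff_distinct)

lemma alternating_list_sign:
  fixes cs :: "'a list"
  assumes "distinct cs"
  shows "alternating (list_sign cs)"
  unfolding alternating_def
proof (intro allI impI)
  fix xs :: "'a list" and \<tau> assume \<tau>: "\<tau> permutes {..<length xs}"
  show "list_sign cs (permute_list \<tau> xs) = sign \<tau> * list_sign cs xs"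
  proof (rule list_sign_cases[OF assms, of xs])
    fix \<sigma> assume \<sigma>: "\<sigma> permutes {..<length cs}" "xs = permute_list \<sigma> cs" "list_sign cs xs = sign \<sigma>"
    have \<tau>': "\<tau> permutes {..<length cs}"
      using \<tau> \<sigma> by simp
    then have "permute_list \<tau> xs = permute_list (\<sigma> \<circ> \<tau>) cs"
      using \<sigma> by (simp add: permute_list_compose)
    then have "list_sign cs (permute_list \<tau> xs) = sign (\<sigma> \<circ> \<tau>)"
      using list_sign_permute[OF assms permutes_compose[OF \<tau>' \<sigma>(1)]] by simp
    also have "\<dots> = sign \<sigma> * sign \<tau>"
      using \<sigma>(1) \<tau>' by (intro sign_compose) (auto simp: permutation_permutes)
    finally show ?thesis
      using \<sigma> by simp
  next
    assume "mset xs \<noteq> mset cs" "list_sign cs xs = 0"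
    then show ?thesis
      using \<tau> by (simp add: list_sign_def)
  qed
qed

text \<open>The top exterior power has rank one: a list of full length with entries from
  \<open>cs\<close> either is a rearrangement of \<open>cs\<close> or has a repetition.\<close>

lemma alternating_unique:
  assumes "alternating F" "distinct cs" "set xs \<subseteq> set cs" "length xs = length cs"
  shows "F xs = list_sign cs xs * F cs"
proof (cases "distinct xs")
  case True
  then have "set xs = set cs"
    using assms by (simp add: card_subset_eq distinct_card)
  then have "mset xs = mset cs"
    using True assms(2) by (simp add: mset_eq_iff_distinct)
  show ?thesis
    by (rule list_sign_cases[OF assms(2), of xs])
       (use \<open>mset xs = mset cs\<close> assms(1) in \<open>auto simp: alternatingD\<close>)
next
  case False
  then show ?thesis
    using assms(2) by (simp add: alternating_not_distinct[OF assms(1)] list_sign_eq_0)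
qed

lemma alternating_Cons:
  assumes "alternating F"
  shows "alternating (\<lambda>xs. F (b # xs))"
  unfolding alternating_def
proof (intro allI impI)
  fix xs :: "'a list" and \<sigma> assume \<sigma>: "\<sigma> permutes {..<length xs}"
  \<comment> \<open>\<open>\<sigma>\<close> acting on the tail: conjugated by \<open>Suc\<close> and
    fixing position \<open>0\<close>. Its sign is that of \<open>\<sigma>\<close>.\<close>
  let ?\<tau> = "map_permutation {..<length xs} Suc \<sigma>"
  have \<tau>: "?\<tau> permutes {..<length (b # xs)}"
    by (rule permutes_subset[OF map_permutation_permutes])
       (use \<sigma> in \<open>auto simp: permutes_imp_bij\<close>)
  have inj: "inj_on Suc {..<length xs}"
    by simp
  have "permute_list ?\<tau> (b # xs) = b # permute_list \<sigma> xs"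
  proof (rule nth_equalityI)
    fix i assume i: "i < length (permute_list ?\<tau> (b # xs))"
    show "permute_list ?\<tau> (b # xs) ! i = (b # permute_list \<sigma> xs) ! i"
    proof (cases i)
      case 0
      have "0 \<notin> Suc ` {..<length xs}" by simp
      then have "?\<tau> 0 = 0"
        by (simp add: map_permutation_def restrict_id_def)
      then show ?thesis
        using 0 \<tau> by (simp add: permute_list_nth)
    next
      case (Suc k)
      have "?\<tau> (Suc k) = Suc (\<sigma> k)"
        using i Suc \<sigma> by (intro map_permutation_apply) auto
      then show ?thesis
        using Suc \<tau> \<sigma> i by (simp add: permute_list_nth)
    qed
  qed simp
  then show "F (b # permute_list \<sigma> xs) = sign \<sigma> * F (b # xs)"
    using alternatingD[OF assms \<tau>] sign_map_permutation[OF inj \<sigma>] by simp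
qed

lemma alternating_diff:
  "alternating F \<Longrightarrow> alternating G \<Longrightarrow> alternating (\<lambda>xs. F xs - G xs)"
  by (simp add: alternating_def right_diff_distrib)

lemma alternating_map:
  "alternating F \<Longrightarrow> alternating (\<lambda>xs. F (map g xs))"
  unfolding alternating_def by (simp flip: permute_list_map)

text \<open>Exchanging \<open>a\<close> for \<open>b\<close> in an alternating function amounts to passing to the quotient in
  which \<open>a\<close> and \<open>b\<close> are identified.\<close>

lemma alternating_diff_identify:
  assumes alt: "alternating F"
  shows "F (b # xs) - F (a # xs)
       = F (b # map (\<lambda>c. if c = b then a else c) xs) - F (a # map (\<lambda>c. if c = b then a else c) xs)"
    (is "_ = F (b # ?m xs) - F (a # ?m xs)")
proof (cases "a = b \<or> b \<notin> set xs")
  case True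
  then have "?m xs = xs"
    by (auto intro: map_idI)
  then show ?thesis
    by metis
next
  case False
  then obtain ps qs where xs: "xs = ps @ b # qs"
    by (auto dest: split_list)
  have ab: "a \<noteq> b"
    using False by auto
  have nd: "F ys = 0" if "\<not> distinct ys" for ys
    using alternating_not_distinct[OF alt that] .
  show ?thesis
  proof (cases "set ps \<inter> {a, b} = {} \<and> set qs \<inter> {a, b} = {}")
    case True
    then have "?m ps = ps" "?m qs = qs"
      by (auto intro!: map_idI)
    then have "?m xs = ps @ a # qs"
      by (simp add: xs)
    moreover have "F (b # ps @ b # qs) = 0" "F (a # ps @ a # qs) = 0"
      by (auto intro: nd)
    ultimately show ?thesis
      using alternating_swap[OF alt, of "[]" b ps a qs] by (simp add: xs)
  next
    case False
    \<comment> \<open>Besides the \<open>b\<close> that was split off, \<open>xs\<close> contains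
      another \<open>a\<close> or \<open>b\<close>, so each of the four lists has a
      repetition.\<close>
    have "\<not> distinct (b # xs)" "\<not> distinct (a # ?m xs)"
      by (auto simp: xs)
    moreover have "\<not> distinct (?m xs)" "\<not> distinct (a # xs)"
      using False ab by (auto simp: xs image_iff)
    ultimately show ?thesis
      by (simp add: nd)
  qed
qed

section \<open>Orbits and transpositions\<close>

lemma orbit_sym:
  assumes "permutation f" "x \<in> orbit f y"
  shows "y \<in> orbit f x"
  using permutation_self_in_orbit[OF assms(1)] assms(2) by (rule orbit_swap)

lemma orbit_transposition_unchanged:
  assumes "permutation f" "a \<notin> orbit f x" "b \<notin> orbit f x"
  shows "orbit (transpose a b \<circ> f) x = orbit f x"
proof (rule orbit_cong)
  show "x \<in> orbit f x"
    using assms(1) by (rule permutation_self_in_orbit)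
next
  fix y assume "y \<in> orbit f x"
  then have "f y \<in> orbit f x"
    by (rule orbit.step)
  then show "(transpose a b \<circ> f) y = f y"
    using assms by (auto simp: transpose_def)
qed

lemma orbit_first_hit:
  assumes "z \<in> orbit f x" "z \<in> A"
  obtains n where "0 < n" "(f ^^ n) x \<in> A" "\<And>k. 0 < k \<Longrightarrow> k < n \<Longrightarrow> (f ^^ k) x \<notin> A"
proof -
  let ?P = "\<lambda>n. 0 < n \<and> (f ^^ n) x \<in> A"
  obtain m where "?P m"
    using assms by (auto simp: orbit_altdef)
  then have "?P (LEAST n. ?P n)"
    by (rule LeastI)
  then show ?thesis
    using that[of "LEAST n. ?P n"] not_less_Least[of _ ?P] by auto
qed

lemma funpow_agree:
  fixes f g :: "'a \<Rightarrow> 'a"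
  assumes "\<And>k. 0 < k \<Longrightarrow> k < n \<Longrightarrow> (f ^^ k) x \<notin> A" "\<And>y. f y \<notin> A \<Longrightarrow> g y = f y" "k < n"
  shows "(g ^^ k) x = (f ^^ k) x"
  using assms(3)
proof (induction k)
  case (Suc k)
  moreover have "f ((f ^^ k) x) \<notin> A"
    using assms(1)[of "Suc k"] Suc.prems by simp
  ultimately show ?case
    using assms(2) by simp
qed simp

text \<open>\<open>g\<close> follows \<open>f\<close> from \<open>x\<close> as long as
  \<open>f\<close> avoids \<open>A\<close>; at the first entrance into \<open>A\<close> it goes to
  \<open>z'\<close> instead of \<open>z\<close>.\<close>

lemma orbit_redirect:
  fixes f g :: "'a \<Rightarrow> 'a"
  assumes "0 < n" "\<And>k. 0 < k \<Longrightarrow> k < n \<Longrightarrow> (f ^^ k) x \<notin> A" "\<And>y. f y \<notin> A \<Longrightarrow> g y = f y"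
    and "(f ^^ n) x = z" "\<And>y. f y = z \<Longrightarrow> g y = z'"
  shows "z' \<in> orbit g x"
proof -
  obtain m where m: "n = Suc m"
    using assms(1) gr0_implies_Suc by auto
  have "(g ^^ m) x = (f ^^ m) x"
    by (rule funpow_agree[OF assms(2,3)]) (use m in auto)
  moreover have "f ((f ^^ m) x) = z"
    using assms(4) m by simp
  ultimately have "(g ^^ n) x = z'"
    using assms(5) m by simp
  then show ?thesis
    using assms(1) by (auto simp: orbit_altdef)
qed

text \<open>Since \<open>b\<close> is on another cycle, the cycle of \<open>a\<close> first meets
  \<open>{a, b}\<close> again in \<open>a\<close>, and there the new permutation goes to
  \<open>b\<close> instead.\<close>

lemma orbit_transposition_merge:
  assumes f: "permutation f" and ab: "b \<notin> orbit f a"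
  shows "b \<in> orbit (transpose a b \<circ> f) a"
proof -
  have a: "a \<in> orbit f a"
    using f by (rule permutation_self_in_orbit)
  obtain n where n: "0 < n" "(f ^^ n) a \<in> {a, b}" "\<And>k. 0 < k \<Longrightarrow> k < n \<Longrightarrow> (f ^^ k) a \<notin> {a, b}"
    using orbit_first_hit[OF a, of "{a, b}"] by blast
  moreover have "(f ^^ n) a \<noteq> b"
    using n(1) ab by (auto simp: orbit_altdef)
  ultimately have "(f ^^ n) a = a"
    by auto
  from orbit_redirect[OF n(1,3) _ this, of "transpose a b \<circ> f" b] show ?thesis
    by auto
qed

text \<open>The transposition closes the arc from \<open>a\<close> to \<open>b\<close> up at
  \<open>a\<close>, before it reaches \<open>b\<close>.\<close>

lemma orbit_transposition_split:
  assumes f: "permutation f" and ab: "b \<in> orbit f a" "a \<noteq> b"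
  shows "b \<notin> orbit (transpose a b \<circ> f) a"
proof -
  let ?g = "transpose a b \<circ> f"
  obtain n where n: "0 < n" "(f ^^ n) a \<in> {a, b}" "\<And>k. 0 < k \<Longrightarrow> k < n \<Longrightarrow> (f ^^ k) a \<notin> {a, b}"
    using orbit_first_hit[OF ab(1), of "{a, b}"] by blast
  obtain m where m: "n = Suc m"
    using n(1) gr0_implies_Suc by auto
  have agree: "(?g ^^ k) a = (f ^^ k) a" if "k < n" for k
    by (rule funpow_agree[OF n(3) _ that]) (auto simp: transpose_def)
  show ?thesis
  proof (cases "(f ^^ n) a = a")
    case True
    have "(f ^^ k) a \<noteq> b" for k
    proof -
      have "(f ^^ k) a = (f ^^ (k mod n)) a"
        using True by (simp add: funpow_mod_eq)
      moreover have "k mod n < n"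
        using n(1) by simp
      ultimately show ?thesis
        using n(3)[of "k mod n"] ab(2) by (cases "k mod n") auto
    qed
    then show ?thesis
      using ab(1) by (auto simp: orbit_altdef)
  next
    case False
    then have "(f ^^ n) a = b"
      using n(2) by auto
    then have g: "(?g ^^ n) a = a"
      using agree[of m] m by simp
    have g': "b \<noteq> (?g ^^ k) a" for k
    proof -
      have "(?g ^^ k) a = (?g ^^ (k mod n)) a"
        using g by (simp add: funpow_mod_eq)
      moreover have "k mod n < n"
        using n(1) by simp
      ultimately show ?thesis
        using n(3)[of "k mod n"] agree[of "k mod n"] ab(2) by (cases "k mod n") auto
    qed
    show ?thesis
      unfolding orbit_altdef mem_Collect_eq using g' by iprover
  qed
qed

text \<open>Cut two cycles \<open>(a \<dots> c \<dots>)\<close> and \<open>(b \<dots> d \<dots>)\<close> at all four points: the arc from \<open>a\<close>, which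
  ended in \<open>c\<close>, now ends in \<open>d\<close>.\<close>

lemma orbit_two_transpositions:
  assumes f: "permutation f" and c: "c \<in> orbit f a" and b: "b \<notin> orbit f a" and d: "d \<notin> orbit f a"
    and ac: "a \<noteq> c"
  shows "d \<in> orbit (transpose c d \<circ> transpose a b \<circ> f) a"
proof -
  let ?g = "transpose c d \<circ> transpose a b \<circ> f"
  have a: "a \<in> orbit f a"
    using f by (rule permutation_self_in_orbit)
  obtain n where n: "0 < n" "(f ^^ n) a \<in> {c}" "\<And>k. 0 < k \<Longrightarrow> k < n \<Longrightarrow> (f ^^ k) a \<notin> {c}"
    using orbit_first_hit[OF c, of "{c}"] by blast
  have orb: "(f ^^ k) a \<in> orbit f a" for k
    using funpow_in_orbit[OF a] .
  \<comment> \<open>A return to \<open>a\<close> before time \<open>n\<close> would make the path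
    periodic and bring \<open>c\<close> up earlier than at its first visit.\<close>
  have na: "(f ^^ k) a \<noteq> a" if k: "0 < k" "k < n" for k
  proof
    assume eq: "(f ^^ k) a = a"
    have "(f ^^ n) a = (f ^^ (n mod k)) a"
      using eq by (simp add: funpow_mod_eq)
    moreover have "n mod k < n"
      using k mod_less_divisor[of k n] by linarith
    ultimately show False
      using n(2) n(3)[of "n mod k"] ac by (cases "n mod k") auto
  qed
  have 1: "(f ^^ k) a \<notin> {a, b, c, d}" if "0 < k" "k < n" for k
    using that n(3)[of k] na[of k] orb[of k] b d by auto
  show ?thesis
  proof (rule orbit_redirect[OF n(1) 1])
    show "(f ^^ n) a = c"
      using n(2) by simp
  qed (use ac b c d in \<open>auto simp: transpose_def\<close>)
qed

section \<open>Coherent orientations of the half-edges\<close>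

text \<open>The results on permutations concern maps of the whole type, so a map that permutes only
  the finite set \<open>A\<close> is replaced by the identity outside of it.\<close>

lemma restrict_id_permutes:
  assumes "finite A" "f ` A \<subseteq> A" "inj_on f A"
  shows "restrict_id f A permutes A"
  by (rule permutes_restrict_id) (use assms in \<open>simp add: bij_betw_def endo_inj_surj\<close>)

lemma restrict_id_orbit:
  assumes "f ` A \<subseteq> A" "x \<in> A"
  shows "orbit (restrict_id f A) x = orbit f x"
  by (rule orbit_cong0[OF assms(2), symmetric]) (use assms in \<open>auto simp: restrict_id_def\<close>)

lemma self_in_orbit_inj:
  assumes "finite A" "f ` A \<subseteq> A" "inj_on f A" "x \<in> A"
  shows "x \<in> orbit f x"
proof -
  have "permutation (restrict_id f A)"
    using restrict_id_permutes[OF assms(1-3)] assms(1) permutation_permutes by blast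
  from permutation_self_in_orbit[OF this, of x] show ?thesis
    using restrict_id_orbit[OF assms(2,4)] by simp
qed

lemma orbit_subset_closed:
  assumes "f ` A \<subseteq> A" "x \<in> A"
  shows "orbit f x \<subseteq> A"
proof
  fix y assume "y \<in> orbit f x"
  then show "y \<in> A"
    by induction (use assms in auto)
qed

lemma orbit_eq_if_mem:
  assumes "finite A" "f ` A \<subseteq> A" "inj_on f A" "x \<in> A" "y \<in> orbit f x"
  shows "orbit f y = orbit f x"
proof
  have x: "x \<in> orbit f x"
    by (rule self_in_orbit_inj) fact+
  show "orbit f y \<subseteq> orbit f x"
    using assms(5) by (auto intro: orbit_trans)
  have "x \<in> orbit f y"
    using x assms(5) by (rule orbit_swap)
  then show "orbit f x \<subseteq> orbit f y"
    by (auto intro: orbit_trans)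
qed

text \<open>Boundary walks are orbits of the permutation \<open>angle \<circ> other_end A\<close>,
  which \<open>other_end A\<close> conjugates to its inverse. Hence \<open>other_end A\<close>
  exchanges the two walks around a cell, exactly one of which is chosen. The walk leaving along
  \<open>other_end A h\<close> arrives at \<open>h\<close> and leaves again along
  \<open>angle h\<close>, which gives the second claim.\<close>

lemma cells_orientation_alternates:
  assumes fin: "finite (frame A)"
    and e: "\<And>h. h \<in> frame A \<Longrightarrow> other_end A h \<in> frame A \<and> other_end A (other_end A h) = h"
    and a: "\<And>h. h \<in> frame A \<Longrightarrow> angle h \<in> frame A \<and> angle (angle h) = h"
    and Os: "cells_orientation A angle Os"
    and h: "h \<in> frame A"
  shows "other_end A h \<in> \<Union>Os \<longleftrightarrow> h \<notin> \<Union>Os" "angle h \<in> \<Union>Os \<longleftrightarrow> h \<notin> \<Union>Os"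
proof -
  let ?F = "frame A" and ?e = "other_end A" and ?f = "\<lambda>x. angle (other_end A x)"
  have cl: "?f ` ?F \<subseteq> ?F"
    using e a by auto
  have inj: "inj_on ?f ?F"
    by (rule inj_onI) (metis e a)
  have self: "x \<in> orbit ?f x" if "x \<in> ?F" for x
    by (rule self_in_orbit_inj[OF fin cl inj that])
  have orbeq: "orbit ?f y = orbit ?f x" if "x \<in> ?F" "y \<in> orbit ?f x" for x y
    by (rule orbit_eq_if_mem[OF fin cl inj that])
  have mem: "x \<in> \<Union>Os \<longleftrightarrow> orbit ?f x \<in> Os" if x: "x \<in> ?F" for x
  proof
    assume "x \<in> \<Union>Os"
    then obtain y where "x \<in> orbit ?f y" "orbit ?f y \<in> Os" "y \<in> ?F"
      using Os by (auto simp: cells_orientation_def cell_boundaries_def)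
    then show "orbit ?f x \<in> Os"
      using orbeq[of y x] by simp
  next
    assume "orbit ?f x \<in> Os"
    then show "x \<in> \<Union>Os"
      using self[OF x] by auto
  qed
  have prev: "?e (?f x) \<in> orbit ?f (?e x)" if x: "x \<in> ?F" for x
  proof -
    have "?f (?e (?f x)) = ?e x"
      using e[OF x] a[of "?e x"] e[of "?f x"] by simp
    then have "?e x \<in> orbit ?f (?e (?f x))"
      using orbit.base[of ?f "?e (?f x)"] by simp
    moreover have "?e (?f x) \<in> ?F"
      using x e a by blast
    ultimately show ?thesis
      using self orbit_swap by metis
  qed
  have sub: "?e y \<in> orbit ?f (?e x)" if x: "x \<in> ?F" and "y \<in> orbit ?f x" for x y
    using that(2)
  proof induction
    case base
    show ?case by (rule prev[OF x])
  next
    case (step y)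
    then have "y \<in> ?F"
      using orbit_subset_closed[OF cl x] by auto
    from prev[OF this] step.IH show ?case
      by (rule orbit_trans)
  qed
  have img: "?e ` orbit ?f x = orbit ?f (?e x)" if x: "x \<in> ?F" for x
  proof
    show "?e ` orbit ?f x \<subseteq> orbit ?f (?e x)"
      using sub[OF x] by auto
    show "orbit ?f (?e x) \<subseteq> ?e ` orbit ?f x"
    proof
      fix z assume z: "z \<in> orbit ?f (?e x)"
      have "?e x \<in> ?F" "?e (?e x) = x"
        using e x by auto
      then have "?e z \<in> orbit ?f x" "z \<in> ?F"
        using sub[of "?e x" z] z orbit_subset_closed[OF cl, of "?e x"] by auto
      then show "z \<in> ?e ` orbit ?f x"
        using e by (metis imageI)
    qed
  qed
  have flip: "?e x \<in> \<Union>Os \<longleftrightarrow> x \<notin> \<Union>Os" if x: "x \<in> ?F" for x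
  proof -
    have "orbit ?f x \<in> cell_boundaries A angle"
      using x by (auto simp: cell_boundaries_def)
    then have "orbit ?f x \<in> Os \<longleftrightarrow> ?e ` orbit ?f x \<notin> Os"
      using Os by (auto simp: cells_orientation_def)
    then show ?thesis
      using mem[OF x] mem[of "?e x"] e[OF x] img[OF x] by auto
  qed
  show "?e h \<in> \<Union>Os \<longleftrightarrow> h \<notin> \<Union>Os"
    by (rule flip[OF h])
  have eh: "?e h \<in> ?F" "?f (?e h) = angle h"
    using e[OF h] by auto
  have "angle h \<in> orbit ?f (?e h)"
    using orbit.base[of ?f "?e h"] eh by simp
  then have "orbit ?f (angle h) = orbit ?f (?e h)"
    using orbeq[OF eh(1)] by simp
  then have "angle h \<in> \<Union>Os \<longleftrightarrow> ?e h \<in> \<Union>Os"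
    using mem eh(1) a[OF h] by simp
  then show "angle h \<in> \<Union>Os \<longleftrightarrow> h \<notin> \<Union>Os"
    using flip[OF h] by simp
qed

lemma straight_straight [simp]: "straight (straight h) = h"
  by (cases h; cases "case h of At v c \<Rightarrow> c | _ \<Rightarrow> UL") auto

locale valid_diagram =
  fixes K :: "'v diagram"
  assumes virtual_diagram: "virtual_diagram K"
begin

lemma finite_crossings: "finite (crossings K)"
  using virtual_diagram by (simp add: virtual_diagram_def)

lemma finite_half_edges: "finite (half_edges K)"
proof -
  have "UNIV = {UL, UR, LL, LR}"
    using corner.exhaust by blast
  then have "finite (UNIV :: corner set)"
    by (metis finite.emptyI finite.insertI)
  then have "finite ((\<lambda>(v, c). At v c) ` (crossings K \<times> (UNIV :: corner set)) \<union>
      (\<lambda>(l, b). Loop l b) ` ({..<loops K} \<times> UNIV) :: 'v half_edge set)"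
    using finite_crossings by auto
  moreover have "half_edges K \<subseteq> (\<lambda>(v, c). At v c) ` (crossings K \<times> (UNIV :: corner set)) \<union>
      (\<lambda>(l, b). Loop l b) ` ({..<loops K} \<times> UNIV)"
    by (auto simp: half_edges_def vertex_half_edges_def)
  ultimately show ?thesis
    by (rule finite_subset[rotated])
qed

lemma mate_in [simp]: "h \<in> half_edges K \<Longrightarrow> mate K h \<in> half_edges K"
  and mate_mate [simp]: "h \<in> half_edges K \<Longrightarrow> mate K (mate K h) = h"
  and outgoing_mate: "h \<in> half_edges K \<Longrightarrow> outgoing (mate K h) \<longleftrightarrow> \<not> outgoing h"
  using virtual_diagram unfolding virtual_diagram_def by blast+

lemma straight_in [simp]: "straight h \<in> half_edges K \<longleftrightarrow> h \<in> half_edges K"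
  by (cases h) (auto simp: half_edges_def vertex_half_edges_def)

lemma straight_classical [simp]:
  "straight h \<in> classical_half_edges K \<longleftrightarrow> h \<in> classical_half_edges K"
  by (cases h) (auto simp: classical_half_edges_def)

lemma classical_half_edges_subset: "classical_half_edges K \<subseteq> half_edges K"
  by (auto simp: classical_half_edges_def half_edges_def vertex_half_edges_def classical_def)

lemma mate_Loop: "l < loops K \<Longrightarrow> mate K (Loop l b) = Loop l (\<not> b)"
  using virtual_diagram by (simp add: virtual_diagram_def)

section \<open>Branches of the diagram between classical crossings\<close>

definition walk :: "'v half_edge \<Rightarrow> nat \<Rightarrow> 'v half_edge"
  where "walk h n = ((\<lambda>x. mate K (straight x)) ^^ n) (mate K h)"

text \<open>Fails for half-edges of components that pass no classical crossing; there the
  \<open>LEAST\<close> in \<open>branch_end\<close> is unspecified.\<close>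

definition reaches :: "'v half_edge \<Rightarrow> bool"
  where "reaches h \<longleftrightarrow> (\<exists>n. walk h n \<in> classical_half_edges K)"

lemma branch_end_eq: "branch_end K h = walk h (LEAST n. walk h n \<in> classical_half_edges K)"
  by (simp add: branch_end_def walk_def)

lemma walk_0: "walk h 0 = mate K h"
  by (simp add: walk_def)

lemma walk_Suc: "walk h (Suc n) = walk (straight (mate K h)) n"
  by (simp add: walk_def funpow_Suc_right del: funpow.simps)

lemma branch_end_classical:
  assumes "mate K h \<in> classical_half_edges K"
  shows "reaches h" "branch_end K h = mate K h"
proof -
  have 0: "walk h 0 \<in> classical_half_edges K"
    using assms by (simp add: walk_0)
  then show "reaches h"
    by (auto simp: reaches_def)
  have "(LEAST n. walk h n \<in> classical_half_edges K) = 0"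
    using 0 by (rule Least_eq_0)
  then show "branch_end K h = mate K h"
    by (simp add: branch_end_eq walk_0)
qed

lemma branch_end_virtual:
  assumes "mate K h \<notin> classical_half_edges K"
  shows "reaches h \<longleftrightarrow> reaches (straight (mate K h))"
    "reaches h \<Longrightarrow> branch_end K h = branch_end K (straight (mate K h))"
proof -
  have 0: "walk h 0 \<notin> classical_half_edges K"
    using assms by (simp add: walk_0)
  then show "reaches h \<longleftrightarrow> reaches (straight (mate K h))"
    unfolding reaches_def by (metis walk_Suc not0_implies_Suc)
  assume "reaches h"
  then obtain n where "walk h n \<in> classical_half_edges K"
    by (auto simp: reaches_def)
  from Least_Suc[of "\<lambda>n. walk h n \<in> classical_half_edges K", OF this 0]
  show "branch_end K h = branch_end K (straight (mate K h))"
    by (simp add: branch_end_eq walk_Suc)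
qed

text \<open>\<open>mate \<circ> straight\<close> permutes the finite set of half-edges. So the
  component, followed in the other direction, finally returns to the classical crossing of
  \<open>mate K h\<close>, through the half-edge opposite to it.\<close>

lemma reaches_classical:
  assumes h: "h \<in> half_edges K" and m: "mate K h \<in> classical_half_edges K"
  shows "reaches (mate K h)"
proof -
  let ?T = "\<lambda>x. mate K (straight x)"
  have T: "?T ` half_edges K \<subseteq> half_edges K"
    by auto
  have "inj_on ?T (half_edges K)"
    by (rule inj_onI) (metis mate_mate straight_in straight_straight)
  from self_in_orbit_inj[OF finite_half_edges T this h]
  obtain p where p: "0 < p" "(?T ^^ p) h = h"
    by (auto simp: orbit_altdef)
  then obtain q where q: "p = Suc q"
    using gr0_implies_Suc by auto
  let ?y = "(?T ^^ q) h"
  have "(?T ^^ k) h \<in> half_edges K" for k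
    by (induction k) (use h in auto)
  moreover have "mate K (straight ?y) = h"
    using p q by simp
  ultimately have "straight ?y = mate K h"
    by (metis mate_mate straight_in)
  then have "?y \<in> classical_half_edges K"
    using m by (metis straight_classical)
  moreover have "walk (mate K h) q = ?y"
    using h by (simp add: walk_def)
  ultimately show ?thesis
    unfolding reaches_def by (intro exI[of _ q]) simp
qed

text \<open>A branch has two classical ends, one reached along \<open>h\<close> and one along
  \<open>mate K h\<close>. Passing a virtual crossing changes neither of them, which is the
  induction step.\<close>

lemma branch_end_branch_end:
  assumes "h \<in> half_edges K" "reaches h"
  shows "reaches (mate K h) \<and> branch_end K h \<in> classical_half_edges K \<and>
    branch_end K (branch_end K h) = branch_end K (mate K h)"
proof -
  obtain n where "walk h n \<in> classical_half_edges K"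
    using assms(2) by (auto simp: reaches_def)
  then show ?thesis
    using assms(1)
  proof (induction n arbitrary: h)
    case 0
    then have "mate K h \<in> classical_half_edges K"
      by (simp add: walk_0)
    then show ?case
      using reaches_classical[of h] branch_end_classical 0 by simp
  next
    case (Suc n)
    show ?case
    proof (cases "mate K h \<in> classical_half_edges K")
      case True
      then show ?thesis
        using reaches_classical[of h] branch_end_classical Suc.prems by simp
    next
      case False
      let ?h' = "straight (mate K h)"
      have h': "?h' \<in> half_edges K" "walk ?h' n \<in> classical_half_edges K"
        using Suc.prems by (auto simp: walk_Suc)
      note IH = Suc.IH[OF h'(2,1)]
      have "mate K (mate K ?h') \<notin> classical_half_edges K" "straight (mate K (mate K ?h')) = mate K h"
        using False h' by auto
      then have "reaches (mate K h)" "branch_end K (mate K ?h') = branch_end K (mate K h)"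
        using branch_end_virtual[of "mate K ?h'"] IH by auto
      moreover have "branch_end K h = branch_end K ?h'"
        using branch_end_virtual[OF False] h'(2) by (auto simp: reaches_def)
      ultimately show ?thesis
        using IH by simp
    qed
  qed
qed

lemma branch_end_involution:
  assumes "h \<in> classical_half_edges K"
  shows "reaches h" "branch_end K h \<in> classical_half_edges K"
    "branch_end K (branch_end K h) = h"
proof -
  have h: "h \<in> half_edges K" "mate K (mate K h) \<in> classical_half_edges K"
    using assms classical_half_edges_subset by auto
  then show "reaches h"
    using reaches_classical[of "mate K h"] by simp
  then show "branch_end K h \<in> classical_half_edges K" "branch_end K (branch_end K h) = h"
    using branch_end_branch_end[OF h(1)] branch_end_classical(2)[OF h(2)] h(1) by auto
qed

text \<open>A source-sink structure: opposite half-edges at a classical crossing lie in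
  \<open>G\<close> both or not at all (\<open>corner_G\<close>), whereas at a virtual crossing
  exactly one of them does.\<close>

definition coherent :: "'v half_edge set \<Rightarrow> bool"
  where "coherent G \<longleftrightarrow> G \<subseteq> half_edges K \<and>
    (\<forall>h\<in>half_edges K. (mate K h \<in> G \<longleftrightarrow> h \<notin> G) \<and> (\<forall>s. turn K s h \<in> G \<longleftrightarrow> h \<notin> G))"

lemma turn_classical:
  assumes "h \<in> classical_half_edges K"
  shows "turn K s h \<in> {black_at K h, white_at K h}"
  using assms by (auto simp: classical_half_edges_def classical_def)

lemma black_white_at:
  assumes "h \<in> classical_half_edges K"
  shows "black_at K h \<in> classical_half_edges K" "black_at K (black_at K h) = h"
    "white_at K h \<in> classical_half_edges K" "white_at K (white_at K h) = h"
proof -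
  obtain v c where h: "h = At v c" "v \<in> classical K"
    using assms by (auto simp: classical_half_edges_def)
  show "black_at K h \<in> classical_half_edges K" "white_at K h \<in> classical_half_edges K"
    using h by (auto simp: classical_half_edges_def)
  show "black_at K (black_at K h) = h" "white_at K (white_at K h) = h"
    using h by (cases c; simp add: over_corners_def)+
qed

text \<open>The clause on \<open>outgoing\<close> serves the components without classical crossings,
  on which \<open>G\<close> will follow the orientation of \<open>K\<close>.\<close>

lemma turn_not_classical:
  assumes "h \<in> half_edges K" "h \<notin> classical_half_edges K"
  shows "(turn K s h = straight h \<and> outgoing (straight h) = (\<not> outgoing h)) \<or> turn K s h = mate K h"
proof (cases h)
  case (At v c)
  then have "kind K v = Virtual"
    using assms by (auto simp: classical_half_edges_def classical_def half_edges_def vertex_half_edges_def)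
  then show ?thesis
    using At by (cases c) auto
next
  case (Loop l b)
  then show ?thesis
    using assms by (auto simp: half_edges_def vertex_half_edges_def mate_Loop)
qed

lemma orientable_imp_coherent:
  assumes "orientable_atom (atom_of K)"
  obtains G where "coherent G"
proof -
  let ?H = "half_edges K" and ?CH = "classical_half_edges K" and ?e = "branch_end K"
  obtain Bs Ws where
    B: "cells_orientation (atom_of K) (black_at K) Bs" and
    W: "cells_orientation (atom_of K) (white_at K) Ws" and
    BW: "\<And>h. h \<in> ?CH \<Longrightarrow> h \<in> \<Union>Bs \<longleftrightarrow> ?e h \<in> \<Union>Ws"
    using assms by (auto simp: orientable_atom_def atom_of_def)
  have fin: "finite ?CH"
    using classical_half_edges_subset finite_half_edges by (rule finite_subset)
  have "?e h \<in> \<Union>Bs \<longleftrightarrow> h \<notin> \<Union>Bs" "black_at K h \<in> \<Union>Bs \<longleftrightarrow> h \<notin> \<Union>Bs"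
    "?e h \<in> \<Union>Ws \<longleftrightarrow> h \<notin> \<Union>Ws" "white_at K h \<in> \<Union>Ws \<longleftrightarrow> h \<notin> \<Union>Ws" if "h \<in> ?CH" for h
    using cells_orientation_alternates[OF _ _ _ B, of h] cells_orientation_alternates[OF _ _ _ W, of h]
      fin that branch_end_involution black_white_at by (auto simp: atom_of_def)
  \<comment> \<open>By \<open>BW\<close> the sets \<open>\<Union>Bs\<close> and
    \<open>\<Union>Ws\<close> are complementary on the frame. Membership in
    \<open>\<Union>Bs\<close> therefore alternates across white angles as well as across black
    ones.\<close>
  then have e: "?e h \<in> \<Union>Bs \<longleftrightarrow> h \<notin> \<Union>Bs" and
    turn: "turn K s h \<in> \<Union>Bs \<longleftrightarrow> h \<notin> \<Union>Bs" if "h \<in> ?CH" for h s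
    using BW that black_white_at[OF that] turn_classical[OF that, of s] by (metis, metis empty_iff insert_iff)
  \<comment> \<open>On a branch the choice is dictated by the classical end ahead of
    \<open>h\<close>: the two ends of a branch alternate, so \<open>h\<close> is treated like the
    end behind it. Components without such an end get the orientation of \<open>K\<close>.\<close>
  define G where "G = {h \<in> ?H. if reaches h then ?e h \<notin> \<Union>Bs else outgoing h}"
  have mate: "mate K h \<in> G \<longleftrightarrow> h \<notin> G" if h: "h \<in> ?H" for h
  proof (cases "reaches h")
    case True
    from branch_end_branch_end[OF h this] show ?thesis
      using True h e[of "?e h"] by (auto simp: G_def)
  next
    case False
    then have "\<not> reaches (mate K h)"
      using branch_end_branch_end[of "mate K h"] h by auto
    then show ?thesis
      using False h outgoing_mate by (auto simp: G_def)
  qed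
  have clG: "h \<in> G \<longleftrightarrow> h \<in> \<Union>Bs" if "h \<in> ?CH" for h
    using that e[OF that] branch_end_involution(1)[OF that] classical_half_edges_subset
    by (auto simp: G_def)
  have "turn K s h \<in> G \<longleftrightarrow> h \<notin> G" if h: "h \<in> ?H" for h s
  proof (cases "h \<in> ?CH")
    case True
    then have "turn K s h \<in> ?CH"
      using turn_classical[of h s] black_white_at by auto
    then show ?thesis
      using True clG turn by simp
  next
    case False
    have st: "straight h \<in> G \<longleftrightarrow> mate K h \<in> G" if o: "outgoing (straight h) = (\<not> outgoing h)"
      using branch_end_virtual[of "mate K h"] False h o outgoing_mate[OF h] by (auto simp: G_def)
    show ?thesis
      using turn_not_classical[OF h False, of s] st mate[OF h] by auto
  qed
  then have "coherent G"
    using mate by (auto simp: coherent_def G_def)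
  then show thesis
    by (rule that)
qed

end

section \<open>Circles of a state and their resmoothings\<close>

locale coherent_diagram = valid_diagram K for K :: "'v diagram" +
  fixes G :: "'v half_edge set"
  assumes coherent: "coherent G"
begin

abbreviation H :: "'v half_edge set" where "H \<equiv> half_edges K"
abbreviation circ :: "'v set \<Rightarrow> 'v half_edge \<Rightarrow> 'v half_edge set" where "circ \<equiv> circle_at K"
abbreviation ul :: "'v \<Rightarrow> 'v half_edge" where "ul v \<equiv> At v UL"
abbreviation lr :: "'v \<Rightarrow> 'v half_edge" where "lr v \<equiv> At v LR"

definition next_on :: "'v set \<Rightarrow> 'v half_edge \<Rightarrow> 'v half_edge"
  where "next_on s x = turn K s (mate K x)"

text \<open>A split is a merge read backwards. Allowing both directions lets a face of the cube be
  studied from whichever of its four states is most convenient.\<close>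

definition flip :: "'v \<Rightarrow> 'v set \<Rightarrow> 'v set"
  where "flip v s = (if v \<in> s then s - {v} else insert v s)"

lemma flip_flip [simp]: "flip v (flip v s) = s"
  by (auto simp: flip_def)

lemma flip_commute: "flip u (flip v s) = flip v (flip u s)"
  by (auto simp: flip_def)

lemma G_subset: "G \<subseteq> H"
  and mate_G: "h \<in> H \<Longrightarrow> mate K h \<in> G \<longleftrightarrow> h \<notin> G"
  and turn_G: "h \<in> H \<Longrightarrow> turn K s h \<in> G \<longleftrightarrow> h \<notin> G"
  using coherent by (auto simp: coherent_def)

lemma corner_in [simp]: "v \<in> classical K \<Longrightarrow> At v c \<in> H"
  by (auto simp: half_edges_def vertex_half_edges_def classical_def)

lemma turn_in [simp]: "h \<in> H \<Longrightarrow> turn K s h \<in> H"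
  by (cases h) (auto simp: half_edges_def vertex_half_edges_def)

lemma turn_turn [simp]: "turn K s (turn K s h) = h"
proof (cases h)
  case (At v c)
  then show ?thesis
    by (cases c; cases "kind K v") (auto simp: over_corners_def)
qed simp

lemma next_on_H: "next_on s ` H \<subseteq> H"
  by (auto simp: next_on_def)

lemma next_on_G: "next_on s ` G \<subseteq> G"
  using G_subset mate_G turn_G by (auto simp: next_on_def)

lemma next_on_inj: "inj_on (next_on s) H"
  by (rule inj_onI) (metis mate_mate next_on_def turn_turn)

lemma self_in_orbit_next_on: "h \<in> H \<Longrightarrow> h \<in> orbit (next_on s) h"
  by (rule self_in_orbit_inj[OF finite_half_edges next_on_H next_on_inj])

lemma orbit_next_on_eq: "h \<in> H \<Longrightarrow> k \<in> orbit (next_on s) h \<Longrightarrow> orbit (next_on s) k = orbit (next_on s) h"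
  by (rule orbit_eq_if_mem[OF finite_half_edges next_on_H next_on_inj])

lemma oriented_circle_eq: "oriented_circle K s h = orbit (next_on s) h"
  by (simp add: oriented_circle_def next_on_def[abs_def])

text \<open>\<open>mate\<close> conjugates \<open>next_on s\<close> to its inverse, that is, it
  reverses an oriented circle.\<close>

lemma mate_orbit_subset:
  assumes h: "h \<in> H"
  shows "mate K ` orbit (next_on s) h \<subseteq> orbit (next_on s) (mate K h)"
proof -
  have prev: "mate K (next_on s x) \<in> orbit (next_on s) (mate K x)" if x: "x \<in> H" for x
  proof -
    have "next_on s (mate K (next_on s x)) = mate K x"
      using x by (simp add: next_on_def)
    then have "mate K x \<in> orbit (next_on s) (mate K (next_on s x))"
      using orbit.base[of "next_on s" "mate K (next_on s x)"] by simp
    moreover have "mate K (next_on s x) \<in> H"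
      using x by (simp add: next_on_def)
    ultimately show ?thesis
      using self_in_orbit_next_on orbit_swap by metis
  qed
  have "mate K y \<in> orbit (next_on s) (mate K h)" if "y \<in> orbit (next_on s) h" for y
    using that
  proof induction
    case base
    show ?case by (rule prev[OF h])
  next
    case (step y)
    then have "y \<in> H"
      using orbit_subset_closed[OF next_on_H h] by auto
    from prev[OF this] step.IH show ?case
      by (rule orbit_trans)
  qed
  then show ?thesis by auto
qed

lemma mate_orbit:
  assumes h: "h \<in> H"
  shows "mate K ` orbit (next_on s) h = orbit (next_on s) (mate K h)"
proof
  show "orbit (next_on s) (mate K h) \<subseteq> mate K ` orbit (next_on s) h"
  proof
    fix z assume z: "z \<in> orbit (next_on s) (mate K h)"
    then have "mate K z \<in> orbit (next_on s) h" "z \<in> H"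
      using mate_orbit_subset[of "mate K h" s] h orbit_subset_closed[OF next_on_H, of "mate K h" s] by auto
    then show "z \<in> mate K ` orbit (next_on s) h"
      by (metis imageI mate_mate)
  qed
qed (rule mate_orbit_subset[OF h])

lemma circ_eq: "h \<in> H \<Longrightarrow> circ s h = orbit (next_on s) h \<union> orbit (next_on s) (mate K h)"
  by (simp add: circle_at_def oriented_circle_eq mate_orbit)

lemma circ_subset: "h \<in> H \<Longrightarrow> circ s h \<subseteq> H"
  using orbit_subset_closed[OF next_on_H] by (simp add: circ_eq)

lemma self_in_circ [simp]: "h \<in> H \<Longrightarrow> h \<in> circ s h"
  using self_in_orbit_next_on by (simp add: circ_eq)

lemma circ_mate [simp]: "h \<in> H \<Longrightarrow> circ s (mate K h) = circ s h"
  by (auto simp: circ_eq)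

lemma circ_eq_if_mem:
  assumes "h \<in> H" "k \<in> circ s h"
  shows "circ s k = circ s h"
proof -
  have k: "k \<in> H"
    using assms circ_subset by auto
  have *: "circ s k = circ s x" if "x \<in> H" "k \<in> orbit (next_on s) x" for x
  proof -
    have "orbit (next_on s) k = orbit (next_on s) x"
      by (rule orbit_next_on_eq[OF that])
    then show ?thesis
      using mate_orbit[OF k, of s] mate_orbit[OF that(1), of s] k that(1) by (simp add: circ_eq)
  qed
  show ?thesis
    using assms *[of h] *[of "mate K h"] by (auto simp: circ_eq)
qed

lemma circ_eq_iff: "h \<in> H \<Longrightarrow> k \<in> H \<Longrightarrow> circ s k = circ s h \<longleftrightarrow> k \<in> circ s h"
  using circ_eq_if_mem self_in_circ by metis

lemma circ_turn [simp]: "h \<in> H \<Longrightarrow> circ s (turn K s h) = circ s h"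
proof -
  assume h: "h \<in> H"
  have "next_on s (mate K h) \<in> orbit (next_on s) (mate K h)"
    by (rule orbit.base)
  then have "turn K s h \<in> circ s h"
    using h by (simp add: next_on_def circ_eq)
  then show ?thesis
    using circ_eq_if_mem h by blast
qed

text \<open>\<open>next_on s\<close> maps \<open>G\<close> into itself and \<open>mate\<close> maps
  \<open>G\<close> to its complement in \<open>H\<close>, so of the two orientations of a circle one
  lies in \<open>G\<close> and the other avoids it.\<close>

lemma circ_Int_G:
  assumes "h \<in> G"
  shows "circ s h \<inter> G = orbit (next_on s) h" "circ s h - G = mate K ` orbit (next_on s) h"
proof -
  have h: "h \<in> H" and sub: "orbit (next_on s) h \<subseteq> G"
    using assms G_subset orbit_subset_closed[OF next_on_G] by auto
  have "mate K ` orbit (next_on s) h \<inter> G = {}"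
    using sub mate_G G_subset by auto
  then show "circ s h \<inter> G = orbit (next_on s) h" "circ s h - G = mate K ` orbit (next_on s) h"
    using sub h mate_orbit[OF h, of s] by (auto simp: circ_eq)
qed

lemma circ_eq_iff_orbit:
  assumes "h \<in> G" "k \<in> G"
  shows "circ s h = circ s k \<longleftrightarrow> k \<in> orbit (next_on s) h"
  using circ_Int_G(1)[OF assms(1), of s] circ_eq_iff[of h k s] assms G_subset by auto

lemma circlesE:
  assumes "C \<in> circles K s"
  obtains h where "h \<in> G" "C = circ s h"
proof -
  obtain h where h: "h \<in> H" "C = circ s h"
    using assms by (auto simp: circles_def)
  show thesis
  proof (cases "h \<in> G")
    case True
    with h that show thesis by blast
  next
    case False
    then have "mate K h \<in> G" "C = circ s (mate K h)"
      using h mate_G by auto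
    with that show thesis by blast
  qed
qed

lemma circ_in_circles [simp]: "h \<in> H \<Longrightarrow> circ s h \<in> circles K s"
  by (simp add: circles_def)

lemma finite_circles: "finite (circles K s)"
  using finite_half_edges by (simp add: circles_def)

text \<open>In particular the two orientations of a circle are different, so no generator
  \<open>X\<close> is identified with its own negative.\<close>

lemma orientations_eq:
  assumes C: "C \<in> circles K s"
  shows "orientations K s C = {C \<inter> G, C - G}" "mate K ` (C \<inter> G) = C - G" "mate K ` (C - G) = C \<inter> G"
    "C \<inter> G \<noteq> {}" "C - G \<noteq> {}"
proof -
  obtain h where h: "h \<in> G" "C = circ s h"
    using C by (rule circlesE)
  have hH: "h \<in> H"
    using h G_subset by auto
  let ?o = "orbit (next_on s) h"
  have o: "C \<inter> G = ?o" "C - G = mate K ` ?o" "C = ?o \<union> mate K ` ?o"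
    using circ_Int_G[OF h(1), of s] h(2) by auto
  have oH: "?o \<subseteq> H"
    by (rule orbit_subset_closed[OF next_on_H hH])
  have 1: "oriented_circle K s x = ?o" if "x \<in> ?o" for x
    unfolding oriented_circle_eq by (rule orbit_next_on_eq[OF hH that])
  have 2: "oriented_circle K s x = mate K ` ?o" if "x \<in> mate K ` ?o" for x
    using orbit_next_on_eq[of "mate K h" x s] that mate_orbit[OF hH, of s] hH
    by (simp add: oriented_circle_eq)
  have ne: "h \<in> ?o"
    by (rule self_in_orbit_next_on[OF hH])
  then have 3: "?o \<noteq> {}"
    by blast
  have "oriented_circle K s ` ?o = {?o}" "oriented_circle K s ` mate K ` ?o = {mate K ` ?o}"
    using 1 2 3 by (simp_all add: image_constant_conv cong: image_cong_simp)
  then have "oriented_circle K s ` (?o \<union> mate K ` ?o) = {?o, mate K ` ?o}"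
    unfolding image_Un by (simp add: insert_commute)
  then show "orientations K s C = {C \<inter> G, C - G}"
    using o by (simp add: orientations_def)
  show "mate K ` (C \<inter> G) = C - G"
    using o by simp
  have "mate K ` mate K ` ?o = ?o"
    using oH by (force simp: image_image)
  then show "mate K ` (C - G) = C \<inter> G"
    using o by simp
  show "C \<inter> G \<noteq> {}" "C - G \<noteq> {}"
    using o ne by auto
qed

text \<open>The end in \<open>G\<close> of the arc through \<open>UL\<close>. As circles are
  followed inside \<open>G\<close>, it represents this arc.\<close>

definition arc_ul :: "'v set \<Rightarrow> 'v \<Rightarrow> 'v half_edge"
  where "arc_ul s v = (if ul v \<in> G then ul v else turn K s (ul v))"

definition arc_lr :: "'v set \<Rightarrow> 'v \<Rightarrow> 'v half_edge"
  where "arc_lr s v = (if ul v \<in> G then lr v else turn K s (lr v))"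

text \<open>The two smoothings together join all pairs of adjacent corners, and membership in
  \<open>G\<close> changes across each pair.\<close>

lemma corner_G:
  assumes "v \<in> classical K"
  shows "At v LR \<in> G \<longleftrightarrow> At v UL \<in> G" "At v UR \<in> G \<longleftrightarrow> At v UL \<notin> G" "At v LL \<in> G \<longleftrightarrow> At v UL \<notin> G"
proof -
  have "kind K v = Positive \<or> kind K v = Negative"
    using assms by (cases "kind K v") (auto simp: classical_def)
  then show "At v LR \<in> G \<longleftrightarrow> At v UL \<in> G" "At v UR \<in> G \<longleftrightarrow> At v UL \<notin> G" "At v LL \<in> G \<longleftrightarrow> At v UL \<notin> G"
    using turn_G[of "At v UL" "{v}"] turn_G[of "At v UL" "{}"] turn_G[of "At v UR" "{v}"]
      turn_G[of "At v UR" "{}"] assms by (auto simp: over_corners_def)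
qed

lemma arcs_G:
  assumes "v \<in> classical K"
  shows "arc_ul s v \<in> G" "arc_lr s v \<in> G"
  using assms turn_G[of "At v UL" s] turn_G[of "At v LR" s] corner_G[OF assms]
  by (auto simp: arc_ul_def arc_lr_def)

lemma circ_arcs:
  assumes "v \<in> classical K"
  shows "circ s (arc_ul s v) = circ s (ul v)" "circ s (arc_lr s v) = circ s (lr v)"
  using assms by (auto simp: arc_ul_def arc_lr_def simp del: turn.simps)

text \<open>The same two half-edges of \<open>G\<close> represent the arcs before and after
  resmoothing. If they are \<open>UL\<close> and \<open>LR\<close>, each keeps its name; if they are
  \<open>UR\<close> and \<open>LL\<close>, the names are exchanged. This asymmetry is where
  membership of \<open>ul v\<close> in \<open>G\<close> enters the ladybug computation.\<close>

lemma arcs_cases: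
  assumes "v \<in> classical K"
  shows "arc_ul s v \<noteq> arc_lr s v"
    "At v c \<in> G \<longleftrightarrow> At v c \<in> {arc_ul s v, arc_lr s v}"
    "arc_ul (flip v s) v = (if ul v \<in> G then arc_ul s v else arc_lr s v)"
    "arc_lr (flip v s) v = (if ul v \<in> G then arc_lr s v else arc_ul s v)"
    "At v c \<notin> G \<Longrightarrow> turn K (flip v s) (At v c) = transpose (arc_ul s v) (arc_lr s v) (turn K s (At v c))"
proof -
  have "kind K v = Positive \<or> kind K v = Negative"
    using assms by (cases "kind K v") (auto simp: classical_def)
  then show "arc_ul s v \<noteq> arc_lr s v"
    "At v c \<in> G \<longleftrightarrow> At v c \<in> {arc_ul s v, arc_lr s v}"
    "arc_ul (flip v s) v = (if ul v \<in> G then arc_ul s v else arc_lr s v)"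
    "arc_lr (flip v s) v = (if ul v \<in> G then arc_lr s v else arc_ul s v)"
    "At v c \<notin> G \<Longrightarrow> turn K (flip v s) (At v c) = transpose (arc_ul s v) (arc_lr s v) (turn K s (At v c))"
    using corner_G[OF assms]
    by (cases c; auto simp: arc_ul_def arc_lr_def over_corners_def flip_def transpose_def)+
qed

lemma arcs_flip_other:
  assumes "u \<noteq> v"
  shows "arc_ul (flip u s) v = arc_ul s v" "arc_lr (flip u s) v = arc_lr s v"
  using assms by (auto simp: arc_ul_def arc_lr_def flip_def)

lemma arcs_vertex: "\<exists>c. arc_ul s v = At v c" "\<exists>c. arc_lr s v = At v c"
  by (auto simp: arc_ul_def arc_lr_def)

text \<open>Its cycles on \<open>G\<close> are the circles of \<open>s\<close>, each traversed once,
  in its preferred direction.\<close>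

definition circle_perm :: "'v set \<Rightarrow> 'v half_edge \<Rightarrow> 'v half_edge"
  where "circle_perm s = restrict_id (next_on s) G"

lemma permutation_circle_perm: "permutation (circle_perm s)"
proof -
  have "finite G"
    using G_subset finite_half_edges by (rule finite_subset)
  moreover have "circle_perm s permutes G"
    unfolding circle_perm_def
    using \<open>finite G\<close> next_on_G inj_on_subset[OF next_on_inj G_subset] by (rule restrict_id_permutes)
  ultimately show ?thesis
    by (auto simp: permutation_permutes)
qed

lemma circ_eq_iff_perm:
  assumes "h \<in> G" "k \<in> G"
  shows "circ s h = circ s k \<longleftrightarrow> k \<in> orbit (circle_perm s) h"
  using circ_eq_iff_orbit[OF assms] restrict_id_orbit[OF next_on_G assms(1)]
  by (simp add: circle_perm_def)

text \<open>A step from a half-edge of \<open>G\<close> arrives at one outside \<open>G\<close> and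
  turns back into \<open>G\<close>. At \<open>v\<close> there are only two half-edges of
  \<open>G\<close> to turn to, and resmoothing exchanges them.\<close>

lemma circle_perm_flip:
  assumes v: "v \<in> classical K"
  shows "circle_perm (flip v s) = transpose (arc_ul s v) (arc_lr s v) \<circ> circle_perm s"
proof
  fix x
  show "circle_perm (flip v s) x = (transpose (arc_ul s v) (arc_lr s v) \<circ> circle_perm s) x"
  proof (cases "x \<in> G")
    case False
    then have "x \<noteq> arc_ul s v" "x \<noteq> arc_lr s v"
      using arcs_G[OF v] by auto
    then show ?thesis
      using False by (simp add: circle_perm_def transpose_def)
  next
    case True
    then have m: "mate K x \<notin> G"
      using mate_G G_subset by auto
    have "turn K (flip v s) (mate K x) = transpose (arc_ul s v) (arc_lr s v) (turn K s (mate K x))"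
    proof (cases "\<exists>c. mate K x = At v c")
      case True
      then show ?thesis
        using arcs_cases(5)[OF v] m by metis
    next
      case other: False
      obtain a b where ab: "arc_ul s v = At v a" "arc_lr s v = At v b"
        using arcs_vertex[of s v] by auto
      show ?thesis
        using other by (cases "mate K x") (auto simp: flip_def ab transpose_def)
    qed
    then show ?thesis
      using True by (simp add: circle_perm_def next_on_def)
  qed
qed

text \<open>As \<open>two_at_flip\<close> excludes the type \<open>1 \<rightarrow> 1\<close>, the resmoothing at \<open>v\<close> is of type \<open>2 \<rightarrow> 1\<close> if this
  holds and of type \<open>1 \<rightarrow> 2\<close> otherwise.\<close>

definition two_at :: "'v set \<Rightarrow> 'v \<Rightarrow> bool"
  where "two_at s v \<longleftrightarrow> circ s (ul v) \<noteq> circ s (lr v)"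

lemma two_at_iff:
  assumes "v \<in> classical K"
  shows "two_at s v \<longleftrightarrow> arc_lr s v \<notin> orbit (circle_perm s) (arc_ul s v)"
  unfolding two_at_def circ_arcs[OF assms, of s, symmetric] circ_eq_iff_perm[OF arcs_G[OF assms]] ..

text \<open>Composing a permutation with a transposition always joins the cycles of the two points
  or separates the points; there is no third possibility.\<close>

lemma two_at_flip:
  assumes v: "v \<in> classical K"
  shows "two_at (flip v s) v \<longleftrightarrow> \<not> two_at s v"
proof -
  let ?g = "circle_perm (flip v s)" and ?a = "arc_ul s v" and ?b = "arc_lr s v"
  have "two_at (flip v s) v \<longleftrightarrow> arc_lr (flip v s) v \<notin> orbit ?g (arc_ul (flip v s) v)"
    by (rule two_at_iff[OF v])
  also have "\<dots> \<longleftrightarrow> ?b \<notin> orbit ?g ?a"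
    using arcs_cases(3,4)[OF v, of s] orbit_sym[OF permutation_circle_perm[of "flip v s"]] by auto
  also have "\<dots> \<longleftrightarrow> \<not> two_at s v"
    using orbit_transposition_merge[OF permutation_circle_perm, of ?b s ?a]
      orbit_transposition_split[OF permutation_circle_perm, of ?b s ?a] arcs_cases(1)[OF v, of s]
      circle_perm_flip[OF v, of s] two_at_iff[OF v, of s] by auto
  finally show ?thesis .
qed

lemma circ_flip_unchanged:
  assumes v: "v \<in> classical K" and h: "h \<in> H" "circ s h \<noteq> circ s (ul v)" "circ s h \<noteq> circ s (lr v)"
  shows "circ (flip v s) h = circ s h"
proof -
  have *: "circ (flip v s) g = circ s g"
    if g: "g \<in> G" "circ s g \<noteq> circ s (ul v)" "circ s g \<noteq> circ s (lr v)" for g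
  proof -
    have gH: "g \<in> H"
      using g G_subset by auto
    have "orbit (circle_perm (flip v s)) g = orbit (circle_perm s) g"
      unfolding circle_perm_flip[OF v]
      by (rule orbit_transposition_unchanged[OF permutation_circle_perm])
         (use g circ_eq_iff_perm[OF g(1) arcs_G(1)[OF v]] circ_eq_iff_perm[OF g(1) arcs_G(2)[OF v]]
           circ_arcs[OF v] in metis)+
    then have "orbit (next_on (flip v s)) g = orbit (next_on s) g"
      unfolding circle_perm_def restrict_id_orbit[OF next_on_G g(1)] .
    then show ?thesis
      using mate_orbit[OF gH] gH by (metis circ_eq)
  qed
  show ?thesis
    using h *[of h] *[of "mate K h"] mate_G[of h] by auto
qed

text \<open>A circle of the new state that avoids \<open>v\<close> survives the resmoothing back and
  so is a circle of \<open>s\<close>. It could not contain \<open>UL\<close> or \<open>LR\<close>,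
  but the circle of \<open>h\<close> in \<open>s\<close> contains one of them.\<close>

lemma circ_flip_merged:
  assumes v: "v \<in> classical K" and two: "two_at s v"
    and h: "h \<in> H" "circ s h = circ s (ul v) \<or> circ s h = circ s (lr v)"
  shows "circ (flip v s) h = circ (flip v s) (ul v)"
proof (rule ccontr)
  assume ne: "circ (flip v s) h \<noteq> circ (flip v s) (ul v)"
  have "circ (flip v s) (ul v) = circ (flip v s) (lr v)"
    using two_at_flip[OF v, of s] two by (simp add: two_at_def)
  with ne have eq: "circ s h = circ (flip v s) h"
    using circ_flip_unchanged[OF v h(1), of "flip v s"] by simp
  have "ul v \<in> circ s h \<or> lr v \<in> circ s h"
    using h v circ_eq_iff by (metis corner_in self_in_circ)
  then show False
    using ne eq h v circ_eq_if_mem \<open>circ (flip v s) (ul v) = circ (flip v s) (lr v)\<close> by metis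
qed

text \<open>Merging at \<open>u\<close> identifies no circles other than the two at
  \<open>u\<close>, so these must be the two at \<open>v\<close>.\<close>

lemma two_at_common:
  assumes uv: "u \<in> classical K" "v \<in> classical K" and two: "two_at s u" "two_at s v" "\<not> two_at (flip u s) v"
  shows "{circ s (ul v), circ s (lr v)} = {circ s (ul u), circ s (lr u)}"
proof -
  let ?t = "flip u s"
  have eq: "circ ?t (ul v) = circ ?t (lr v)"
    using two(3) by (simp add: two_at_def)
  have uin: "ul u \<in> circ ?t h" if "circ s h = circ s (ul u) \<or> circ s h = circ s (lr u)" "h \<in> H" for h
    using circ_flip_merged[OF uv(1) two(1) that(2,1)] uv self_in_circ by (metis corner_in)
  have unch: "circ ?t h = circ s h \<and> ul u \<notin> circ s h"
    if "\<not> (circ s h = circ s (ul u) \<or> circ s h = circ s (lr u))" "h \<in> H" for h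
    using circ_flip_unchanged[OF uv(1) that(2), of s] circ_eq_if_mem[OF that(2), of "ul u" s] that by auto
  have ne: "circ s (ul v) \<noteq> circ s (lr v)"
    using two by (simp add: two_at_def)
  have in1: "circ s (ul v) \<in> {circ s (ul u), circ s (lr u)}"
    using unch[of "ul v"] unch[of "lr v"] uin[of "lr v"] eq ne uv by auto
  have in2: "circ s (lr v) \<in> {circ s (ul u), circ s (lr u)}"
    using unch[of "ul v"] unch[of "lr v"] uin[of "ul v"] eq ne uv by auto
  show ?thesis
    using in1 in2 ne by auto
qed

text \<open>If \<open>?a\<close> and \<open>?c\<close> share a circle in \<open>s\<close>, then
  \<open>?a\<close> and \<open>?d\<close> share one in \<open>q\<close>, and conversely with
  \<open>?c\<close> and \<open>?d\<close> exchanged: this is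
  \<open>orbit_two_transpositions\<close>. Translating the half-edges of \<open>G\<close> back into
  arcs through \<open>UL\<close> and \<open>LR\<close> of \<open>q\<close> exchanges the names at
  each crossing whose \<open>UL\<close> is not in \<open>G\<close>, which produces the right-hand
  side.\<close>

lemma two_at_opposite:
  assumes uv: "u \<in> classical K" "v \<in> classical K" "u \<noteq> v"
    and two: "two_at s u" "two_at s v" "\<not> two_at (flip u s) v"
    and q: "q = flip v (flip u s)" "two_at q u" "two_at q v"
  shows "(circ s (ul u) = circ s (ul v) \<longleftrightarrow> circ q (ul u) \<noteq> circ q (ul v)) \<longleftrightarrow> (ul u \<in> G \<longleftrightarrow> ul v \<in> G)"
proof -
  let ?a = "arc_ul s u" and ?b = "arc_lr s u" and ?c = "arc_ul s v" and ?d = "arc_lr s v"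
  let ?f = "circle_perm s"
  have "\<not> two_at (flip u q) v"
    using two_at_flip[OF uv(2), of s] two q by (simp add: flip_commute[of u v])
  then have comq: "{circ q (ul v), circ q (lr v)} = {circ q (ul u), circ q (lr u)}"
    using q by (intro two_at_common uv)
  have com: "{circ s (ul v), circ s (lr v)} = {circ s (ul u), circ s (lr u)}"
    by (intro two_at_common uv two)
  have ne: "circ s (ul u) \<noteq> circ s (lr u)" "circ s (ul v) \<noteq> circ s (lr v)"
    "circ q (ul u) \<noteq> circ q (lr u)" "circ q (ul v) \<noteq> circ q (lr v)"
    using two q by (simp_all add: two_at_def)
  have fq: "circle_perm q = transpose ?c ?d \<circ> transpose ?a ?b \<circ> ?f"
    using circle_perm_flip[OF uv(1), of s] circle_perm_flip[OF uv(2), of "flip u s"] uv(3) q(1)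
    by (simp add: arcs_flip_other comp_assoc)
  have orb: "x \<in> orbit (circle_perm t) ?a \<longleftrightarrow> circ t ?a = circ t x" if "x \<in> G" for x t
    using circ_eq_iff_perm[OF arcs_G(1)[OF uv(1)] that] by simp
  have circs: "circ s ?a = circ s (ul u)" "circ s ?b = circ s (lr u)"
    "circ s ?c = circ s (ul v)" "circ s ?d = circ s (lr v)"
    using circ_arcs[OF uv(1)] circ_arcs[OF uv(2)] by blast+
  have inG: "?b \<in> G" "?c \<in> G" "?d \<in> G"
    using arcs_G uv by blast+
  have arcs: "?c \<noteq> ?a" "?d \<noteq> ?a"
    using uv(3) arcs_vertex[of s u] arcs_vertex[of s v] by (metis half_edge.inject(1))+
  have qu: "arc_ul q u = arc_ul (flip u s) u" "arc_lr q u = arc_lr (flip u s) u"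
    using uv(3) unfolding q(1) by (simp_all add: arcs_flip_other)
  have qv: "arc_ul q v = (if ul v \<in> G then ?c else ?d)" "arc_lr q v = (if ul v \<in> G then ?d else ?c)"
    using uv(3) arcs_cases(3,4)[OF uv(2), of "flip u s"] unfolding q(1)
    by (simp_all add: arcs_flip_other)
  have arcq: "circ q ?a = (if ul u \<in> G then circ q (ul u) else circ q (lr u))"
    using arcs_cases(3,4)[OF uv(1), of s] circ_arcs[OF uv(1), of q] qu by (metis (full_types))
  have arcq': "circ q ?c = (if ul v \<in> G then circ q (ul v) else circ q (lr v))"
    "circ q ?d = (if ul v \<in> G then circ q (lr v) else circ q (ul v))"
    using circ_arcs[OF uv(2), of q] qv by (metis (full_types))+
  show ?thesis
  proof (cases "circ s (ul u) = circ s (ul v)")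
    case True
    have "circ s (lr v) \<noteq> circ s (ul u)"
      using True ne by simp
    then have "?d \<in> orbit (circle_perm q) ?a"
      unfolding fq using True ne arcs inG circs
      by (intro orbit_two_transpositions[OF permutation_circle_perm]) (simp_all add: orb)
    then have "circ q ?a = circ q ?d"
      using orb[OF inG(3)] by simp
    then have "(if ul u \<in> G then circ q (ul u) else circ q (lr u)) =
        (if ul v \<in> G then circ q (lr v) else circ q (ul v))"
      using arcq arcq' by simp
    with comq ne True show ?thesis
      by (cases "ul u \<in> G"; cases "ul v \<in> G"; simp add: doubleton_eq_iff; metis)
  next
    case False
    then have eq: "circ s (ul u) = circ s (lr v)"
      using com ne by (simp add: doubleton_eq_iff)
    \<comment> \<open>The same cutting of cycles with \<open>?c\<close> and \<open>?d\<close>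
      interchanged; the transposition is symmetric in them.\<close>
    have "?c \<in> orbit (transpose ?d ?c \<circ> transpose ?a ?b \<circ> ?f) ?a"
      using False eq ne arcs inG circs
      by (intro orbit_two_transpositions[OF permutation_circle_perm]) (simp_all add: orb)
    then have "?c \<in> orbit (circle_perm q) ?a"
      unfolding fq transpose_commute[of ?d ?c] .
    then have "circ q ?a = circ q ?c"
      using orb[OF inG(2)] by simp
    then have "(if ul u \<in> G then circ q (ul u) else circ q (lr u)) =
        (if ul v \<in> G then circ q (ul v) else circ q (lr v))"
      using arcq arcq' by simp
    with comq ne False show ?thesis
      by (cases "ul u \<in> G"; cases "ul v \<in> G"; simp add: doubleton_eq_iff; metis)
  qed
qed

end

section \<open>Signs of orderings of circles\<close>

context coherent_diagram
begin

definition circle_list :: "'v set \<Rightarrow> 'v half_edge set list"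
  where "circle_list s = (SOME cs. distinct cs \<and> set cs = circles K s)"

lemma circle_list: "distinct (circle_list s)" "set (circle_list s) = circles K s"
  "length (circle_list s) = card (circles K s)"
proof -
  have "distinct (circle_list s) \<and> set (circle_list s) = circles K s"
    unfolding circle_list_def by (rule someI_ex) (use finite_distinct_list[OF finite_circles] in blast)
  then show "distinct (circle_list s)" "set (circle_list s) = circles K s"
    "length (circle_list s) = card (circles K s)"
    using distinct_card by fastforce+
qed

definition circles_sign :: "'v set \<Rightarrow> 'v half_edge set list \<Rightarrow> int"
  where "circles_sign s = list_sign (circle_list s)"

text \<open>Half-edges instead of circles: one list can be evaluated in all four states of a
  face.\<close>

definition edges_sign :: "'v set \<Rightarrow> 'v half_edge list \<Rightarrow> int"
  where "edges_sign s w = circles_sign s (map (circ s) w)"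

text \<open>The coordinate of \<open>(b - a) \<and> w\<close>, where \<open>a\<close> and
  \<open>b\<close> are the circles of \<open>s\<close> through \<open>UL\<close> and
  \<open>LR\<close>.\<close>

definition diff_sign :: "'v set \<Rightarrow> 'v \<Rightarrow> 'v half_edge list \<Rightarrow> int"
  where "diff_sign s v w = edges_sign s (lr v # w) - edges_sign s (ul v # w)"

lemma alternating_circles_sign: "alternating (circles_sign s)"
  unfolding circles_sign_def by (rule alternating_list_sign[OF circle_list(1)])

lemma circles_sign_unit:
  "distinct c \<Longrightarrow> set c = circles K s \<Longrightarrow> circles_sign s c \<in> {1, - 1}"
  using list_sign_unit[OF circle_list(1)] circle_list(2) by (simp add: circles_sign_def)

lemma circles_sign_eq_0:
  "\<not> (distinct c \<and> set c = circles K s) \<Longrightarrow> circles_sign s c = 0"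
  using list_sign_eq_0[OF circle_list(1)] circle_list(2) by (simp add: circles_sign_def)

lemma circles_sign_length:
  assumes "length c \<noteq> card (circles K s)"
  shows "circles_sign s c = 0"
  using assms by (intro circles_sign_eq_0) (auto simp: distinct_card dest: distinct_card)

lemma merged_circle_new:
  assumes v: "v \<in> classical K"
  shows "circ (flip v s) (ul v) \<notin> circles K s - {circ s (ul v), circ s (lr v)}"
proof
  assume "circ (flip v s) (ul v) \<in> circles K s - {circ s (ul v), circ s (lr v)}"
  then obtain h where h: "h \<in> H" "circ (flip v s) (ul v) = circ s h" "circ (flip v s) (ul v) \<noteq> circ s (ul v)"
    by (auto simp: circles_def)
  moreover have "ul v \<in> circ (flip v s) (ul v)"
    using v by simp
  ultimately show False
    using circ_eq_if_mem[of h "ul v" s] by simp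
qed

text \<open>\<open>q\<close> is the map that the merge induces on circles, and \<open>r\<close> is
  the section of it that represents the merged circle by the one through \<open>UL\<close>.\<close>

lemma flip_merge:
  assumes v: "v \<in> classical K" and two: "two_at s v"
  defines "t \<equiv> flip v s"
  defines "q \<equiv> \<lambda>C. if C = circ s (ul v) \<or> C = circ s (lr v) then circ t (ul v) else C"
  defines "r \<equiv> \<lambda>C. if C = circ t (ul v) then circ s (ul v) else C"
  shows "h \<in> H \<Longrightarrow> circ t h = q (circ s h)"
    and "C \<in> circles K s \<Longrightarrow> r (q C) = (if C = circ s (lr v) then circ s (ul v) else C)"
    and "circles K t = q ` circles K s"
    and "card (circles K s) = Suc (card (circles K t))"
proof -
  let ?A = "circ s (ul v)" and ?B = "circ s (lr v)" and ?M = "circ t (ul v)"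
  have AB: "?A \<noteq> ?B" "?A \<in> circles K s" "?B \<in> circles K s"
    using two v by (simp_all add: two_at_def)
  show q: "circ t h = q (circ s h)" if "h \<in> H" for h
    using circ_flip_unchanged[OF v that, of s] circ_flip_merged[OF v two that]
    by (auto simp: q_def t_def)
  have M: "?M \<notin> circles K s - {?A, ?B}"
    unfolding t_def by (rule merged_circle_new[OF v])
  then show "r (q C) = (if C = ?B then ?A else C)" if "C \<in> circles K s" for C
    using that by (auto simp: q_def r_def)
  show img: "circles K t = q ` circles K s"
    using q by (auto simp: circles_def)
  have "q ` circles K s = insert ?M (circles K s - {?A, ?B})"
    using AB by (auto simp: q_def)
  then have "card (circles K t) = Suc (card (circles K s - {?A, ?B}))"
    using img M finite_circles by simp
  moreover have "card {?A, ?B} = 2"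
    using AB by simp
  then have "card (circles K s - {?A, ?B}) = card (circles K s) - 2" "2 \<le> card (circles K s)"
    using AB card_Diff_subset[of "{?A, ?B}" "circles K s"] card_mono[OF finite_circles, of "{?A, ?B}" s]
    by auto
  ultimately show "card (circles K s) = Suc (card (circles K t))"
    by simp
qed

text \<open>Wedging with \<open>b - a\<close> depends only on the images of the remaining factors
  after \<open>a\<close> and \<open>b\<close> are identified. It is thus an alternating function of
  the circles of the merged state, and such functions in top degree form a rank-one module. In other
  degrees both sides vanish.\<close>

lemma edge_sign_exists:
  assumes v: "v \<in> classical K" and two: "two_at s v"
  obtains \<rho> where "\<rho> \<in> {1, - 1}"
    "\<And>w. set w \<subseteq> H \<Longrightarrow> diff_sign s v w = \<rho> * edges_sign (flip v s) w"
proof -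
  let ?t = "flip v s" and ?A = "circ s (ul v)" and ?B = "circ s (lr v)"
  define r where "r = (\<lambda>C. if C = circ ?t (ul v) then ?A else C)"
  let ?F = "\<lambda>xs. circles_sign s (?B # xs) - circles_sign s (?A # xs)"
  let ?m = "map (\<lambda>C. if C = ?B then ?A else C)"
  have alt: "alternating (\<lambda>xs. ?F (map r xs))"
    by (intro alternating_map alternating_diff alternating_Cons alternating_circles_sign)
  note fm = flip_merge[OF v two]
  have card: "card (circles K s) = Suc (card (circles K ?t))"
    by (rule fm(4))
  define \<rho> where "\<rho> = ?F (map r (circle_list ?t))"
  have main: "diff_sign s v w = \<rho> * edges_sign ?t w" if w: "set w \<subseteq> H" for w
  proof (cases "length w = card (circles K ?t)")
    case True
    have "r (circ ?t h) = (if circ s h = ?B then ?A else circ s h)" if "h \<in> set w" for h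
    proof -
      have "h \<in> H"
        using that w by auto
      then show ?thesis
        unfolding r_def fm(1)[OF \<open>h \<in> H\<close>] by (intro fm(2) circ_in_circles)
    qed
    then have m: "?m (map (circ s) w) = map r (map (circ ?t) w)"
      by simp
    have "diff_sign s v w = ?F (map (circ s) w)"
      by (simp add: diff_sign_def edges_sign_def)
    also have "\<dots> = ?F (?m (map (circ s) w))"
      by (rule alternating_diff_identify[OF alternating_circles_sign])
    also have "\<dots> = ?F (map r (map (circ ?t) w))"
      unfolding m ..
    also have "\<dots> = list_sign (circle_list ?t) (map (circ ?t) w) * \<rho>"
      unfolding \<rho>_def
      by (rule alternating_unique[OF alt circle_list(1)]) (use w True circle_list in auto)
    finally show ?thesis
      by (simp add: edges_sign_def circles_sign_def)
  next
    case False
    then show ?thesis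
      using card by (simp add: diff_sign_def edges_sign_def circles_sign_length)
  qed
  \<comment> \<open>\<open>?R\<close> lists all circles of \<open>s\<close> except
    \<open>?B\<close>. So \<open>?B # ?R\<close> is an ordering of the circles, while
    \<open>?A # ?R\<close> repeats \<open>?A\<close> and contributes nothing.\<close>
  let ?R = "map r (circle_list ?t)"
  have "set ?R = r ` (\<lambda>C. if C = ?A \<or> C = ?B then circ ?t (ul v) else C) ` circles K s"
    using fm(3) by (simp add: circle_list)
  also have "\<dots> = (\<lambda>C. if C = ?B then ?A else C) ` circles K s"
    unfolding image_image r_def by (rule image_cong[OF refl fm(2)])
  also have "\<dots> = circles K s - {?B}"
    using two v by (auto simp: two_at_def)
  finally have R: "set ?R = circles K s - {?B}" .
  have "card (circles K s - {?B}) = card (circles K ?t)"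
    using card v by simp
  then have "distinct ?R"
    using R by (intro card_distinct) (simp add: circle_list)
  moreover have "?A \<in> set ?R" "?B \<in> circles K s"
    using R two v by (auto simp: two_at_def)
  ultimately have "circles_sign s (?B # ?R) \<in> {1, - 1}" "circles_sign s (?A # ?R) = 0"
    using R by (intro circles_sign_unit circles_sign_eq_0; auto)+
  then have "\<rho> \<in> {1, - 1}"
    unfolding \<rho>_def by simp
  from that[OF this main] show thesis .
qed

text \<open>One half-edge on each circle suffices. Such a list allows signs to be cancelled from
  identities between these functions.\<close>

lemma edges_sign_nonzero: "\<exists>w. set w \<subseteq> H \<and> edges_sign s w \<noteq> 0"
proof -
  have "\<exists>h. h \<in> H \<and> circ s h = C" if "C \<in> set (circle_list s)" for C
    using that by (auto simp: circle_list circles_def)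
  then obtain g where g: "\<And>C. C \<in> set (circle_list s) \<Longrightarrow> g C \<in> H \<and> circ s (g C) = C"
    by metis
  have "map (circ s) (map g (circle_list s)) = circle_list s"
    using g by (auto intro: map_idI)
  then have "edges_sign s (map g (circle_list s)) \<in> {1, - 1}"
    unfolding edges_sign_def using circles_sign_unit circle_list by auto
  moreover have "set (map g (circle_list s)) \<subseteq> H"
    using g by auto
  ultimately show ?thesis
    by (intro exI[of _ "map g (circle_list s)"]) auto
qed

definition edge_sign :: "'v set \<Rightarrow> 'v \<Rightarrow> int"
  where "edge_sign s v = (SOME \<rho>. \<rho> \<in> {1, - 1} \<and>
    (\<forall>w. set w \<subseteq> H \<longrightarrow> diff_sign s v w = \<rho> * edges_sign (flip v s) w))"

lemma edge_sign:
  assumes "v \<in> classical K" "two_at s v"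
  shows "edge_sign s v \<in> {1, - 1}"
    "set w \<subseteq> H \<Longrightarrow> diff_sign s v w = edge_sign s v * edges_sign (flip v s) w"
proof -
  have "edge_sign s v \<in> {1, - 1} \<and>
    (\<forall>w. set w \<subseteq> H \<longrightarrow> diff_sign s v w = edge_sign s v * edges_sign (flip v s) w)"
    unfolding edge_sign_def by (rule someI_ex) (metis edge_sign_exists[OF assms])
  then show "edge_sign s v \<in> {1, - 1}"
    "set w \<subseteq> H \<Longrightarrow> diff_sign s v w = edge_sign s v * edges_sign (flip v s) w"
    by auto
qed

text \<open>The sign of the local generator \<open>X\<close> at \<open>v\<close> relative to the
  preferred one (see \<open>local_orientation_eq\<close>).\<close>

definition corner_sign :: "'v \<Rightarrow> int"
  where "corner_sign v = (if ul v \<in> G then - 1 else 1)"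

text \<open>The sign by which the partial differential at \<open>v\<close> differs from the unsigned one, in terms of
  the orderings \<^const>\<open>circle_list\<close>.\<close>

definition partial_sign :: "'v set \<Rightarrow> 'v \<Rightarrow> int"
  where "partial_sign s v =
    (if two_at s v then - edge_sign s v else - edge_sign (flip v s) v * corner_sign v)"

text \<open>The coordinate of a product of two differences wedged with \<open>w\<close>: the
  difference at \<open>u\<close> comes first, then the one at \<open>v\<close>.\<close>

definition diff_sign2 :: "'v set \<Rightarrow> 'v \<Rightarrow> 'v \<Rightarrow> 'v half_edge list \<Rightarrow> int"
  where "diff_sign2 s u v w = diff_sign s u (lr v # w) - diff_sign s u (ul v # w)"

lemma diff_sign2_swap: "diff_sign2 s u v w = - diff_sign2 s v u w"
proof -
  have "edges_sign s (x # y # w) = - edges_sign s (y # x # w)" for x y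
    using alternating_swap[OF alternating_circles_sign, of s "[]" "circ s x" "[]" "circ s y"]
    by (simp add: edges_sign_def)
  from this[of "lr u" "lr v"] this[of "ul u" "lr v"] this[of "lr u" "ul v"] this[of "ul u" "ul v"]
  show ?thesis
    unfolding diff_sign2_def diff_sign_def by linarith
qed

lemma diff_sign2_edges:
  assumes u: "u \<in> classical K" "two_at s u" and v: "v \<in> classical K" and w: "set w \<subseteq> H"
  shows "diff_sign2 s u v w = edge_sign s u * diff_sign (flip u s) v w"
  using edge_sign(2)[OF u, of "lr v # w"] edge_sign(2)[OF u, of "ul v # w"] v w
  by (simp add: diff_sign2_def diff_sign_def right_diff_distrib)

lemma card_circles_flip:
  assumes "v \<in> classical K"
  shows "int (card (circles K (flip v s))) = int (card (circles K s)) + (if two_at s v then - 1 else 1)"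
  using flip_merge(4)[OF assms, of s] flip_merge(4)[OF assms, of "flip v s"] two_at_flip[OF assms, of s]
  by auto

lemma partial_sign_unit: "v \<in> classical K \<Longrightarrow> partial_sign s v \<in> {1, - 1}"
  using edge_sign(1)[of v s] edge_sign(1)[of v "flip v s"] two_at_flip[of v s]
  by (auto simp: partial_sign_def corner_sign_def)

lemma corner_sign_square [simp]: "corner_sign v * corner_sign v = 1"
  by (simp add: corner_sign_def)

end

section \<open>Products of signs around the faces of the cube\<close>

context coherent_diagram
begin

text \<open>The sign of an edge regardless of its direction, always read off at the end with two
  circles.\<close>

definition undirected_sign :: "'v set \<Rightarrow> 'v \<Rightarrow> int"
  where "undirected_sign s v = (if two_at s v then edge_sign s v else edge_sign (flip v s) v)"

lemma partial_sign_eq: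
  "partial_sign s v = - undirected_sign s v * (if two_at s v then 1 else corner_sign v)"
  by (simp add: partial_sign_def undirected_sign_def)

lemma undirected_sign:
  assumes "v \<in> classical K"
  shows "undirected_sign s v \<in> {1, - 1}" "undirected_sign (flip v s) v = undirected_sign s v"
    "two_at s v \<Longrightarrow> set w \<subseteq> H \<Longrightarrow> diff_sign s v w = undirected_sign s v * edges_sign (flip v s) w"
  using edge_sign[OF assms, of s] edge_sign(1)[OF assms, of "flip v s"] two_at_flip[OF assms, of s]
  by (auto simp: undirected_sign_def)

text \<open>The product of the signs around a face does not depend on the corner \<open>s\<close> of the face at
  which it is read off; hence two configurations suffice below.\<close>

definition face_sign :: "'v set \<Rightarrow> 'v \<Rightarrow> 'v \<Rightarrow> int"
  where "face_sign s u v = undirected_sign s u * undirected_sign (flip u s) v *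
    (undirected_sign s v * undirected_sign (flip v s) u)"

lemma face_sign_flip:
  assumes "u \<in> classical K" "v \<in> classical K"
  shows "face_sign (flip u s) u v = face_sign s u v"
  using undirected_sign(2)[OF assms(1), of s] undirected_sign(2)[OF assms(1), of "flip v s"]
  by (simp add: face_sign_def flip_commute[of v u])

lemma face_sign_commute: "face_sign s u v = face_sign s v u"
  by (simp add: face_sign_def)

lemma sign_eqI:
  assumes "a * (x::int) = b * x" "x \<noteq> 0"
  shows "a = b"
  using assms by simp

text \<open>Both ways around the face wedge with the differences at \<open>u\<close> and at
  \<open>v\<close>, but in opposite orders, and one-forms anticommute.\<close>

lemma face_sign_exterior:
  assumes uv: "u \<in> classical K" "v \<in> classical K"
    and two: "two_at s u" "two_at s v" "two_at (flip u s) v" "two_at (flip v s) u"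
  shows "face_sign s u v = - 1"
proof -
  let ?t = "flip v (flip u s)"
  obtain w where w: "set w \<subseteq> H" "edges_sign ?t w \<noteq> 0"
    using edges_sign_nonzero by blast
  have "diff_sign2 s x y w = undirected_sign s x * undirected_sign (flip x s) y * edges_sign ?t w"
    if "x \<in> classical K" "y \<in> classical K" "two_at s x" "two_at (flip x s) y" "flip y (flip x s) = ?t" for x y
    using diff_sign2_edges[OF that(1,3,2) w(1)] undirected_sign(3)[OF that(2,4) w(1)] that(3,5)
    by (simp add: undirected_sign_def)
  from this[OF uv two(1,3) refl] this[OF uv(2,1) two(2,4) flip_commute]
  have "(undirected_sign s u * undirected_sign (flip u s) v) * edges_sign ?t w =
      - (undirected_sign s v * undirected_sign (flip v s) u) * edges_sign ?t w"
    using diff_sign2_swap[of s u v w] by simp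
  then have "undirected_sign s u * undirected_sign (flip u s) v =
      - (undirected_sign s v * undirected_sign (flip v s) u)"
    using w(2) by (rule sign_eqI)
  then show ?thesis
    unfolding face_sign_def
    using undirected_sign(1)[OF uv(1), of "flip v s"] undirected_sign(1)[OF uv(2), of s] by auto
qed

lemma diff_sign_common:
  assumes "{circ s (ul v), circ s (lr v)} = {circ s (ul u), circ s (lr u)}"
  shows "diff_sign s v w = (if circ s (ul u) = circ s (ul v) then 1 else - 1) * diff_sign s u w"
  using assms by (auto simp: diff_sign_def edges_sign_def doubleton_eq_iff)

text \<open>In \<open>s\<close> and in the opposite state \<open>q\<close> both crossings join the
  same two circles, so their differences \<open>b - a\<close> agree up to signs
  \<open>\<kappa> s\<close> and \<open>\<kappa> q\<close>. Comparing the two remaining states from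
  both ends gives \<open>\<kappa> s * \<kappa> q\<close> for the face, and this product is known
  from \<open>two_at_opposite\<close>.\<close>

lemma face_sign_ladybug:
  assumes uv: "u \<in> classical K" "v \<in> classical K" "u \<noteq> v"
    and two: "two_at s u" "two_at s v" "\<not> two_at (flip u s) v" "\<not> two_at (flip v s) u"
  shows "face_sign s u v = - (corner_sign u * corner_sign v)"
proof -
  define q where "q = flip v (flip u s)"
  have q: "flip v q = flip u s" "flip u q = flip v s" "two_at q u" "two_at q v"
    using two_at_flip[OF uv(1), of "flip v s"] two_at_flip[OF uv(2), of "flip u s"] two
    by (simp_all add: q_def flip_commute[of u v])
  have fu: "\<not> two_at (flip u q) v"
    using two_at_flip[OF uv(2), of s] two q by simp
  define \<kappa> where "\<kappa> = (\<lambda>p. if circ p (ul u) = circ p (ul v) then 1 else - 1 :: int)"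
  have ks: "diff_sign s v w = \<kappa> s * diff_sign s u w" for w
    unfolding \<kappa>_def by (intro diff_sign_common two_at_common uv two)
  have kq: "diff_sign q v w = \<kappa> q * diff_sign q u w" for w
    unfolding \<kappa>_def by (intro diff_sign_common two_at_common uv q fu)
  have kk: "\<kappa> s * \<kappa> q = - (corner_sign u * corner_sign v)"
    using two_at_opposite[OF uv two(1-3) q_def q(3,4)] by (auto simp: \<kappa>_def corner_sign_def)
  let ?e1 = "undirected_sign s u" and ?e2 = "undirected_sign (flip u s) v"
    and ?e3 = "undirected_sign s v" and ?e4 = "undirected_sign (flip v s) u"
  have e24: "undirected_sign q v = ?e2" "undirected_sign q u = ?e4"
    using undirected_sign(2)[OF uv(1), of q] undirected_sign(2)[OF uv(2), of q] q by simp_all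
  obtain w where w: "set w \<subseteq> H" "edges_sign (flip u s) w \<noteq> 0"
    using edges_sign_nonzero by blast
  let ?x = "edges_sign (flip u s) w" and ?y = "edges_sign (flip v s) w"
  have "?e3 * ?y = \<kappa> s * (?e1 * ?x)"
    using ks[of w] undirected_sign(3)[OF uv(1) two(1) w(1)] undirected_sign(3)[OF uv(2) two(2) w(1)]
    by simp
  moreover have "?e2 * ?x = \<kappa> q * (?e4 * ?y)"
    using kq[of w] undirected_sign(3)[OF uv(1) q(3) w(1)] undirected_sign(3)[OF uv(2) q(4) w(1)]
      q(1,2) e24 by simp
  moreover have units: "?e1 \<in> {1, - 1}" "?e3 \<in> {1, - 1}" "?e4 \<in> {1, - 1}"
    using undirected_sign(1) uv by blast+
  then have "?e3 * (?e3 * ?y) = ?y"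
    by auto
  ultimately have "?e2 * ?x = \<kappa> q * (?e4 * (?e3 * (\<kappa> s * (?e1 * ?x))))"
    by simp
  then have "?e2 * ?x = (\<kappa> q * (?e4 * (?e3 * (\<kappa> s * ?e1)))) * ?x"
    by (simp only: mult.assoc)
  then have "?e2 = \<kappa> q * (?e4 * (?e3 * (\<kappa> s * ?e1)))"
    using w(2) by (rule sign_eqI)
  then have "face_sign s u v = \<kappa> s * \<kappa> q"
    using units unfolding face_sign_def by auto
  then show ?thesis
    using kk by simp
qed

text \<open>In a face with a state from which both ways merge twice, each corner sign occurs an even
  number of times. In a ladybug each occurs once, and their product cancels against
  \<open>face_sign_ladybug\<close>.\<close>

lemma partial_sign_face:
  assumes uv: "u \<in> classical K" "v \<in> classical K" "u \<noteq> v"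
  shows "partial_sign s u * partial_sign (flip u s) v * (partial_sign s v * partial_sign (flip v s) u) = - 1"
proof -
  let ?c = "\<lambda>s v. if two_at s v then 1 else corner_sign v"
  let ?cs = "?c s u * ?c (flip u s) v * (?c s v * ?c (flip v s) u)"
  have eq: "partial_sign s u * partial_sign (flip u s) v * (partial_sign s v * partial_sign (flip v s) u) =
      face_sign s u v * ?cs"
    unfolding partial_sign_eq face_sign_def by (simp add: mult_ac)
  have cards: "of_bool (two_at s u) + of_bool (two_at (flip u s) v) =
      (of_bool (two_at s v) + of_bool (two_at (flip v s) u) :: int)"
    using card_circles_flip[OF uv(1), of s] card_circles_flip[OF uv(2), of "flip u s"]
      card_circles_flip[OF uv(2), of s] card_circles_flip[OF uv(1), of "flip v s"]
    by (simp add: flip_commute[of v u] split: if_splits)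
  note fl = two_at_flip[OF uv(1), of s] two_at_flip[OF uv(2), of s]
    two_at_flip[OF uv(1), of "flip v s"] two_at_flip[OF uv(2), of "flip u s"]
  note sym = face_sign_flip[OF uv(1,2), of s] face_sign_flip[OF uv(2,1), of s]
    face_sign_flip[OF uv(2,1), of "flip u s"] face_sign_commute[of _ v u]
  have [simp]: "flip v (flip u s) = flip u (flip v s)"
    by (rule flip_commute)
  have ext: "face_sign p u v = - 1"
    if "two_at p u" "two_at p v" "two_at (flip u p) v" "two_at (flip v p) u" for p
    by (rule face_sign_exterior[OF uv(1,2) that])
  have lady: "face_sign p u v = - (corner_sign u * corner_sign v)"
    if "two_at p u" "two_at p v" "\<not> two_at (flip u p) v" "\<not> two_at (flip v p) u" for p
    by (rule face_sign_ladybug[OF uv that])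
  \<comment> \<open>Both ways around change the number of circles by the same amount, which leaves
    six of the sixteen patterns. The first four are seen from the state where both crossings merge
    twice, the last two from a state with two circles common to both crossings.\<close>
  consider "two_at s u" "two_at (flip u s) v" "two_at s v" "two_at (flip v s) u"
    | "\<not> two_at s u" "\<not> two_at (flip u s) v" "\<not> two_at s v" "\<not> two_at (flip v s) u"
    | "two_at s u" "\<not> two_at (flip u s) v" "\<not> two_at s v" "two_at (flip v s) u"
    | "\<not> two_at s u" "two_at (flip u s) v" "two_at s v" "\<not> two_at (flip v s) u"
    | "two_at s u" "\<not> two_at (flip u s) v" "two_at s v" "\<not> two_at (flip v s) u"
    | "\<not> two_at s u" "two_at (flip u s) v" "\<not> two_at s v" "two_at (flip v s) u"
    using cards by (auto simp: of_bool_def split: if_splits)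
  then show ?thesis
  proof cases
    case 1
    then show ?thesis
      using ext[of s] by (simp add: eq)
  next
    case 2
    have q: "flip u (flip u (flip v s)) = flip v s" "flip v (flip u (flip v s)) = flip u s"
      by (simp, simp add: flip_commute[of u v] del: \<open>flip v (flip u s) = flip u (flip v s)\<close>)
    have "face_sign (flip u (flip v s)) u v = - 1"
      by (rule ext, unfold q) (use 2 fl in simp_all)
    moreover have "corner_sign u * corner_sign v * (corner_sign v * corner_sign u) = 1"
      by (simp add: corner_sign_def)
    ultimately show ?thesis
      using 2 sym unfolding eq by simp
  next
    case 3
    then show ?thesis
      using ext[of "flip v s"] fl sym by (simp add: eq)
  next
    case 4
    then show ?thesis
      using ext[of "flip u s"] fl sym by (simp add: eq)
  next
    case 5
    then show ?thesis
      using lady[of s] unfolding eq by (simp add: corner_sign_def)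
  next
    case 6
    then show ?thesis
      using lady[of "flip u s"] fl sym unfolding eq by (simp add: corner_sign_def)
  qed
qed

end

subsection \<open>Trivial cocycles on a cube\<close>

text \<open>The cube has no first cohomology with values in signs. By induction on its dimension, a
  potential on the face without \<open>x\<close> is continued along the edges in direction
  \<open>x\<close>; the faces containing such edges show that it fits the opposite face.\<close>

lemma cube_cocycle_trivial:
  fixes \<tau> :: "'v set \<Rightarrow> 'v \<Rightarrow> int"
  assumes "finite V"
    and "\<And>s v. s \<subseteq> V \<Longrightarrow> v \<in> V - s \<Longrightarrow> \<tau> s v \<in> {1, - 1}"
    and "\<And>s u v. s \<subseteq> V \<Longrightarrow> u \<in> V - s \<Longrightarrow> v \<in> V - s \<Longrightarrow> u \<noteq> v \<Longrightarrow>
      \<tau> s u * \<tau> (insert u s) v * (\<tau> s v * \<tau> (insert v s) u) = 1"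
  obtains \<phi> where "\<And>s. s \<subseteq> V \<Longrightarrow> \<phi> s \<in> {1, - 1 :: int}"
    "\<And>s v. s \<subseteq> V \<Longrightarrow> v \<in> V - s \<Longrightarrow> \<tau> s v = \<phi> s * \<phi> (insert v s)"
proof -
  have "\<exists>\<phi>. (\<forall>s. s \<subseteq> V \<longrightarrow> \<phi> s \<in> {1, - 1 :: int}) \<and>
    (\<forall>s v. s \<subseteq> V \<longrightarrow> v \<in> V - s \<longrightarrow> \<tau> s v = \<phi> s * \<phi> (insert v s))"
    using assms
  proof (induction V)
    case empty
    show ?case
      by (intro exI[of _ "\<lambda>_. 1"]) auto
  next
    case (insert x V)
    have "\<exists>\<phi>. (\<forall>s. s \<subseteq> V \<longrightarrow> \<phi> s \<in> {1, - 1 :: int}) \<and>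
      (\<forall>s v. s \<subseteq> V \<longrightarrow> v \<in> V - s \<longrightarrow> \<tau> s v = \<phi> s * \<phi> (insert v s))"
    proof (rule insert.IH)
      fix s v assume "s \<subseteq> V" "v \<in> V - s"
      then show "\<tau> s v \<in> {1, - 1}"
        by (intro insert.prems(1)) auto
    next
      fix s u v assume "s \<subseteq> V" "u \<in> V - s" "v \<in> V - s" "u \<noteq> v"
      then show "\<tau> s u * \<tau> (Set.insert u s) v * (\<tau> s v * \<tau> (Set.insert v s) u) = 1"
        by (intro insert.prems(2)) auto
    qed
    then obtain \<phi> where \<phi>: "\<And>s. s \<subseteq> V \<Longrightarrow> \<phi> s \<in> {1, - 1 :: int}"
      "\<And>s v. s \<subseteq> V \<Longrightarrow> v \<in> V - s \<Longrightarrow> \<tau> s v = \<phi> s * \<phi> (Set.insert v s)"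
      by blast
    define \<psi> where "\<psi> s = (if x \<in> s then \<phi> (s - {x}) * \<tau> (s - {x}) x else \<phi> s)" for s
    have unit: "\<psi> s \<in> {1, - 1}" if s: "s \<subseteq> Set.insert x V" for s
    proof (cases "x \<in> s")
      case True
      have "s - {x} \<subseteq> V" "s - {x} \<subseteq> Set.insert x V"
        using s by auto
      then show ?thesis
        using \<phi>(1)[of "s - {x}"] insert.prems(1)[of "s - {x}" x] True by (auto simp: \<psi>_def)
    next
      case False
      then show ?thesis
        using \<phi>(1)[of s] s by (auto simp: \<psi>_def)
    qed
    have "\<tau> s v = \<psi> s * \<psi> (Set.insert v s)" if s: "s \<subseteq> Set.insert x V" and v: "v \<in> Set.insert x V - s" for s v
    proof (cases "x \<in> s")
      case False
      then have sV: "s \<subseteq> V"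
        using s by auto
      show ?thesis
      proof (cases "v = x")
        case True
        then show ?thesis
          using False \<phi>(1)[OF sV] by (auto simp: \<psi>_def)
      next
        case vx: False
        then show ?thesis
          using False \<phi>(2)[OF sV, of v] v by (auto simp: \<psi>_def)
      qed
    next
      case True
      define s' where "s' = s - {x}"
      have s': "s = Set.insert x s'" "x \<notin> s'" "s' \<subseteq> V" "v \<in> V - s'" "v \<noteq> x"
        using True s v by (auto simp: s'_def)
      have d: "Set.insert v (Set.insert x s') - {x} = Set.insert v s'" "Set.insert x s' - {x} = s'"
        using s' by auto
      have "\<tau> s' v = \<phi> s' * \<phi> (Set.insert v s')"
        by (rule \<phi>(2)) (use s' in auto)
      moreover have "\<tau> s' v * \<tau> (Set.insert v s') x * (\<tau> s' x * \<tau> (Set.insert x s') v) = 1"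
        by (rule insert.prems(2)) (use s' in auto)
      moreover have "\<tau> s' x \<in> {1, - 1}" "\<tau> (Set.insert v s') x \<in> {1, - 1}" "\<tau> (Set.insert x s') v \<in> {1, - 1}"
        using s' insert.hyps(2) by (intro insert.prems(1); auto)+
      moreover have "\<phi> s' \<in> {1, - 1}" "\<phi> (Set.insert v s') \<in> {1, - 1}"
        using s' by (intro \<phi>(1); auto)+
      ultimately show ?thesis
        unfolding s'(1) \<psi>_def d by auto
    qed
    with unit show ?case
      by blast
  qed
  with that show thesis
    by blast
qed

lemma takeWhile_neq_order:
  "u \<in> set vs \<Longrightarrow> v \<in> set vs \<Longrightarrow> u \<noteq> v \<Longrightarrow>
    u \<in> set (takeWhile (\<lambda>x. x \<noteq> v) vs) \<longleftrightarrow> v \<notin> set (takeWhile (\<lambda>x. x \<noteq> u) vs)"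
  by (induction vs) auto

lemma ones_before_insert:
  assumes "u \<notin> s"
  shows "ones_before vs (insert u s) v =
    ones_before vs s v + (if u \<in> set (takeWhile (\<lambda>x. x \<noteq> v) vs) then 1 else 0)"
proof -
  let ?A = "set (takeWhile (\<lambda>x. x \<noteq> v) vs)"
  have "{w \<in> ?A. w \<in> insert u s} = (if u \<in> ?A then insert u {w \<in> ?A. w \<in> s} else {w \<in> ?A. w \<in> s})"
    by auto
  then show ?thesis
    using assms by (simp add: ones_before_def)
qed

text \<open>Exactly one of \<open>u\<close> and \<open>v\<close> precedes the other, so inserting
  one of them raises exactly one of the exponents by one, and all other factors occur in
  pairs.\<close>

lemma ones_before_face:
  assumes "u \<in> set vs - s" "v \<in> set vs - s" "u \<noteq> v"
  shows "(- 1) ^ ones_before vs s u * (- 1) ^ ones_before vs (insert u s) v *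
    ((- 1) ^ ones_before vs s v * (- 1) ^ ones_before vs (insert v s) u) = (- 1 :: int)"
proof -
  have "(- 1) ^ n * (- 1) ^ n = (1 :: int)" for n
    by (simp flip: power_add)
  then show ?thesis
    using assms takeWhile_neq_order[of u vs v]
    by (simp add: ones_before_insert power_add mult_ac)
qed

section \<open>Signs of orderings adapted to the differentials\<close>

context coherent_diagram
begin

lemma merge_circles:
  assumes v: "v \<in> classical K" and two: "two_at s v"
  shows "circles K (flip v s) =
      insert (circ (flip v s) (ul v)) (circles K s - {circ s (ul v), circ s (lr v)})"
    "circ (flip v s) (ul v) \<notin> circles K s - {circ s (ul v), circ s (lr v)}"
proof -
  let ?A = "circ s (ul v)" and ?B = "circ s (lr v)" and ?M = "circ (flip v s) (ul v)"
  have AB: "?A \<noteq> ?B" "?A \<in> circles K s" "?B \<in> circles K s"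
    using two v by (simp_all add: two_at_def)
  show "?M \<notin> circles K s - {?A, ?B}"
    by (rule merged_circle_new[OF v])
  show "circles K (flip v s) = insert ?M (circles K s - {?A, ?B})"
    unfolding flip_merge(3)[OF v two] using AB by auto
qed

text \<open>A circle away from \<open>v\<close> is represented by one half-edge in both states, so
  that signs of the two states can be compared on a common list.\<close>

lemma unaffected_edges:
  assumes v: "v \<in> classical K" and c: "set c \<subseteq> circles K s - {circ s (ul v), circ s (lr v)}"
  obtains w where "set w \<subseteq> H" "c = map (circ s) w" "c = map (circ (flip v s)) w"
proof -
  have "\<exists>h. h \<in> H \<and> circ s h = C \<and> circ (flip v s) h = C" if "C \<in> set c" for C
  proof -
    have "C \<in> circles K s"
      using that c by auto
    then obtain h where "h \<in> H" "C = circ s h"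
      by (auto simp: circles_def)
    then show ?thesis
      using circ_flip_unchanged[OF v, of h s] c that by auto
  qed
  then obtain g where g: "\<And>C. C \<in> set c \<Longrightarrow> g C \<in> H \<and> circ s (g C) = C \<and> circ (flip v s) (g C) = C"
    by metis
  show thesis
    by (rule that[of "map g c"]) (use g in \<open>auto intro!: map_idI[symmetric]\<close>)
qed

text \<open>Evaluate the defining identity of \<open>edge_sign\<close> on a list starting with
  \<open>ul v\<close>: since \<open>(b - a) \<and> a = - (a \<and> b)\<close>, the minus sign of
  \<open>partial_sign\<close> appears.\<close>

lemma partial_sign_merge:
  assumes v: "v \<in> classical K" and two: "two_at s v"
    and c: "set c \<subseteq> circles K s - {circ s (ul v), circ s (lr v)}"
  shows "circles_sign (flip v s) (circ (flip v s) (ul v) # c) =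
    - edge_sign s v * circles_sign s (circ s (ul v) # circ s (lr v) # c)"
proof -
  obtain w where w: "set w \<subseteq> H" "c = map (circ s) w" "c = map (circ (flip v s)) w"
    using unaffected_edges[OF v c] by blast
  have 1: "diff_sign s v (ul v # w) = edge_sign s v * edges_sign (flip v s) (ul v # w)"
    using w v by (intro edge_sign(2)[OF v two]) auto
  have 2: "diff_sign s v (ul v # w) = - circles_sign s (circ s (ul v) # circ s (lr v) # c)"
    using alternating_swap[OF alternating_circles_sign, of s "[]" "circ s (lr v)" "[]" "circ s (ul v)" c]
      alternating_not_distinct[OF alternating_circles_sign, of "circ s (ul v) # circ s (ul v) # c" s]
    by (simp add: diff_sign_def edges_sign_def w(2)[symmetric])
  have "edges_sign (flip v s) (ul v # w) = circles_sign (flip v s) (circ (flip v s) (ul v) # c)"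
    by (simp add: edges_sign_def w(3)[symmetric])
  then show ?thesis
    using 1 2 edge_sign(1)[OF v two] by auto
qed

lemma flip_insert: "v \<notin> s \<Longrightarrow> flip v s = insert v s"
  by (simp add: flip_def)

lemma coherent_signs:
  assumes vs: "set vs = classical K"
  obtains D :: "'v set \<Rightarrow> 'v half_edge set list \<Rightarrow> int"
  where "\<And>s c. s \<subseteq> classical K \<Longrightarrow> distinct c \<Longrightarrow> set c = circles K s \<Longrightarrow> D s c \<in> {1, - 1}"
    "\<And>s. alternating (D s)"
    "\<And>s v c. s \<subseteq> classical K \<Longrightarrow> v \<in> classical K - s \<Longrightarrow> two_at s v \<Longrightarrow>
      set c \<subseteq> circles K s - {circ s (ul v), circ s (lr v)} \<Longrightarrow>
      D (insert v s) (circ (insert v s) (ul v) # c) =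
        (- 1) ^ ones_before vs s v * D s (circ s (ul v) # circ s (lr v) # c)"
    "\<And>s v c. s \<subseteq> classical K \<Longrightarrow> v \<in> classical K - s \<Longrightarrow> \<not> two_at s v \<Longrightarrow>
      set c \<subseteq> circles K (insert v s) - {circ (insert v s) (ul v), circ (insert v s) (lr v)} \<Longrightarrow>
      corner_sign v * D (insert v s) (circ (insert v s) (ul v) # circ (insert v s) (lr v) # c) =
        (- 1) ^ ones_before vs s v * D s (circ s (ul v) # c)"
proof -
  let ?V = "classical K"
  \<comment> \<open>Both factors are \<open>1\<close> or \<open>- 1\<close>, so their product is
    also their quotient, which has product \<open>1\<close> around every face.\<close>
  define \<tau> where "\<tau> s v = partial_sign s v * (- 1) ^ ones_before vs s v" for s v
  have ob: "(- 1) ^ ones_before vs s v \<in> {1, - 1 :: int}" for s v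
    by (cases "even (ones_before vs s v)") auto
  obtain \<phi> where \<phi>: "\<And>s. s \<subseteq> ?V \<Longrightarrow> \<phi> s \<in> {1, - 1 :: int}"
    "\<And>s v. s \<subseteq> ?V \<Longrightarrow> v \<in> ?V - s \<Longrightarrow> \<tau> s v = \<phi> s * \<phi> (insert v s)"
  proof (rule cube_cocycle_trivial)
    show "finite ?V"
      using finite_crossings by (simp add: classical_def)
    show "\<tau> s v \<in> {1, - 1}" if "v \<in> ?V - s" for s v
      using partial_sign_unit[of v s] ob[of s v] that by (auto simp: \<tau>_def)
    show "\<tau> s u * \<tau> (insert u s) v * (\<tau> s v * \<tau> (insert v s) u) = 1"
      if "u \<in> ?V - s" "v \<in> ?V - s" "u \<noteq> v" for s u v
    proof -
      have "partial_sign s u * partial_sign (insert u s) v *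
          (partial_sign s v * partial_sign (insert v s) u) = - 1"
        using partial_sign_face[of u v s] that by (simp add: flip_insert)
      moreover have "(- 1) ^ ones_before vs s u * (- 1) ^ ones_before vs (insert u s) v *
        ((- 1) ^ ones_before vs s v * (- 1) ^ ones_before vs (insert v s) u) = (- 1 :: int)"
        using that vs by (intro ones_before_face) auto
      ultimately have "(partial_sign s u * partial_sign (insert u s) v *
          (partial_sign s v * partial_sign (insert v s) u)) *
        ((- 1) ^ ones_before vs s u * (- 1) ^ ones_before vs (insert u s) v *
          ((- 1) ^ ones_before vs s v * (- 1) ^ ones_before vs (insert v s) u)) = (1 :: int)"
        by simp
      then show ?thesis
        unfolding \<tau>_def by (simp only: mult_ac)
    qed
  qed auto
  have rel: "\<phi> (insert v s) * partial_sign s v = (- 1) ^ ones_before vs s v * \<phi> s"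
    if "s \<subseteq> ?V" "v \<in> ?V - s" for s v
    using \<phi>(2)[OF that] \<phi>(1)[OF that(1)] \<phi>(1)[of "insert v s"] that ob[of s v] by (auto simp: \<tau>_def)
  show thesis
  proof (rule that[of "\<lambda>s c. \<phi> s * circles_sign s c"])
    fix s c assume "s \<subseteq> ?V" "distinct c" "set c = circles K s"
    then show "\<phi> s * circles_sign s c \<in> {1, - 1}"
      using \<phi>(1)[of s] circles_sign_unit[of c s] by auto
  next
    fix s
    show "alternating (\<lambda>c. \<phi> s * circles_sign s c)"
      using alternating_circles_sign[of s] by (auto simp: alternating_def)
  next
    fix s v c
    assume s: "s \<subseteq> ?V" "v \<in> ?V - s" and two: "two_at s v"
      and c: "set c \<subseteq> circles K s - {circ s (ul v), circ s (lr v)}"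
    have "circles_sign (insert v s) (circ (insert v s) (ul v) # c) =
        partial_sign s v * circles_sign s (circ s (ul v) # circ s (lr v) # c)"
      using partial_sign_merge[OF _ two c] s two by (simp add: flip_insert partial_sign_def)
    then show "\<phi> (insert v s) * circles_sign (insert v s) (circ (insert v s) (ul v) # c) =
        (- 1) ^ ones_before vs s v * (\<phi> s * circles_sign s (circ s (ul v) # circ s (lr v) # c))"
      using rel[OF s] by (metis mult.assoc)
  next
    fix s v c
    assume s: "s \<subseteq> ?V" "v \<in> ?V - s" and two: "\<not> two_at s v"
      and c: "set c \<subseteq> circles K (insert v s) - {circ (insert v s) (ul v), circ (insert v s) (lr v)}"
    let ?t = "insert v s"
    have t: "flip v s = ?t" "flip v ?t = s" "two_at ?t v"
      using s two two_at_flip[of v s] by (auto simp: flip_insert flip_def)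
    have "circles_sign s (circ s (ul v) # c) =
        - edge_sign ?t v * circles_sign ?t (circ ?t (ul v) # circ ?t (lr v) # c)"
      using partial_sign_merge[OF _ t(3) c] s unfolding t by simp
    moreover have "edge_sign ?t v \<in> {1, - 1}"
      using edge_sign(1)[OF _ t(3)] s by auto
    ultimately have "corner_sign v * circles_sign ?t (circ ?t (ul v) # circ ?t (lr v) # c) =
        partial_sign s v * circles_sign s (circ s (ul v) # c)"
      using two by (auto simp: partial_sign_def t)
    then have "\<phi> ?t * (corner_sign v * circles_sign ?t (circ ?t (ul v) # circ ?t (lr v) # c)) =
        (- 1) ^ ones_before vs s v * (\<phi> s * circles_sign s (circ s (ul v) # c))"
      using rel[OF s] by (metis mult.assoc)
    then show "corner_sign v * (\<phi> ?t * circles_sign ?t (circ ?t (ul v) # circ ?t (lr v) # c)) =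
        (- 1) ^ ones_before vs s v * (\<phi> s * circles_sign s (circ s (ul v) # c))"
      by (simp only: mult.left_commute)
  qed
qed

text \<open>By \<open>corner_G\<close> the half-edges \<open>UR\<close> and \<open>LL\<close> are
  either exactly the two of \<open>G\<close> at \<open>v\<close> or exactly the two outside
  \<open>G\<close>. So a circle passing \<open>v\<close> twice receives the same orientation from
  both passages, and \<open>THE\<close> is well defined.\<close>

lemma local_orientation_eq:
  assumes v: "v \<in> classical K" and C: "C \<in> circles K s" and mem: "ul v \<in> C \<or> lr v \<in> C"
  shows "local_orientation K s v C = (if ul v \<in> G then C - G else C \<inter> G)"
  unfolding local_orientation_def
proof (rule the_equality)
  note or = orientations_eq[OF C]
  let ?P = "\<lambda>ori. ori \<in> orientations K s C \<and> (\<forall>c. At v c \<in> C \<longrightarrow> (At v c \<in> ori \<longleftrightarrow> c \<in> {UR, LL}))"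
  have cG: "At v c \<in> G \<longleftrightarrow> (if ul v \<in> G then c \<in> {UL, LR} else c \<in> {UR, LL})" for c
    using corner_G[OF v] by (cases c) auto
  have ULUR: "c \<in> {UL, LR} \<longleftrightarrow> c \<notin> {UR, LL}" for c
    by (cases c) auto
  show "?P (if ul v \<in> G then C - G else C \<inter> G)"
  proof (intro conjI allI impI)
    show "(if ul v \<in> G then C - G else C \<inter> G) \<in> orientations K s C"
      unfolding or(1) by simp
  next
    fix c assume "At v c \<in> C"
    then show "At v c \<in> (if ul v \<in> G then C - G else C \<inter> G) \<longleftrightarrow> c \<in> {UR, LL}"
      using cG[of c] ULUR[of c] by (cases "ul v \<in> G") simp_all
  qed
  fix ori assume P: "?P ori"
  then have "ori = C \<inter> G \<or> ori = C - G"
    using or(1) by auto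
  moreover have "ul v \<notin> ori" if "ul v \<in> C" 
    using P that by auto
  moreover have "lr v \<notin> ori" if "lr v \<in> C" 
    using P that by auto
  ultimately show "ori = (if ul v \<in> G then C - G else C \<inter> G)"
    using mem corner_G(1)[OF v] by auto
qed

lemma merges_iff:
  assumes "v \<in> classical K - s"
  shows "merges K s v \<longleftrightarrow> two_at s v" "splits K s v \<longleftrightarrow> \<not> two_at s v"
  using two_at_flip[of v s] assms
  by (auto simp: merges_def splits_def two_at_def first_circle_def second_circle_def flip_insert)

end

section \<open>Linear algebra\<close>

lemma mod_homI:
  assumes "\<And>x. x \<in> carrier M \<Longrightarrow> f x \<in> carrier N"
    and "\<And>x y. x \<in> carrier M \<Longrightarrow> y \<in> carrier M \<Longrightarrow> f (x \<oplus>\<^bsub>M\<^esub> y) = f x \<oplus>\<^bsub>N\<^esub> f y"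
    and "\<And>a x. a \<in> carrier R \<Longrightarrow> x \<in> carrier M \<Longrightarrow> f (a \<odot>\<^bsub>M\<^esub> x) = a \<odot>\<^bsub>N\<^esub> f x"
  shows "f \<in> mod_hom R M N"
  using assms by (auto simp: mod_hom_def)

lemma mod_homD:
  assumes "f \<in> mod_hom R M N"
  shows "x \<in> carrier M \<Longrightarrow> f x \<in> carrier N"
    and "x \<in> carrier M \<Longrightarrow> y \<in> carrier M \<Longrightarrow> f (x \<oplus>\<^bsub>M\<^esub> y) = f x \<oplus>\<^bsub>N\<^esub> f y"
    and "a \<in> carrier R \<Longrightarrow> x \<in> carrier M \<Longrightarrow> f (a \<odot>\<^bsub>M\<^esub> x) = a \<odot>\<^bsub>N\<^esub> f x"
  using assms by (auto simp: mod_hom_def)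

lemma mod_hom_zero:
  assumes "module R M" "module R N" "f \<in> mod_hom R M N"
  shows "f \<zero>\<^bsub>M\<^esub> = \<zero>\<^bsub>N\<^esub>"
proof -
  interpret M: module R M by fact
  interpret N: module R N by fact
  have "f (\<zero>\<^bsub>R\<^esub> \<odot>\<^bsub>M\<^esub> \<zero>\<^bsub>M\<^esub>) = \<zero>\<^bsub>R\<^esub> \<odot>\<^bsub>N\<^esub> f \<zero>\<^bsub>M\<^esub>"
    by (rule mod_homD(3)[OF assms(3)]) auto
  moreover have "f \<zero>\<^bsub>M\<^esub> \<in> carrier N"
    by (rule mod_homD(1)[OF assms(3)]) auto
  ultimately show ?thesis
    by simp
qed

lemma mod_hom_finsum:
  assumes "module R M" "module R N" "f \<in> mod_hom R M N" "finite A" "h \<in> A \<rightarrow> carrier M"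
  shows "f (\<Oplus>\<^bsub>M\<^esub> i\<in>A. h i) = (\<Oplus>\<^bsub>N\<^esub> i\<in>A. f (h i))"
proof -
  interpret M: module R M by fact
  interpret N: module R N by fact
  show ?thesis
    using assms(4,5)
  proof (induction A)
    case empty
    show ?case
      using mod_hom_zero[OF assms(1-3)] by simp
  next
    case (insert a A)
    then have "(\<Oplus>\<^bsub>M\<^esub> i\<in>insert a A. h i) = h a \<oplus>\<^bsub>M\<^esub> (\<Oplus>\<^bsub>M\<^esub> i\<in>A. h i)"
      by (intro M.finsum_insert) auto
    moreover have "(\<Oplus>\<^bsub>N\<^esub> i\<in>insert a A. f (h i)) = f (h a) \<oplus>\<^bsub>N\<^esub> (\<Oplus>\<^bsub>N\<^esub> i\<in>A. f (h i))"
      using insert mod_homD(1)[OF assms(3)] by (intro N.finsum_insert) auto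
    moreover have "(\<Oplus>\<^bsub>M\<^esub> i\<in>A. h i) \<in> carrier M"
      using insert by (intro M.finsum_closed) auto
    ultimately show ?case
      using insert mod_homD(2)[OF assms(3)] by auto
  qed
qed

lemma mod_hom_compose:
  assumes "f \<in> mod_hom R M N" "g \<in> mod_hom R N P"
  shows "(\<lambda>x. g (f x)) \<in> mod_hom R M P"
  using assms by (auto simp: mod_hom_def Pi_iff)

lemma mod_hom_the_inv:
  assumes "module R M" "f \<in> mod_hom R M N" "bij_betw f (carrier M) (carrier N)"
  shows "the_inv_into (carrier M) f \<in> mod_hom R N M"
proof (rule mod_homI)
  interpret M: module R M by fact
  let ?g = "the_inv_into (carrier M) f"
  note f = mod_homD[OF assms(2)]
  have inj: "inj_on f (carrier M)"
    using assms(3) by (simp add: bij_betw_def)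
  have g: "?g y \<in> carrier M" "f (?g y) = y" if "y \<in> carrier N" for y
    using that assms(3) f_the_inv_into_f_bij_betw[OF assms(3)] the_inv_into_into[OF inj, of y]
    by (auto simp: bij_betw_def)
  fix x y a
  show "x \<in> carrier N \<Longrightarrow> ?g x \<in> carrier M"
    by (rule g)
  show "?g (x \<oplus>\<^bsub>N\<^esub> y) = ?g x \<oplus>\<^bsub>M\<^esub> ?g y" if "x \<in> carrier N" "y \<in> carrier N"
    using that g f by (intro the_inv_into_f_eq[OF inj]) auto
  show "?g (a \<odot>\<^bsub>N\<^esub> x) = a \<odot>\<^bsub>M\<^esub> ?g x" if "a \<in> carrier R" "x \<in> carrier N"
    using that g f by (intro the_inv_into_f_eq[OF inj]) auto
qed

text \<open>Every axiom can be checked in \<open>N\<close> after applying the injective map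
  \<open>f\<close>. Quotients become modules in this way through their induced maps.\<close>

lemma module_transport:
  fixes M :: "('r, 'm) module" and N :: "('r, 'n) module"
  assumes N: "module R N" and bij: "bij_betw f (carrier M) (carrier N)" and f: "f \<in> mod_hom R M N"
    and zero: "\<zero>\<^bsub>M\<^esub> \<in> carrier M" "f \<zero>\<^bsub>M\<^esub> = \<zero>\<^bsub>N\<^esub>"
    and add: "\<And>x y. x \<in> carrier M \<Longrightarrow> y \<in> carrier M \<Longrightarrow> x \<oplus>\<^bsub>M\<^esub> y \<in> carrier M"
    and smult: "\<And>a x. a \<in> carrier R \<Longrightarrow> x \<in> carrier M \<Longrightarrow> a \<odot>\<^bsub>M\<^esub> x \<in> carrier M"
  shows "module R M"
proof -
  interpret N: module R N by fact
  note hom = mod_homD[OF f]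
  have inj: "x = y" if "f x = f y" "x \<in> carrier M" "y \<in> carrier M" for x y
    using that bij by (auto simp: bij_betw_def inj_on_def)
  have surj: "\<exists>x\<in>carrier M. f x = y" if "y \<in> carrier N" for y
    using that bij_betw_imp_surj_on[OF bij] by (metis imageE)
  show ?thesis
  proof (rule moduleI)
    show "cring R" by (rule N.is_cring)
    show "abelian_group M"
    proof (rule abelian_groupI)
      show "\<exists>y\<in>carrier M. y \<oplus>\<^bsub>M\<^esub> x = \<zero>\<^bsub>M\<^esub>" if x: "x \<in> carrier M" for x
      proof -
        obtain y where y: "y \<in> carrier M" "f y = \<ominus>\<^bsub>N\<^esub> f x"
          using surj[of "\<ominus>\<^bsub>N\<^esub> f x"] hom(1)[OF x] by auto
        have "y \<oplus>\<^bsub>M\<^esub> x = \<zero>\<^bsub>M\<^esub>"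
          by (rule inj) (use x y add zero hom N.l_neg in auto)
        with y show ?thesis by blast
      qed
      fix x y z assume xyz: "x \<in> carrier M" "y \<in> carrier M" "z \<in> carrier M"
      show "(x \<oplus>\<^bsub>M\<^esub> y) \<oplus>\<^bsub>M\<^esub> z = x \<oplus>\<^bsub>M\<^esub> (y \<oplus>\<^bsub>M\<^esub> z)"
        by (rule inj) (use xyz add hom in \<open>auto simp: N.a_assoc\<close>)
    next
      fix x y assume xy: "x \<in> carrier M" "y \<in> carrier M"
      show "x \<oplus>\<^bsub>M\<^esub> y = y \<oplus>\<^bsub>M\<^esub> x"
        by (rule inj) (use xy add hom in \<open>auto simp: N.a_comm\<close>)
      show "\<zero>\<^bsub>M\<^esub> \<oplus>\<^bsub>M\<^esub> x = x"
        by (rule inj) (use xy add hom zero in auto)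
    qed (use zero add in auto)
    show "(a \<oplus>\<^bsub>R\<^esub> b) \<odot>\<^bsub>M\<^esub> x = a \<odot>\<^bsub>M\<^esub> x \<oplus>\<^bsub>M\<^esub> b \<odot>\<^bsub>M\<^esub> x"
      if "a \<in> carrier R" "b \<in> carrier R" "x \<in> carrier M" for a b x
      by (rule inj) (use that add smult hom in \<open>auto simp: N.smult_l_distr\<close>)
    show "a \<odot>\<^bsub>M\<^esub> (x \<oplus>\<^bsub>M\<^esub> y) = a \<odot>\<^bsub>M\<^esub> x \<oplus>\<^bsub>M\<^esub> a \<odot>\<^bsub>M\<^esub> y"
      if "a \<in> carrier R" "x \<in> carrier M" "y \<in> carrier M" for a x y
      by (rule inj) (use that add smult hom in \<open>auto simp: N.smult_r_distr\<close>)
    show "(a \<otimes>\<^bsub>R\<^esub> b) \<odot>\<^bsub>M\<^esub> x = a \<odot>\<^bsub>M\<^esub> (b \<odot>\<^bsub>M\<^esub> x)"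
      if "a \<in> carrier R" "b \<in> carrier R" "x \<in> carrier M" for a b x
      by (rule inj) (use that smult hom in \<open>auto simp: N.smult_assoc1\<close>)
    show "\<one>\<^bsub>R\<^esub> \<odot>\<^bsub>M\<^esub> x = x" if "x \<in> carrier M" for x
      by (rule inj) (use that smult hom in auto)
  qed (rule smult)
qed

subsection \<open>Quotients\<close>

text \<open>Intended for cosets of the kernel of \<open>f\<close>, whose images have a single
  element.\<close>

definition induced_map :: "('m \<Rightarrow> 'n) \<Rightarrow> 'm set \<Rightarrow> 'n"
  where "induced_map f X = the_elem (f ` X)"

text \<open>The setting of the first isomorphism theorem: \<open>I\<close> is the kernel of the
  surjection \<open>f\<close>.\<close>

locale module_quotient =
  fixes R :: "('r, 'x) ring_scheme" and M :: "('r, 'm) module" and N :: "('r, 'n) module"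
    and I :: "'m set" and f :: "'m \<Rightarrow> 'n"
  assumes M: "module R M" and N: "module R N" and f: "f \<in> mod_hom R M N"
    and sub: "submodule I R M"
    and surj: "f ` carrier M = carrier N"
    and ker: "\<And>x. x \<in> carrier M \<Longrightarrow> f x = \<zero>\<^bsub>N\<^esub> \<longleftrightarrow> x \<in> I"
begin

interpretation M: module R M by (rule M)
interpretation N: module R N by (rule N)

lemmas hom = mod_homD[OF f]
lemmas I = M.submoduleE[OF sub]

lemma I_zero: "\<zero>\<^bsub>M\<^esub> \<in> I"
  using ker[of "\<zero>\<^bsub>M\<^esub>"] mod_hom_zero[OF M N f] by simp

lemma coset_eq: "I +>\<^bsub>M\<^esub> x = {i \<oplus>\<^bsub>M\<^esub> x |i. i \<in> I}"
  by (auto simp: a_r_coset_def')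

text \<open>With cosets described as fibres of \<open>f\<close>, most of the work on the quotient
  reduces to computing values of \<open>f\<close>.\<close>

lemma coset_eq_fibre:
  assumes x: "x \<in> carrier M"
  shows "I +>\<^bsub>M\<^esub> x = {y \<in> carrier M. f y = f x}"
proof (intro equalityI subsetI)
  fix y assume "y \<in> I +>\<^bsub>M\<^esub> x"
  then obtain i where i: "i \<in> I" "y = i \<oplus>\<^bsub>M\<^esub> x"
    by (auto simp: coset_eq)
  moreover have "i \<in> carrier M"
    using i I by auto
  ultimately show "y \<in> {y \<in> carrier M. f y = f x}"
    using x hom ker by auto
next
  fix y assume "y \<in> {y \<in> carrier M. f y = f x}"
  then have y: "y \<in> carrier M" "f y = f x"
    by auto
  let ?i = "y \<oplus>\<^bsub>M\<^esub> (\<ominus>\<^bsub>M\<^esub> x)"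
  have "f x \<oplus>\<^bsub>N\<^esub> f (\<ominus>\<^bsub>M\<^esub> x) = f (x \<oplus>\<^bsub>M\<^esub> (\<ominus>\<^bsub>M\<^esub> x))"
    using x hom(2) by simp
  also have "\<dots> = \<zero>\<^bsub>N\<^esub>"
    using x mod_hom_zero[OF M N f] by (simp add: M.r_neg)
  finally have "f ?i = \<zero>\<^bsub>N\<^esub>"
    using y x hom(2) by simp
  then have "?i \<in> I"
    using y x ker[of ?i] by simp
  moreover have "y = ?i \<oplus>\<^bsub>M\<^esub> x"
    using x y by (simp add: M.a_assoc M.l_neg)
  ultimately show "y \<in> I +>\<^bsub>M\<^esub> x"
    by (auto simp: coset_eq)
qed

lemma induced_map_coset:
  assumes x: "x \<in> carrier M"
  shows "induced_map f (I +>\<^bsub>M\<^esub> x) = f x"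
proof -
  have "f ` (I +>\<^bsub>M\<^esub> x) = {f x}"
    unfolding coset_eq_fibre[OF x] using x by auto
  then show ?thesis
    by (simp add: induced_map_def)
qed

abbreviation Q where "Q \<equiv> quotient_module M I"

lemma carrier_Q: "carrier Q = {I +>\<^bsub>M\<^esub> x |x. x \<in> carrier M}"
  by (auto simp: quotient_module_def A_RCOSETS_def')

lemma coset_in_Q: "x \<in> carrier M \<Longrightarrow> I +>\<^bsub>M\<^esub> x \<in> carrier Q"
  by (auto simp: carrier_Q)

lemma Q_add:
  assumes "x \<in> carrier M" "y \<in> carrier M"
  shows "(I +>\<^bsub>M\<^esub> x) \<oplus>\<^bsub>Q\<^esub> (I +>\<^bsub>M\<^esub> y) = I +>\<^bsub>M\<^esub> (x \<oplus>\<^bsub>M\<^esub> y)"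
proof -
  have "I +>\<^bsub>M\<^esub> (x \<oplus>\<^bsub>M\<^esub> y) \<subseteq> (I +>\<^bsub>M\<^esub> x) <+>\<^bsub>M\<^esub> (I +>\<^bsub>M\<^esub> y)"
  proof
    fix z assume "z \<in> I +>\<^bsub>M\<^esub> (x \<oplus>\<^bsub>M\<^esub> y)"
    then obtain i where i: "i \<in> I" "z = i \<oplus>\<^bsub>M\<^esub> (x \<oplus>\<^bsub>M\<^esub> y)"
      by (auto simp: coset_eq)
    then have "z = (i \<oplus>\<^bsub>M\<^esub> x) \<oplus>\<^bsub>M\<^esub> (\<zero>\<^bsub>M\<^esub> \<oplus>\<^bsub>M\<^esub> y)"
      using I(1) assms by (simp add: M.a_assoc subsetD)
    moreover have "i \<oplus>\<^bsub>M\<^esub> x \<in> I +>\<^bsub>M\<^esub> x" "\<zero>\<^bsub>M\<^esub> \<oplus>\<^bsub>M\<^esub> y \<in> I +>\<^bsub>M\<^esub> y"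
      unfolding coset_eq using i I_zero by blast+
    ultimately show "z \<in> (I +>\<^bsub>M\<^esub> x) <+>\<^bsub>M\<^esub> (I +>\<^bsub>M\<^esub> y)"
      unfolding set_add_def' by blast
  qed
  moreover have "(I +>\<^bsub>M\<^esub> x) <+>\<^bsub>M\<^esub> (I +>\<^bsub>M\<^esub> y) \<subseteq> I +>\<^bsub>M\<^esub> (x \<oplus>\<^bsub>M\<^esub> y)"
    using assms hom by (auto simp: set_add_def' coset_eq_fibre)
  ultimately show ?thesis
    by (simp add: quotient_module_def)
qed

lemma Q_smult:
  assumes "a \<in> carrier R" "x \<in> carrier M"
  shows "a \<odot>\<^bsub>Q\<^esub> (I +>\<^bsub>M\<^esub> x) = I +>\<^bsub>M\<^esub> (a \<odot>\<^bsub>M\<^esub> x)"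
proof -
  have "I +>\<^bsub>M\<^esub> (a \<odot>\<^bsub>M\<^esub> z) = I +>\<^bsub>M\<^esub> (a \<odot>\<^bsub>M\<^esub> x)" if "z \<in> I +>\<^bsub>M\<^esub> x" for z
    using that assms hom by (simp add: coset_eq_fibre)
  moreover have "I +>\<^bsub>M\<^esub> x \<noteq> {}"
    using assms by (auto simp: coset_eq_fibre)
  ultimately have "(\<Union>z\<in>I +>\<^bsub>M\<^esub> x. I +>\<^bsub>M\<^esub> (a \<odot>\<^bsub>M\<^esub> z)) = I +>\<^bsub>M\<^esub> (a \<odot>\<^bsub>M\<^esub> x)"
    by (intro SUP_eq_const)
  then show ?thesis
    by (simp add: quotient_module_def)
qed

lemma induced_hom: "induced_map f \<in> mod_hom R Q N"
proof (rule mod_homI)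
  fix X assume "X \<in> carrier Q"
  then obtain x where x: "x \<in> carrier M" "X = I +>\<^bsub>M\<^esub> x"
    by (auto simp: carrier_Q)
  then show "induced_map f X \<in> carrier N"
    using hom by (simp add: induced_map_coset)
  show "induced_map f (a \<odot>\<^bsub>Q\<^esub> X) = a \<odot>\<^bsub>N\<^esub> induced_map f X" if "a \<in> carrier R" for a
    using x hom that by (simp add: induced_map_coset Q_smult)
  fix Y assume "Y \<in> carrier Q"
  then obtain y where y: "y \<in> carrier M" "Y = I +>\<^bsub>M\<^esub> y"
    by (auto simp: carrier_Q)
  show "induced_map f (X \<oplus>\<^bsub>Q\<^esub> Y) = induced_map f X \<oplus>\<^bsub>N\<^esub> induced_map f Y"
    using x y hom by (simp add: induced_map_coset Q_add)
qed

lemma induced_bij: "bij_betw (induced_map f) (carrier Q) (carrier N)"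
proof (rule bij_betwI')
  fix X Y assume "X \<in> carrier Q" "Y \<in> carrier Q"
  then obtain x y where xy: "x \<in> carrier M" "X = I +>\<^bsub>M\<^esub> x" "y \<in> carrier M" "Y = I +>\<^bsub>M\<^esub> y"
    by (auto simp: carrier_Q)
  then have "induced_map f X = f x" "induced_map f Y = f y"
    by (simp_all add: induced_map_coset)
  moreover have "X = Y" if "f x = f y"
    using xy that by (simp add: coset_eq_fibre)
  ultimately show "induced_map f X = induced_map f Y \<longleftrightarrow> X = Y"
    by auto
next
  fix X assume "X \<in> carrier Q"
  then show "induced_map f X \<in> carrier N"
    using mod_homD(1)[OF induced_hom] by blast
next
  fix y assume "y \<in> carrier N"
  then obtain x where "x \<in> carrier M" "y = f x"
    using surj by auto
  then show "\<exists>X\<in>carrier Q. y = induced_map f X"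
    using coset_in_Q induced_map_coset by metis
qed

lemma module_Q: "module R Q"
proof (rule module_transport[OF N induced_bij induced_hom])
  have "I = I +>\<^bsub>M\<^esub> \<zero>\<^bsub>M\<^esub>"
    using I(1) by (auto simp: coset_eq_fibre mod_hom_zero[OF M N f] ker)
  then have z: "\<zero>\<^bsub>Q\<^esub> = I +>\<^bsub>M\<^esub> \<zero>\<^bsub>M\<^esub>"
    by (simp add: quotient_module_def)
  show "\<zero>\<^bsub>Q\<^esub> \<in> carrier Q"
    unfolding z by (rule coset_in_Q) simp
  show "induced_map f \<zero>\<^bsub>Q\<^esub> = \<zero>\<^bsub>N\<^esub>"
    unfolding z by (simp add: induced_map_coset mod_hom_zero[OF M N f])
qed (auto simp: carrier_Q Q_add Q_smult)

end

subsection \<open>Free modules\<close>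

lemma free_module_carrier: "carrier (free_module R S) = S \<rightarrow>\<^sub>E carrier R"
  and free_module_add: "x \<oplus>\<^bsub>free_module R S\<^esub> y = (\<lambda>g\<in>S. x g \<oplus>\<^bsub>R\<^esub> y g)"
  and free_module_zero: "\<zero>\<^bsub>free_module R S\<^esub> = (\<lambda>g\<in>S. \<zero>\<^bsub>R\<^esub>)"
  and free_module_smult: "a \<odot>\<^bsub>free_module R S\<^esub> x = (\<lambda>g\<in>S. a \<otimes>\<^bsub>R\<^esub> x g)"
  by (simp_all add: free_module_def)

lemmas free_module_simps = free_module_carrier free_module_add free_module_zero free_module_smult

lemma free_module_nth: "x \<in> carrier (free_module R S) \<Longrightarrow> g \<in> S \<Longrightarrow> x g \<in> carrier R"
  by (auto simp: free_module_carrier)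

lemma free_module_eqI:
  assumes "x \<in> carrier (free_module R S)" "y \<in> carrier (free_module R S)" "\<And>g. g \<in> S \<Longrightarrow> x g = y g"
  shows "x = y"
  using assms by (auto simp: free_module_carrier intro: PiE_ext)

lemma module_free_module:
  assumes "cring R"
  shows "module R (free_module R S)"
proof -
  interpret R: cring R by fact
  let ?F = "free_module R S"
  show ?thesis
  proof (rule moduleI)
    show "abelian_group ?F"
    proof (rule abelian_groupI)
      show "\<exists>y\<in>carrier ?F. y \<oplus>\<^bsub>?F\<^esub> x = \<zero>\<^bsub>?F\<^esub>" if "x \<in> carrier ?F" for x
        using that
        by (intro bexI[of _ "\<lambda>g\<in>S. \<ominus>\<^bsub>R\<^esub> x g"])
           (auto simp: free_module_simps PiE_iff R.l_neg intro!: restrict_ext)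
    qed (auto simp: free_module_simps PiE_iff R.a_ac extensional_def intro!: restrict_ext ext)
  qed (use assms in \<open>auto simp: free_module_simps PiE_iff R.l_distr R.r_distr R.m_assoc extensional_def
         intro!: restrict_ext ext\<close>)
qed

lemma basis_vector_carrier:
  assumes "cring R"
  shows "basis_vector R S g \<in> carrier (free_module R S)"
proof -
  interpret R: cring R by fact
  show ?thesis
    by (auto simp: basis_vector_def free_module_carrier)
qed

lemma free_module_finsum:
  assumes "cring R" "finite A" "h \<in> A \<rightarrow> carrier (free_module R S)" "g \<in> S"
  shows "(\<Oplus>\<^bsub>free_module R S\<^esub> i\<in>A. h i) g = (\<Oplus>\<^bsub>R\<^esub> i\<in>A. h i g)"
proof -
  interpret R: cring R by fact
  interpret F: module R "free_module R S" by (rule module_free_module) fact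
  show ?thesis
    using assms(2,3)
  proof (induction A)
    case empty
    then show ?case
      using assms(4) by (simp add: free_module_zero)
  next
    case (insert a A)
    then have "(\<Oplus>\<^bsub>free_module R S\<^esub> i\<in>insert a A. h i) =
        h a \<oplus>\<^bsub>free_module R S\<^esub> (\<Oplus>\<^bsub>free_module R S\<^esub> i\<in>A. h i)"
      by (intro F.finsum_insert) auto
    moreover have "(\<Oplus>\<^bsub>R\<^esub> i\<in>insert a A. h i g) = h a g \<oplus>\<^bsub>R\<^esub> (\<Oplus>\<^bsub>R\<^esub> i\<in>A. h i g)"
      using insert assms(4) by (intro R.finsum_insert) (auto simp: free_module_carrier)
    ultimately show ?case
      using insert assms(4) by (simp add: free_module_add)
  qed
qed

lemma free_module_expand:
  assumes "cring R" "finite S" "x \<in> carrier (free_module R S)"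
  shows "x = (\<Oplus>\<^bsub>free_module R S\<^esub> g\<in>S. x g \<odot>\<^bsub>free_module R S\<^esub> basis_vector R S g)"
proof -
  interpret R: cring R by fact
  interpret F: module R "free_module R S" by (rule module_free_module) fact
  have mem: "(\<lambda>g. x g \<odot>\<^bsub>free_module R S\<^esub> basis_vector R S g) \<in> S \<rightarrow> carrier (free_module R S)"
    by (intro Pi_I F.smult_closed free_module_nth[OF assms(3)] basis_vector_carrier[OF assms(1)])
  show ?thesis
  proof (rule free_module_eqI[OF assms(3)])
    show "(\<Oplus>\<^bsub>free_module R S\<^esub> g\<in>S. x g \<odot>\<^bsub>free_module R S\<^esub> basis_vector R S g) \<in> carrier (free_module R S)"
      using mem by (rule F.finsum_closed)
    fix g assume g: "g \<in> S"
    have "(\<Oplus>\<^bsub>free_module R S\<^esub> k\<in>S. x k \<odot>\<^bsub>free_module R S\<^esub> basis_vector R S k) g =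
        (\<Oplus>\<^bsub>R\<^esub> k\<in>S. (x k \<odot>\<^bsub>free_module R S\<^esub> basis_vector R S k) g)"
      using assms mem g by (intro free_module_finsum)
    also have "\<dots> = (\<Oplus>\<^bsub>R\<^esub> k\<in>S. if g = k then x k else \<zero>\<^bsub>R\<^esub>)"
      using g free_module_nth[OF assms(3)]
      by (intro R.finsum_cong') (auto simp: free_module_smult basis_vector_def)
    also have "\<dots> = x g"
      using g assms free_module_nth[OF assms(3)] by (intro R.finsum_singleton) auto
    finally show "x g = (\<Oplus>\<^bsub>free_module R S\<^esub> k\<in>S. x k \<odot>\<^bsub>free_module R S\<^esub> basis_vector R S k) g"
      by simp
  qed
qed

lemma mod_hom_free_module:
  assumes "cring R" "finite S" "module R M" "f \<in> mod_hom R (free_module R S) M"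
    "x \<in> carrier (free_module R S)"
  shows "f x = linear_extension S M (\<lambda>g. f (basis_vector R S g)) x"
proof -
  interpret F: module R "free_module R S" by (rule module_free_module) fact
  interpret M: module R M by fact
  have "f x = f (\<Oplus>\<^bsub>free_module R S\<^esub> g\<in>S. x g \<odot>\<^bsub>free_module R S\<^esub> basis_vector R S g)"
    using free_module_expand[OF assms(1,2,5)] by simp
  also have "\<dots> = (\<Oplus>\<^bsub>M\<^esub> g\<in>S. f (x g \<odot>\<^bsub>free_module R S\<^esub> basis_vector R S g))"
    by (intro mod_hom_finsum[OF F.module_axioms assms(3,4,2)] Pi_I F.smult_closed
        free_module_nth[OF assms(5)] basis_vector_carrier[OF assms(1)])
  also have "\<dots> = (\<Oplus>\<^bsub>M\<^esub> g\<in>S. x g \<odot>\<^bsub>M\<^esub> f (basis_vector R S g))"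
    by (intro M.finsum_cong' refl Pi_I M.smult_closed mod_homD(1)[OF assms(4)] mod_homD(3)[OF assms(4)]
        free_module_nth[OF assms(5)] basis_vector_carrier[OF assms(1)])
  finally show ?thesis
    by (simp add: linear_extension_def)
qed

lemma mod_hom_free_module_eqI:
  assumes "cring R" "finite S" "module R M" "f \<in> mod_hom R (free_module R S) M"
    "h \<in> mod_hom R (free_module R S) M"
    "\<And>g. g \<in> S \<Longrightarrow> f (basis_vector R S g) = h (basis_vector R S g)"
    "x \<in> carrier (free_module R S)"
  shows "f x = h x"
proof -
  interpret F: module R "free_module R S" by (rule module_free_module) fact
  interpret M: module R M by fact
  show ?thesis
    unfolding mod_hom_free_module[OF assms(1-4,7)] mod_hom_free_module[OF assms(1-3,5,7)]
      linear_extension_def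
    by (intro M.finsum_cong' refl Pi_I M.smult_closed mod_homD(1)[OF assms(5)]
        free_module_nth[OF assms(7)] basis_vector_carrier[OF assms(1)]) (simp_all add: assms(6))
qed

lemma linear_extension_hom:
  assumes "cring R" "finite S" "module R M" "b \<in> S \<rightarrow> carrier M"
  shows "linear_extension S M b \<in> mod_hom R (free_module R S) M"
proof -
  interpret R: cring R by fact
  interpret M: module R M by fact
  have cl: "(\<lambda>g. x g \<odot>\<^bsub>M\<^esub> b g) \<in> S \<rightarrow> carrier M" if "x \<in> carrier (free_module R S)" for x
    using assms(4) free_module_nth[OF that] by (intro Pi_I M.smult_closed) (auto simp: Pi_iff)
  show ?thesis
  proof (rule mod_homI)
    fix x assume x: "x \<in> carrier (free_module R S)"
    show "linear_extension S M b x \<in> carrier M"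
      unfolding linear_extension_def using cl[OF x] by (rule M.finsum_closed)
    fix y assume y: "y \<in> carrier (free_module R S)"
    have "linear_extension S M b (x \<oplus>\<^bsub>free_module R S\<^esub> y) =
        (\<Oplus>\<^bsub>M\<^esub> g\<in>S. x g \<odot>\<^bsub>M\<^esub> b g \<oplus>\<^bsub>M\<^esub> y g \<odot>\<^bsub>M\<^esub> b g)"
      unfolding linear_extension_def using cl[OF x] cl[OF y] assms(4)
      by (intro M.finsum_cong')
         (auto simp: free_module_add M.smult_l_distr free_module_nth[OF x] free_module_nth[OF y] Pi_iff)
    also have "\<dots> = linear_extension S M b x \<oplus>\<^bsub>M\<^esub> linear_extension S M b y"
      unfolding linear_extension_def using cl[OF x] cl[OF y] by (rule M.finsum_addf)
    finally show "linear_extension S M b (x \<oplus>\<^bsub>free_module R S\<^esub> y) =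
        linear_extension S M b x \<oplus>\<^bsub>M\<^esub> linear_extension S M b y" .
  next
    fix a x assume a: "a \<in> carrier R" and x: "x \<in> carrier (free_module R S)"
    have "linear_extension S M b (a \<odot>\<^bsub>free_module R S\<^esub> x) = (\<Oplus>\<^bsub>M\<^esub> g\<in>S. a \<odot>\<^bsub>M\<^esub> (x g \<odot>\<^bsub>M\<^esub> b g))"
      unfolding linear_extension_def using cl[OF x] a assms(4)
      by (intro M.finsum_cong') (auto simp: free_module_smult M.smult_assoc1 free_module_nth[OF x] Pi_iff)
    also have "\<dots> = a \<odot>\<^bsub>M\<^esub> linear_extension S M b x"
      unfolding linear_extension_def using M.finsum_smult_ldistr[OF assms(2) a cl[OF x]] by simp
    finally show "linear_extension S M b (a \<odot>\<^bsub>free_module R S\<^esub> x) = a \<odot>\<^bsub>M\<^esub> linear_extension S M b x" .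
  qed
qed

lemma linear_extension_basis:
  assumes "cring R" "finite S" "module R M" "b \<in> S \<rightarrow> carrier M" "g \<in> S"
  shows "linear_extension S M b (basis_vector R S g) = b g"
proof -
  interpret R: cring R by fact
  interpret M: module R M by fact
  have "linear_extension S M b (basis_vector R S g) = (\<Oplus>\<^bsub>M\<^esub> k\<in>S. if g = k then b k else \<zero>\<^bsub>M\<^esub>)"
    unfolding linear_extension_def using assms(4)
    by (intro M.finsum_cong') (auto simp: basis_vector_def Pi_iff)
  also have "\<dots> = b g"
    using assms by (intro M.finsum_singleton) auto
  finally show ?thesis .
qed

text \<open>Integers \<open>1\<close> and \<open>- 1\<close> as scalars; other arguments are never used.\<close>

definition sign_scalar :: "('r, 'x) ring_scheme \<Rightarrow> int \<Rightarrow> 'r"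
  where "sign_scalar R k = (if k = 1 then \<one>\<^bsub>R\<^esub> else \<ominus>\<^bsub>R\<^esub> \<one>\<^bsub>R\<^esub>)"

context cring
begin

lemma sign_scalar_closed [simp]: "sign_scalar R k \<in> carrier R"
  by (simp add: sign_scalar_def)

lemma sign_scalar_mult:
  "k \<in> {1, - 1} \<Longrightarrow> l \<in> {1, - 1} \<Longrightarrow> sign_scalar R (k * l) = sign_scalar R k \<otimes> sign_scalar R l"
  by (auto simp: sign_scalar_def l_minus r_minus)

lemma sign_scalar_square [simp]: "sign_scalar R k \<otimes> sign_scalar R k = \<one>"
  by (auto simp: sign_scalar_def l_minus r_minus)

end

context module
begin

text \<open>Turns the integer multiples of the definitions into multiples by a ring element, with
  which linear maps commute.\<close>

lemma add_pow_sign: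
  assumes "k \<in> {1, - 1}" "x \<in> carrier M"
  shows "[(k :: int)] \<cdot>\<^bsub>M\<^esub> x = sign_scalar R k \<odot>\<^bsub>M\<^esub> x"
proof -
  have "[(- 1 :: int)] \<cdot>\<^bsub>M\<^esub> x = \<ominus>\<^bsub>M\<^esub> ([(1 :: int)] \<cdot>\<^bsub>M\<^esub> x)"
    by (rule M.add.int_pow_neg) fact
  then show ?thesis
    using assms M.add.int_pow_1[OF assms(2)] by (auto simp: sign_scalar_def smult_l_minus)
qed

lemma sign_smult_twice:
  "x \<in> carrier M \<Longrightarrow> sign_scalar R k \<odot>\<^bsub>M\<^esub> (sign_scalar R k \<odot>\<^bsub>M\<^esub> x) = x"
  by (simp flip: smult_assoc1)

end

lemma mod_hom_free_module_submodule:
  assumes "cring R" "finite S" "module R M" "f \<in> mod_hom R (free_module R S) M"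
    and I: "submodule I R M" and e: "\<And>g. g \<in> S \<Longrightarrow> f (basis_vector R S g) \<in> I"
    and x: "x \<in> carrier (free_module R S)"
  shows "f x \<in> I"
proof -
  interpret M: module R M by fact
  note I = M.submoduleE[OF I]
  have z: "\<zero>\<^bsub>M\<^esub> \<in> I"
    using I(1,2,3,5) by (metis M.r_neg equals0I subsetD)
  have "(\<Oplus>\<^bsub>M\<^esub> g\<in>A. x g \<odot>\<^bsub>M\<^esub> f (basis_vector R S g)) \<in> I" if "A \<subseteq> S" for A
    using finite_subset[OF that assms(2)] that
  proof (induction A)
    case empty
    then show ?case using z by simp
  next
    case (insert a A)
    have mem: "x g \<odot>\<^bsub>M\<^esub> f (basis_vector R S g) \<in> I" if "g \<in> S" for g
      by (rule I(4)[OF free_module_nth[OF x that] e[OF that]])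
    have "(\<Oplus>\<^bsub>M\<^esub> g\<in>insert a A. x g \<odot>\<^bsub>M\<^esub> f (basis_vector R S g)) =
        x a \<odot>\<^bsub>M\<^esub> f (basis_vector R S a) \<oplus>\<^bsub>M\<^esub> (\<Oplus>\<^bsub>M\<^esub> g\<in>A. x g \<odot>\<^bsub>M\<^esub> f (basis_vector R S g))"
    proof (rule M.finsum_insert)
      show "(\<lambda>g. x g \<odot>\<^bsub>M\<^esub> f (basis_vector R S g)) \<in> A \<rightarrow> carrier M"
        using mem I(1) insert by blast
      show "x a \<odot>\<^bsub>M\<^esub> f (basis_vector R S a) \<in> carrier M"
        using mem I(1) insert by blast
    qed fact+
    then show ?case
      using I(5) mem insert by auto
  qed
  then show ?thesis
    unfolding mod_hom_free_module[OF assms(1-4) x] linear_extension_def by blast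
qed

text \<open>Modulo \<open>I\<close>, generators with equal labels agree once each is multiplied by
  its sign \<open>\<omega>\<close>, so the labels span the quotient. That \<open>f\<close> vanishes
  on \<open>I\<close> excludes any further collapse.\<close>

lemma signed_presentation:
  fixes \<omega> :: "'w \<Rightarrow> int"
  assumes R: "cring R" and W: "finite W" and L: "finite L" and lab: "lab ` W = L"
    and \<omega>: "\<And>w. w \<in> W \<Longrightarrow> \<omega> w \<in> {1, - 1}"
    and I: "submodule I R (free_module R W)"
    and rel: "\<And>w w'. w \<in> W \<Longrightarrow> w' \<in> W \<Longrightarrow> lab w = lab w' \<Longrightarrow>
      basis_vector R W w \<ominus>\<^bsub>free_module R W\<^esub>
        sign_scalar R (\<omega> w * \<omega> w') \<odot>\<^bsub>free_module R W\<^esub> basis_vector R W w' \<in> I"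
  defines "f \<equiv> linear_extension W (free_module R L)
    (\<lambda>w. sign_scalar R (\<omega> w) \<odot>\<^bsub>free_module R L\<^esub> basis_vector R L (lab w))"
  assumes ker: "\<And>x. x \<in> I \<Longrightarrow> f x = \<zero>\<^bsub>free_module R L\<^esub>"
  shows "module_quotient R (free_module R W) (free_module R L) I f"
proof -
  let ?F = "free_module R W" and ?U = "free_module R L"
  interpret R: cring R by fact
  interpret F: module R ?F by (rule module_free_module) fact
  interpret U: module R ?U by (rule module_free_module) fact
  note bW = basis_vector_carrier[OF R, of W] and bL = basis_vector_carrier[OF R, of L]
  define st where "st = inv_into W lab"
  have st: "st l \<in> W" "lab (st l) = l" if "l \<in> L" for l
    using that lab inv_into_into[of l lab W] f_inv_into_f[of l lab W] by (auto simp: st_def)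
  have labL: "lab w \<in> L" if "w \<in> W" for w
    using that lab by auto
  \<comment> \<open>A section of \<open>f\<close>: each label is sent to one chosen generator that
    carries it, with the sign that \<open>f\<close> undoes.\<close>
  define g where "g = linear_extension L ?F (\<lambda>l. sign_scalar R (\<omega> (st l)) \<odot>\<^bsub>?F\<^esub> basis_vector R W (st l))"
  have f: "f \<in> mod_hom R ?F ?U"
    unfolding f_def by (rule linear_extension_hom[OF R W U.module_axioms]) (use bL in auto)
  have g: "g \<in> mod_hom R ?U ?F"
    unfolding g_def by (rule linear_extension_hom[OF R L F.module_axioms]) (use bW in auto)
  have fe: "f (basis_vector R W w) = sign_scalar R (\<omega> w) \<odot>\<^bsub>?U\<^esub> basis_vector R L (lab w)" if "w \<in> W" for w
    unfolding f_def by (rule linear_extension_basis[OF R W U.module_axioms _ that]) (use bL in auto)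
  have ge: "g (basis_vector R L l) = sign_scalar R (\<omega> (st l)) \<odot>\<^bsub>?F\<^esub> basis_vector R W (st l)" if "l \<in> L" for l
    unfolding g_def by (rule linear_extension_basis[OF R L F.module_axioms _ that]) (use bW in auto)
  have fg: "f (g x) = x" if "x \<in> carrier ?U" for x
  proof -
    have "f (g (basis_vector R L l)) = basis_vector R L l" if l: "l \<in> L" for l
      using mod_homD(3)[OF f _ bW] fe[OF st(1)[OF l]] st(2)[OF l] bL
      by (simp add: ge[OF l] U.sign_smult_twice)
    then have e: "f (g (basis_vector R L l)) = (\<lambda>x. x) (basis_vector R L l)" if "l \<in> L" for l
      using that by simp
    have id: "(\<lambda>x. x) \<in> mod_hom R ?U ?U"
      by (rule mod_homI) (rule refl | assumption)+
    show ?thesis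
      by (rule mod_hom_free_module_eqI[OF R L U.module_axioms mod_hom_compose[OF g f] id e that])
  qed
  \<comment> \<open>On a generator, \<open>h\<close> is one of the differences in
    \<open>rel\<close>, so its image lies in \<open>I\<close>; on the kernel of \<open>f\<close> it
    is the identity. Hence the kernel lies in \<open>I\<close>.\<close>
  define h where "h x = x \<ominus>\<^bsub>?F\<^esub> g (f x)" for x
  note fD = mod_homD[OF f] and gD = mod_homD[OF g]
  have h: "h \<in> mod_hom R ?F ?F"
  proof (rule mod_homI)
    show "h x \<in> carrier ?F" if "x \<in> carrier ?F" for x
      using that fD gD by (simp add: h_def)
    show "h (x \<oplus>\<^bsub>?F\<^esub> y) = h x \<oplus>\<^bsub>?F\<^esub> h y" if "x \<in> carrier ?F" "y \<in> carrier ?F" for x y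
      using that fD(1) gD(1) unfolding h_def fD(2)[OF that] gD(2)[OF fD(1)[OF that(1)] fD(1)[OF that(2)]]
      by (simp add: F.minus_eq F.minus_add F.a_ac)
    show "h (a \<odot>\<^bsub>?F\<^esub> x) = a \<odot>\<^bsub>?F\<^esub> h x" if "a \<in> carrier R" "x \<in> carrier ?F" for a x
      using that fD gD by (simp add: h_def F.minus_eq F.smult_r_distr F.smult_r_minus)
  qed
  have hI: "h x \<in> I" if "x \<in> carrier ?F" for x
  proof (rule mod_hom_free_module_submodule[OF R W F.module_axioms h I _ that])
    fix w assume w: "w \<in> W"
    let ?w' = "st (lab w)"
    have w': "?w' \<in> W" "lab ?w' = lab w"
      using st labL w by auto
    have "g (f (basis_vector R W w)) = sign_scalar R (\<omega> w) \<odot>\<^bsub>?F\<^esub> (sign_scalar R (\<omega> ?w') \<odot>\<^bsub>?F\<^esub> basis_vector R W ?w')"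
      using gD(3)[OF _ bL] by (simp add: fe[OF w] ge[OF labL[OF w]])
    also have "\<dots> = sign_scalar R (\<omega> w * \<omega> ?w') \<odot>\<^bsub>?F\<^esub> basis_vector R W ?w'"
      using bW by (simp add: R.sign_scalar_mult[OF \<omega>[OF w] \<omega>[OF w'(1)]] F.smult_assoc1)
    finally show "h (basis_vector R W w) \<in> I"
      using rel[OF w w'(1)] w'(2) by (simp add: h_def)
  qed
  show ?thesis
  proof (rule module_quotient.intro)
    show "module R ?F" "module R ?U"
      by (rule F.module_axioms, rule U.module_axioms)
    show "f \<in> mod_hom R ?F ?U" by (rule f)
    show "submodule I R ?F" by (rule I)
    show "f ` carrier ?F = carrier ?U"
      using fD(1) gD(1) fg by (auto simp: image_iff) (metis)
    fix x assume x: "x \<in> carrier ?F"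
    show "f x = \<zero>\<^bsub>?U\<^esub> \<longleftrightarrow> x \<in> I"
    proof
      assume "f x = \<zero>\<^bsub>?U\<^esub>"
      then have "h x = x"
        using x mod_hom_zero[OF U.module_axioms F.module_axioms g] by (simp add: h_def F.minus_eq)
      then show "x \<in> I"
        using hI[OF x] by simp
    qed (rule ker)
  qed
qed

section \<open>Isomorphic cubes\<close>

text \<open>Cosets, their sums and their multiples are sets formed elementwise, so taking images
  under \<open>p\<close> carries them over directly. Kernel and image of the differentials enter as
  the sets \<open>A\<close> and \<open>B\<close>.\<close>

lemma quotient_module_isomorphic:
  fixes C :: "('r, 'm) module" and D :: "('r, 'n) module"
  assumes p: "bij_betw p (carrier C) (carrier D)" "p \<in> mod_hom R C D"
    and add: "\<And>x y. x \<in> carrier C \<Longrightarrow> y \<in> carrier C \<Longrightarrow> x \<oplus>\<^bsub>C\<^esub> y \<in> carrier C"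
    and smult: "\<And>a x. a \<in> carrier R \<Longrightarrow> x \<in> carrier C \<Longrightarrow> a \<odot>\<^bsub>C\<^esub> x \<in> carrier C"
    and A: "A \<subseteq> carrier C" "p ` A = A'" and B: "B \<subseteq> carrier C" "p ` B = B'"
  shows "mod_isomorphic R (quotient_module (C\<lparr>carrier := A\<rparr>) B) (quotient_module (D\<lparr>carrier := A'\<rparr>) B')"
proof -
  let ?Q = "quotient_module (C\<lparr>carrier := A\<rparr>) B" and ?Q' = "quotient_module (D\<lparr>carrier := A'\<rparr>) B'"
  note hom = mod_homD[OF p(2)]
  have coset: "p ` (B +>\<^bsub>C\<lparr>carrier := A\<rparr>\<^esub> x) = B' +>\<^bsub>D\<lparr>carrier := A'\<rparr>\<^esub> p x" if "x \<in> carrier C" for x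
  proof -
    have "p (h \<oplus>\<^bsub>C\<^esub> x) = p h \<oplus>\<^bsub>D\<^esub> p x" if "h \<in> B" for h
      using that \<open>x \<in> carrier C\<close> B(1) hom(2) by blast
    then show ?thesis
      by (simp add: a_r_coset_def r_coset_def B(2)[symmetric] image_UN)
  qed
  have carr: "carrier ?Q = (\<lambda>x. B +>\<^bsub>C\<lparr>carrier := A\<rparr>\<^esub> x) ` A"
    "carrier ?Q' = (\<lambda>x. B' +>\<^bsub>D\<lparr>carrier := A'\<rparr>\<^esub> x) ` A'"
    by (auto simp: quotient_module_def A_RCOSETS_def RCOSETS_def a_r_coset_def)
  have sub: "X \<subseteq> carrier C" if "X \<in> carrier ?Q" for X
    using that A B add by (auto simp: carr a_r_coset_def r_coset_def)
  have inj: "inj_on p (carrier C)"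
    using p(1) by (simp add: bij_betw_def)
  have "(`) p \<in> mod_hom R ?Q ?Q'"
  proof (rule mod_homI)
    fix X assume X: "X \<in> carrier ?Q"
    then obtain x where "x \<in> A" "X = B +>\<^bsub>C\<lparr>carrier := A\<rparr>\<^esub> x"
      by (auto simp: carr)
    then show "p ` X \<in> carrier ?Q'"
      using coset[of x] A unfolding carr by blast
    fix Y assume Y: "Y \<in> carrier ?Q"
    have "p ` {x \<oplus>\<^bsub>C\<^esub> y |x y. x \<in> X \<and> y \<in> Y} = {x \<oplus>\<^bsub>D\<^esub> y |x y. x \<in> p ` X \<and> y \<in> p ` Y}"
    proof (intro equalityI subsetI)
      fix z assume "z \<in> p ` {x \<oplus>\<^bsub>C\<^esub> y |x y. x \<in> X \<and> y \<in> Y}"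
      then obtain x y where xy: "x \<in> X" "y \<in> Y" "z = p (x \<oplus>\<^bsub>C\<^esub> y)"
        by blast
      then have "z = p x \<oplus>\<^bsub>D\<^esub> p y"
        using hom(2) sub[OF X] sub[OF Y] by blast
      then show "z \<in> {x \<oplus>\<^bsub>D\<^esub> y |x y. x \<in> p ` X \<and> y \<in> p ` Y}"
        using xy by blast
    next
      fix z assume "z \<in> {x \<oplus>\<^bsub>D\<^esub> y |x y. x \<in> p ` X \<and> y \<in> p ` Y}"
      then obtain x y where xy: "x \<in> X" "y \<in> Y" "z = p x \<oplus>\<^bsub>D\<^esub> p y"
        by blast
      then have "z = p (x \<oplus>\<^bsub>C\<^esub> y)"
        using hom(2)[of x y] sub[OF X] sub[OF Y] by (simp add: subsetD)
      then show "z \<in> p ` {x \<oplus>\<^bsub>C\<^esub> y |x y. x \<in> X \<and> y \<in> Y}"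
        using xy by blast
    qed
    moreover have "X \<oplus>\<^bsub>?Q\<^esub> Y = {x \<oplus>\<^bsub>C\<^esub> y |x y. x \<in> X \<and> y \<in> Y}"
      "p ` X \<oplus>\<^bsub>?Q'\<^esub> p ` Y = {x \<oplus>\<^bsub>D\<^esub> y |x y. x \<in> p ` X \<and> y \<in> p ` Y}"
      by (auto simp: quotient_module_def set_add_def set_mult_def)
    ultimately show "p ` (X \<oplus>\<^bsub>?Q\<^esub> Y) = p ` X \<oplus>\<^bsub>?Q'\<^esub> p ` Y"
      by simp
  next
    fix a X assume a: "a \<in> carrier R" and X: "X \<in> carrier ?Q"
    have "p ` (B +>\<^bsub>C\<lparr>carrier := A\<rparr>\<^esub> (a \<odot>\<^bsub>C\<^esub> x)) = B' +>\<^bsub>D\<lparr>carrier := A'\<rparr>\<^esub> (a \<odot>\<^bsub>D\<^esub> p x)" if "x \<in> X" for x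
      using coset[of "a \<odot>\<^bsub>C\<^esub> x"] a sub[OF X] that smult hom(3) by (simp add: subsetD)
    then show "p ` (a \<odot>\<^bsub>?Q\<^esub> X) = a \<odot>\<^bsub>?Q'\<^esub> p ` X"
      by (simp add: quotient_module_def image_UN)
  qed
  moreover have "bij_betw ((`) p) (carrier ?Q) (carrier ?Q')"
    unfolding bij_betw_def
  proof
    show "inj_on ((`) p) (carrier ?Q)"
      using inj_on_image_eq_iff[OF inj sub sub] by (intro inj_onI) simp
    show "(`) p ` carrier ?Q = carrier ?Q'"
      unfolding carr unfolding A(2)[symmetric] image_image using A(1) by (intro image_cong refl coset[unfolded A(2)[symmetric]]) auto
  qed
  ultimately show ?thesis
    unfolding mod_isomorphic_def by blast
qed

text \<open>The differential is a sum of edge maps, so the componentwise map \<open>P\<close>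
  commutes with it in every height and carries kernels to kernels and images to images.\<close>

lemma cube_homology_isomorphic:
  fixes M :: "'v set \<Rightarrow> int \<Rightarrow> ('r, 'm) module" and N :: "'v set \<Rightarrow> int \<Rightarrow> ('r, 'n) module"
  assumes V: "finite V"
    and M: "\<And>s. s \<subseteq> V \<Longrightarrow> module R (M s j)" and N: "\<And>s. s \<subseteq> V \<Longrightarrow> module R (N s j)"
    and p: "\<And>s. s \<subseteq> V \<Longrightarrow> p s \<in> mod_hom R (M s j) (N s j)"
      "\<And>s. s \<subseteq> V \<Longrightarrow> bij_betw (p s) (carrier (M s j)) (carrier (N s j))"
    and \<delta>: "\<And>s v x. s \<subseteq> V \<Longrightarrow> v \<in> V - s \<Longrightarrow> x \<in> carrier (M s j) \<Longrightarrow> \<delta> s v j x \<in> carrier (M (insert v s) j)"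
    and comm: "\<And>s v x. s \<subseteq> V \<Longrightarrow> v \<in> V - s \<Longrightarrow> x \<in> carrier (M s j) \<Longrightarrow>
      p (insert v s) (\<delta> s v j x) = \<delta>' s v j (p s x)"
  shows "mod_isomorphic R (cube_homology V M \<delta> i j) (cube_homology V N \<delta>' i j)"
proof -
  let ?C = "\<lambda>i. cube_chains V M i j" and ?D = "\<lambda>i. cube_chains V N i j"
  let ?d = "\<lambda>i. cube_differential V M \<delta> i j" and ?d' = "\<lambda>i. cube_differential V N \<delta>' i j"
  define P where "P i x = (\<lambda>s\<in>states_of_height V i. p s (x s))" for i x
  have st: "s \<subseteq> V" if "s \<in> states_of_height V i" for s i
    using that by (simp add: states_of_height_def)
  have C: "carrier (?C i) = (\<Pi>\<^sub>E s\<in>states_of_height V i. carrier (M s j))"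
    and D: "carrier (?D i) = (\<Pi>\<^sub>E s\<in>states_of_height V i. carrier (N s j))" for i
    by (simp_all add: cube_chains_def direct_sum_def)
  have addC: "x \<oplus>\<^bsub>?C i\<^esub> y = (\<lambda>s\<in>states_of_height V i. x s \<oplus>\<^bsub>M s j\<^esub> y s)"
    and addD: "x' \<oplus>\<^bsub>?D i\<^esub> y' = (\<lambda>s\<in>states_of_height V i. x' s \<oplus>\<^bsub>N s j\<^esub> y' s)"
    and smC: "a \<odot>\<^bsub>?C i\<^esub> x = (\<lambda>s\<in>states_of_height V i. a \<odot>\<^bsub>M s j\<^esub> x s)"
    and smD: "a \<odot>\<^bsub>?D i\<^esub> x' = (\<lambda>s\<in>states_of_height V i. a \<odot>\<^bsub>N s j\<^esub> x' s)"
    and zC: "\<zero>\<^bsub>?C i\<^esub> = (\<lambda>s\<in>states_of_height V i. \<zero>\<^bsub>M s j\<^esub>)"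
    and zD: "\<zero>\<^bsub>?D i\<^esub> = (\<lambda>s\<in>states_of_height V i. \<zero>\<^bsub>N s j\<^esub>)" for i a x y x' y'
    by (simp_all add: cube_chains_def direct_sum_def)
  have Pbij: "bij_betw (P i) (carrier (?C i)) (carrier (?D i))" for i
  proof (rule bij_betwI)
    let ?q = "\<lambda>y. \<lambda>s\<in>states_of_height V i. the_inv_into (carrier (M s j)) (p s) (y s)"
    have inv: "the_inv_into (carrier (M s j)) (p s) y \<in> carrier (M s j)"
      "p s (the_inv_into (carrier (M s j)) (p s) y) = y"
      if "s \<subseteq> V" "y \<in> carrier (N s j)" for s y
      using p(2)[OF that(1)] that(2) bij_betwE[OF bij_betw_the_inv_into] f_the_inv_into_f_bij_betw
      by (blast, metis)
    show "P i \<in> carrier (?C i) \<rightarrow> carrier (?D i)"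
      using mod_homD(1)[OF p(1)] st by (auto simp: C D P_def PiE_iff)
    show "?q \<in> carrier (?D i) \<rightarrow> carrier (?C i)"
      using inv st by (auto simp: C D PiE_iff)
    show "?q (P i x) = x" if "x \<in> carrier (?C i)" for x
    proof (rule PiE_ext[OF _ that[unfolded C]])
      have inj: "the_inv_into (carrier (M s j)) (p s) (p s (x s)) = x s" if "s \<in> states_of_height V i" for s
        using p(2)[OF st[OF that]] \<open>x \<in> carrier (?C i)\<close> that
        by (intro the_inv_into_f_f) (auto simp: bij_betw_def C)
      then show "?q (P i x) \<in> (\<Pi>\<^sub>E s\<in>states_of_height V i. carrier (M s j))"
        using that by (auto simp: C P_def)
      show "?q (P i x) s = x s" if "s \<in> states_of_height V i" for s
        using inj[OF that] that by (simp add: P_def)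
    qed
    show "P i (?q y) = y" if "y \<in> carrier (?D i)" for y
    proof (rule PiE_ext[OF _ that[unfolded D]])
      have yN: "y s \<in> carrier (N s j)" if "s \<in> states_of_height V i" for s
        using \<open>y \<in> carrier (?D i)\<close> that by (auto simp: D)
      have pq: "P i (?q y) s = y s" if "s \<in> states_of_height V i" for s
        using inv(2)[OF st[OF that] yN[OF that]] that by (simp add: P_def)
      then show "P i (?q y) s = y s" if "s \<in> states_of_height V i" for s
        using that .
      show "P i (?q y) \<in> (\<Pi>\<^sub>E s\<in>states_of_height V i. carrier (N s j))"
        using yN pq by (auto simp: PiE_iff P_def)
    qed
  qed
  have Phom: "P i \<in> mod_hom R (?C i) (?D i)" for i
  proof (rule mod_homI)
    show "P i x \<in> carrier (?D i)" if "x \<in> carrier (?C i)" for x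
      using bij_betwE[OF Pbij] that by blast
    show "P i (x \<oplus>\<^bsub>?C i\<^esub> y) = P i x \<oplus>\<^bsub>?D i\<^esub> P i y" if "x \<in> carrier (?C i)" "y \<in> carrier (?C i)" for x y
      unfolding P_def addC addD
    proof (rule restrict_ext)
      fix s assume s: "s \<in> states_of_height V i"
      then have "x s \<in> carrier (M s j)" "y s \<in> carrier (M s j)"
        using that by (auto simp: C)
      then show "p s ((\<lambda>s\<in>states_of_height V i. x s \<oplus>\<^bsub>M s j\<^esub> y s) s) =
          (\<lambda>s\<in>states_of_height V i. p s (x s)) s \<oplus>\<^bsub>N s j\<^esub> (\<lambda>s\<in>states_of_height V i. p s (y s)) s"
        using s mod_homD(2)[OF p(1)[OF st[OF s]]] by simp
    qed
    show "P i (a \<odot>\<^bsub>?C i\<^esub> x) = a \<odot>\<^bsub>?D i\<^esub> P i x" if "a \<in> carrier R" "x \<in> carrier (?C i)" for a x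
      unfolding P_def smC smD
    proof (rule restrict_ext)
      fix s assume s: "s \<in> states_of_height V i"
      then have "x s \<in> carrier (M s j)"
        using that by (auto simp: C)
      then show "p s ((\<lambda>s\<in>states_of_height V i. a \<odot>\<^bsub>M s j\<^esub> x s) s) =
          a \<odot>\<^bsub>N s j\<^esub> (\<lambda>s\<in>states_of_height V i. p s (x s)) s"
        using s that mod_homD(3)[OF p(1)[OF st[OF s]]] by simp
    qed
  qed
  \<comment> \<open>The differential at \<open>t\<close> sums over the edges that end in
    \<open>t\<close>; their sources \<open>t - {v}\<close> have height one less.\<close>
  have step: "t - {v} \<in> states_of_height V i \<and> t - {v} \<subseteq> V \<and> v \<in> V - (t - {v}) \<and> insert v (t - {v}) = t"
    if "t \<in> states_of_height V (i + 1)" "v \<in> t" for t v i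
  proof -
    have "finite t"
      using st[OF that(1)] V by (rule finite_subset)
    moreover from this have "0 < card t"
      using that(2) by (auto simp: card_gt_0_iff)
    ultimately have "int (card (t - {v})) = int (card t) - 1"
      using that by (simp add: card_Diff_singleton)
    then show ?thesis
      using that by (auto simp: states_of_height_def)
  qed
  have summand: "\<delta> (t - {v}) v j (x (t - {v})) \<in> carrier (M t j)"
    "p t (\<delta> (t - {v}) v j (x (t - {v}))) = \<delta>' (t - {v}) v j (p (t - {v}) (x (t - {v})))"
    if "x \<in> carrier (?C i)" "t \<in> states_of_height V (i + 1)" "v \<in> t" for x t v i
  proof -
    note s = step[OF that(2,3)]
    have x: "x (t - {v}) \<in> carrier (M (t - {v}) j)"
      using that(1) s by (auto simp: C)
    show "\<delta> (t - {v}) v j (x (t - {v})) \<in> carrier (M t j)"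
      using \<delta>[of "t - {v}" v "x (t - {v})"] s x by simp
    show "p t (\<delta> (t - {v}) v j (x (t - {v}))) = \<delta>' (t - {v}) v j (p (t - {v}) (x (t - {v})))"
      using comm[of "t - {v}" v "x (t - {v})"] s x by simp
  qed
  have d: "?d i x \<in> carrier (?C (i + 1))" if "x \<in> carrier (?C i)" for x i
  proof -
    have "(\<Oplus>\<^bsub>M t j\<^esub> v\<in>t. \<delta> (t - {v}) v j (x (t - {v}))) \<in> carrier (M t j)"
      if t: "t \<in> states_of_height V (i + 1)" for t
    proof -
      interpret module R "M t j" by (rule M[OF st[OF t]])
      show ?thesis
        using summand(1)[OF \<open>x \<in> carrier (?C i)\<close> t] by (intro M.finsum_closed) auto
    qed
    then show ?thesis
      by (auto simp: cube_differential_def C)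
  qed
  have chain: "P (i + 1) (?d i x) = ?d' i (P i x)" if x: "x \<in> carrier (?C i)" for x i
  proof -
    have "p t (\<Oplus>\<^bsub>M t j\<^esub> v\<in>t. \<delta> (t - {v}) v j (x (t - {v}))) =
        (\<Oplus>\<^bsub>N t j\<^esub> v\<in>t. \<delta>' (t - {v}) v j (P i x (t - {v})))" if t: "t \<in> states_of_height V (i + 1)" for t
    proof -
      interpret M: module R "M t j" by (rule M[OF st[OF t]])
      interpret N: module R "N t j" by (rule N[OF st[OF t]])
      have "finite t"
        using st[OF t] V finite_subset by blast
      then have "p t (\<Oplus>\<^bsub>M t j\<^esub> v\<in>t. \<delta> (t - {v}) v j (x (t - {v}))) =
          (\<Oplus>\<^bsub>N t j\<^esub> v\<in>t. p t (\<delta> (t - {v}) v j (x (t - {v}))))"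
        using summand(1)[OF x t] by (intro mod_hom_finsum[OF M.module_axioms N.module_axioms p(1)[OF st[OF t]]]) auto
      also have "\<dots> = (\<Oplus>\<^bsub>N t j\<^esub> v\<in>t. \<delta>' (t - {v}) v j (P i x (t - {v})))"
      proof (rule N.finsum_cong'[OF refl])
        have eq: "p t (\<delta> (t - {v}) v j (x (t - {v}))) = \<delta>' (t - {v}) v j (P i x (t - {v}))" if "v \<in> t" for v
          using summand(2)[OF x t that] step[OF t that] by (simp add: P_def)
        then show "p t (\<delta> (t - {v}) v j (x (t - {v}))) = \<delta>' (t - {v}) v j (P i x (t - {v}))" if "v \<in> t" for v
          using that .
        show "(\<lambda>v. \<delta>' (t - {v}) v j (P i x (t - {v}))) \<in> t \<rightarrow> carrier (N t j)"
          using eq mod_homD(1)[OF p(1)[OF st[OF t]] summand(1)[OF x t]] by fastforce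
      qed
      finally show ?thesis .
    qed
    then show ?thesis
      by (auto simp: P_def cube_differential_def intro!: restrict_ext)
  qed
  have Pz: "P i \<zero>\<^bsub>?C i\<^esub> = \<zero>\<^bsub>?D i\<^esub>" "\<zero>\<^bsub>?C i\<^esub> \<in> carrier (?C i)" for i
  proof -
    have z: "\<zero>\<^bsub>M s j\<^esub> \<in> carrier (M s j)" "p s \<zero>\<^bsub>M s j\<^esub> = \<zero>\<^bsub>N s j\<^esub>" if "s \<in> states_of_height V i" for s
    proof -
      interpret M: module R "M s j" by (rule M[OF st[OF that]])
      show "\<zero>\<^bsub>M s j\<^esub> \<in> carrier (M s j)" by simp
      show "p s \<zero>\<^bsub>M s j\<^esub> = \<zero>\<^bsub>N s j\<^esub>"
        by (rule mod_hom_zero[OF M N p(1)]) (use st that in auto)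
    qed
    show "P i \<zero>\<^bsub>?C i\<^esub> = \<zero>\<^bsub>?D i\<^esub>"
      unfolding P_def zC zD by (rule restrict_ext) (use z in simp)
    show "\<zero>\<^bsub>?C i\<^esub> \<in> carrier (?C i)"
      unfolding zC C using z by auto
  qed
  have ker: "P i ` a_kernel (?C i) (?C (i + 1)) (?d i) = a_kernel (?D i) (?D (i + 1)) (?d' i)"
  proof -
    have key: "?d' i (P i x) = \<zero>\<^bsub>?D (i + 1)\<^esub> \<longleftrightarrow> ?d i x = \<zero>\<^bsub>?C (i + 1)\<^esub>" if x: "x \<in> carrier (?C i)" for x
      using chain[OF x] Pz[of "i + 1"] d[OF x] Pbij[of "i + 1"] by (metis bij_betw_imp_inj_on inj_on_eq_iff)
    have "{y \<in> carrier (?D i). ?d' i y = \<zero>\<^bsub>?D (i + 1)\<^esub>} =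
        P i ` {x \<in> carrier (?C i). ?d' i (P i x) = \<zero>\<^bsub>?D (i + 1)\<^esub>}"
      unfolding bij_betw_imp_surj_on[OF Pbij, symmetric] by (rule Compr_image_eq)
    also have "{x \<in> carrier (?C i). ?d' i (P i x) = \<zero>\<^bsub>?D (i + 1)\<^esub>} =
        {x \<in> carrier (?C i). ?d i x = \<zero>\<^bsub>?C (i + 1)\<^esub>}"
      by (rule Collect_cong) (rule conj_cong[OF refl key])
    finally show ?thesis
      unfolding a_kernel_def' by simp
  qed
  have im: "P i ` ?d (i - 1) ` carrier (?C (i - 1)) = ?d' (i - 1) ` carrier (?D (i - 1))"
  proof -
    have "P i ` ?d (i - 1) ` carrier (?C (i - 1)) = ?d' (i - 1) ` P (i - 1) ` carrier (?C (i - 1))"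
      unfolding image_image using chain[of _ "i - 1"] by (intro image_cong) auto
    then show ?thesis
      using bij_betw_imp_surj_on[OF Pbij] by simp
  qed
  have closed: "x \<oplus>\<^bsub>?C i\<^esub> y \<in> carrier (?C i)" "a \<in> carrier R \<Longrightarrow> a \<odot>\<^bsub>?C i\<^esub> x \<in> carrier (?C i)"
    if "x \<in> carrier (?C i)" "y \<in> carrier (?C i)" for x y a
  proof -
    have "x s \<oplus>\<^bsub>M s j\<^esub> y s \<in> carrier (M s j)" "a \<in> carrier R \<Longrightarrow> a \<odot>\<^bsub>M s j\<^esub> x s \<in> carrier (M s j)"
      if s: "s \<in> states_of_height V i" for s
    proof -
      interpret M: module R "M s j" by (rule M[OF st[OF s]])
      have "x s \<in> carrier (M s j)" "y s \<in> carrier (M s j)"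
        using \<open>x \<in> carrier (?C i)\<close> \<open>y \<in> carrier (?C i)\<close> s by (auto simp: C)
      then show "x s \<oplus>\<^bsub>M s j\<^esub> y s \<in> carrier (M s j)" "a \<in> carrier R \<Longrightarrow> a \<odot>\<^bsub>M s j\<^esub> x s \<in> carrier (M s j)"
        by auto
    qed
    then show "x \<oplus>\<^bsub>?C i\<^esub> y \<in> carrier (?C i)" "a \<in> carrier R \<Longrightarrow> a \<odot>\<^bsub>?C i\<^esub> x \<in> carrier (?C i)"
      by (auto simp: addC smC C)
  qed
  show ?thesis
    unfolding cube_homology_def Let_def
  proof (rule quotient_module_isomorphic[OF Pbij Phom _ _ _ ker _ im])
    show "a_kernel (?C i) (?C (i + 1)) (?d i) \<subseteq> carrier (?C i)"
      by (auto simp: a_kernel_def')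
    show "?d (i - 1) ` carrier (?C (i - 1)) \<subseteq> carrier (?C i)"
      using d[of _ "i - 1"] by auto
  qed (use closed in auto)
qed

section \<open>Ordered tensor products are free on the labellings\<close>

lemma span_module:
  assumes "module R M" "S \<subseteq> carrier M"
  shows "submodule (span_module R M S) R M" "S \<subseteq> span_module R M S"
    "submodule N R M \<Longrightarrow> S \<subseteq> N \<Longrightarrow> span_module R M S \<subseteq> N"
proof -
  interpret M: module R M by fact
  have carr: "submodule (carrier M) R M"
    by (rule M.carrier_is_submodule)
  show "submodule (span_module R M S) R M"
  proof (rule M.submoduleI)
    show "span_module R M S \<subseteq> carrier M"
      using carr assms(2) by (auto simp: span_module_def)
    have z: "\<zero>\<^bsub>M\<^esub> \<in> N" if "submodule N R M" for N
      using subgroup.one_closed[OF submodule.axioms(1)[OF that]] by simp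
    then show "\<zero>\<^bsub>M\<^esub> \<in> span_module R M S"
      by (auto simp: span_module_def)
    show "\<ominus>\<^bsub>M\<^esub> a \<in> span_module R M S" if "a \<in> span_module R M S" for a
      using that M.submoduleE(3) by (auto simp: span_module_def)
    show "a \<oplus>\<^bsub>M\<^esub> b \<in> span_module R M S" if "a \<in> span_module R M S" "b \<in> span_module R M S" for a b
      using that M.submoduleE(5) by (auto simp: span_module_def)
    show "a \<odot>\<^bsub>M\<^esub> x \<in> span_module R M S" if "a \<in> carrier R" "x \<in> span_module R M S" for a x
      using that M.submoduleE(4) by (auto simp: span_module_def)
  qed
  show "S \<subseteq> span_module R M S" "submodule N R M \<Longrightarrow> S \<subseteq> N \<Longrightarrow> span_module R M S \<subseteq> N"
    by (auto simp: span_module_def)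
qed

lemma mod_hom_kernel_submodule:
  assumes "module R M" "module R N" "f \<in> mod_hom R M N"
  shows "submodule {x \<in> carrier M. f x = \<zero>\<^bsub>N\<^esub>} R M"
proof -
  interpret M: module R M by fact
  interpret N: module R N by fact
  note f = mod_homD[OF assms(3)] mod_hom_zero[OF assms]
  have "f (\<ominus>\<^bsub>M\<^esub> x) = \<zero>\<^bsub>N\<^esub>" if x: "x \<in> carrier M" "f x = \<zero>\<^bsub>N\<^esub>" for x
  proof -
    have "f (\<ominus>\<^bsub>M\<^esub> x) = \<zero>\<^bsub>N\<^esub> \<oplus>\<^bsub>N\<^esub> f (\<ominus>\<^bsub>M\<^esub> x)"
      using x f(1) by simp
    also have "\<dots> = f (x \<oplus>\<^bsub>M\<^esub> (\<ominus>\<^bsub>M\<^esub> x))"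
      using x f(2)[of x "\<ominus>\<^bsub>M\<^esub> x"] by simp
    also have "\<dots> = \<zero>\<^bsub>N\<^esub>"
      using x f(4) by (simp add: M.r_neg)
    finally show ?thesis .
  qed
  then show ?thesis
    using f by (intro M.submoduleI) auto
qed

lemma UNIV_label: "UNIV = {Lab_1, Lab_X}"
  using label.exhaust by blast

section \<open>Words and the labellings that they carry\<close>

context coherent_diagram
begin

text \<open>The sign relative to the preferred generator with orientation
  \<open>C \<inter> G\<close>. The other orientation \<open>C - G\<close> is nonempty, so the
  inclusion in \<open>G\<close> tells the two apart.\<close>

definition factor_sign :: "'v half_edge factor \<Rightarrow> int"
  where "factor_sign f = (case f of One_at C \<Rightarrow> 1 | X_at C ori \<Rightarrow> if ori \<subseteq> G then 1 else - 1)"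

definition word_labelling :: "'v set \<Rightarrow> 'v half_edge factor list \<Rightarrow> 'v half_edge set \<Rightarrow> label"
  where "word_labelling s w =
    (\<lambda>C\<in>circles K s. the (map_of (map (\<lambda>f. (factor_circle f, factor_label f)) w) C))"

lemma wordsD:
  assumes "w \<in> words K s j"
  shows "distinct (map factor_circle w)" "factor_circle ` set w = circles K s"
    "X_at C ori \<in> set w \<Longrightarrow> ori \<in> orientations K s C"
    "(\<Sum>f\<leftarrow>w. label_degree (factor_label f)) + int (card s) = j"
  using assms by (auto simp: words_def)

lemma words_cong:
  assumes "w \<in> words K s j" "map factor_circle u = map factor_circle w" "map factor_label u = map factor_label w"
    "\<And>C ori. X_at C ori \<in> set u \<Longrightarrow> ori \<in> orientations K s C"
  shows "u \<in> words K s j"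
proof -
  have "factor_circle ` set u = factor_circle ` set w"
    using assms(2) by (metis list.set_map)
  moreover have "(\<Sum>f\<leftarrow>u. label_degree (factor_label f)) = (\<Sum>f\<leftarrow>w. label_degree (factor_label f))"
    using arg_cong[OF assms(3), of "\<lambda>xs. sum_list (map label_degree xs)"] by (simp add: comp_def)
  ultimately show ?thesis
    using assms(1,2,4) by (auto simp: words_def)
qed

lemma word_labelling_eqI:
  assumes w: "distinct (map factor_circle w)" "factor_circle ` set w = circles K s"
    and l: "l \<in> extensional (circles K s)" "\<And>f. f \<in> set w \<Longrightarrow> l (factor_circle f) = factor_label f"
  shows "word_labelling s w = l"
proof
  fix C
  show "word_labelling s w C = l C"
  proof (cases "C \<in> circles K s")
    case True
    then obtain f where f: "f \<in> set w" "C = factor_circle f"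
      using w(2) by auto
    have "map_of (map (\<lambda>f. (factor_circle f, factor_label f)) w) C = Some (factor_label f)"
      using w(1) f by (intro map_of_is_SomeI) (auto simp: comp_def)
    then show ?thesis
      using True f l(2) by (simp add: word_labelling_def)
  qed (use l(1) in \<open>simp add: word_labelling_def extensional_def\<close>)
qed

lemma word_labelling_factor:
  assumes w: "distinct (map factor_circle w)" "factor_circle ` set w = circles K s" and f: "f \<in> set w"
  shows "word_labelling s w (factor_circle f) = factor_label f"
proof -
  have "map_of (map (\<lambda>f. (factor_circle f, factor_label f)) w) (factor_circle f) = Some (factor_label f)"
    using w(1) f by (intro map_of_is_SomeI) (auto simp: comp_def)
  moreover have "factor_circle f \<in> circles K s"
    using w(2) f by auto
  ultimately show ?thesis
    by (simp add: word_labelling_def)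
qed

lemma word_labelling_in:
  assumes w: "w \<in> words K s j"
  shows "word_labelling s w \<in> labellings K s j"
proof -
  let ?l = "word_labelling s w"
  have "(\<Sum>C\<in>circles K s. label_degree (?l C)) = (\<Sum>C\<leftarrow>map factor_circle w. label_degree (?l C))"
    using sum_list_distinct_conv_sum_set[OF wordsD(1)[OF w], of "\<lambda>C. label_degree (?l C)"]
      wordsD(2)[OF w] by simp
  also have "\<dots> = (\<Sum>f\<leftarrow>w. label_degree (factor_label f))"
    using word_labelling_factor[OF wordsD(1,2)[OF w]] by (simp add: comp_def cong: map_cong)
  finally show ?thesis
    using wordsD(4)[OF w] by (auto simp: labellings_def word_labelling_def)
qed

definition labelled_factor ::
    "('v half_edge set \<Rightarrow> 'v half_edge set) \<Rightarrow> ('v half_edge set \<Rightarrow> label) \<Rightarrow> 'v half_edge set \<Rightarrow> 'v half_edge factor"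
  where "labelled_factor ors l C = (case l C of Lab_1 \<Rightarrow> One_at C | Lab_X \<Rightarrow> X_at C (ors C))"

lemma factor_of_labelled_factor [simp]:
  "factor_circle (labelled_factor ors l C) = C" "factor_label (labelled_factor ors l C) = l C"
  by (auto simp: labelled_factor_def split: label.splits)

text \<open>Realises a labelling with any order of the circles and any choice \<open>ors\<close> of
  orientations: preferred ones to show that every labelling occurs, local ones to place the circles
  of a crossing in front.\<close>

lemma labelled_word:
  assumes l: "l \<in> labellings K s j" and c: "distinct c" "set c = circles K s"
    and ors: "\<And>C. C \<in> circles K s \<Longrightarrow> ors C \<in> orientations K s C"
  shows "map (labelled_factor ors l) c \<in> words K s j" "word_labelling s (map (labelled_factor ors l) c) = l"
proof -
  let ?w = "map (labelled_factor ors l) c"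
  have cs: "map factor_circle ?w = c" "factor_circle ` set ?w = circles K s"
    using c by (auto simp: comp_def image_image)
  have "(\<Sum>f\<leftarrow>?w. label_degree (factor_label f)) = (\<Sum>C\<in>circles K s. label_degree (l C))"
    using c by (simp add: comp_def sum_list_distinct_conv_sum_set)
  moreover have "ori \<in> orientations K s C" if "X_at C ori \<in> set ?w" for C ori
    using that ors c(2) by (auto simp: labelled_factor_def split: label.splits)
  ultimately show "?w \<in> words K s j"
    using l cs c(1) by (auto simp: words_def labellings_def)
  show "word_labelling s ?w = l"
    by (rule word_labelling_eqI) (use cs c l in \<open>auto simp: labellings_def PiE_def\<close>)
qed

lemma finite_words: "finite (words K s j)"
proof -
  let ?F = "One_at ` circles K s \<union> (\<Union>C\<in>circles K s. X_at C ` orientations K s C)"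
  have "finite ?F"
    using finite_circles by (auto simp: orientations_eq(1))
  then have "finite {w. set w \<subseteq> ?F \<and> length w = card (circles K s)}"
    by (rule finite_lists_length_eq)
  moreover have "words K s j \<subseteq> {w. set w \<subseteq> ?F \<and> length w = card (circles K s)}"
  proof
    fix w assume w: "w \<in> words K s j"
    have "length w = card (circles K s)"
      using distinct_card[OF wordsD(1)[OF w]] wordsD(2)[OF w] by simp
    moreover have "f \<in> ?F" if "f \<in> set w" for f
    proof -
      have "factor_circle f \<in> circles K s"
        unfolding wordsD(2)[OF w, symmetric] using that by (rule imageI)
      show ?thesis
      proof (cases f)
        case (X_at C ori)
        then have "C \<in> circles K s" "ori \<in> orientations K s C"
          using \<open>factor_circle f \<in> circles K s\<close> wordsD(3)[OF w] that by simp_all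
        then show ?thesis
          unfolding X_at by blast
      qed (use \<open>factor_circle f \<in> circles K s\<close> in simp)
    qed
    ultimately show "w \<in> {w. set w \<subseteq> ?F \<and> length w = card (circles K s)}"
      by auto
  qed
  ultimately show ?thesis
    by (rule finite_subset[rotated])
qed

lemma finite_labellings: "finite (labellings K s j)"
proof -
  have "finite (UNIV :: label set)"
    unfolding UNIV_label by simp
  then have "finite (circles K s \<rightarrow>\<^sub>E (UNIV :: label set))"
    by (intro finite_PiE finite_circles)
  then show ?thesis
    by (rule finite_subset[rotated]) (auto simp: labellings_def)
qed

lemma words_permute:
  assumes w: "w \<in> words K s j" and \<sigma>: "\<sigma> permutes {..<length w}"
  shows "permute_list \<sigma> w \<in> words K s j" "word_labelling s (permute_list \<sigma> w) = word_labelling s w"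
proof -
  have m: "map factor_circle (permute_list \<sigma> w) = permute_list \<sigma> (map factor_circle w)"
    using \<sigma> by (simp add: permute_list_map)
  have d: "distinct (map factor_circle (permute_list \<sigma> w))"
    unfolding m using wordsD(1)[OF w] \<sigma> by (simp del: distinct_map)
  have "mset (map (\<lambda>f. label_degree (factor_label f)) (permute_list \<sigma> w)) =
      mset (map (\<lambda>f. label_degree (factor_label f)) w)"
    using \<sigma> by simp
  then have "(\<Sum>f\<leftarrow>permute_list \<sigma> w. label_degree (factor_label f)) = (\<Sum>f\<leftarrow>w. label_degree (factor_label f))"
    by (metis sum_mset_sum_list)
  then show "permute_list \<sigma> w \<in> words K s j"
    using d wordsD[OF w] \<sigma> by (auto simp: words_def)
  show "word_labelling s (permute_list \<sigma> w) = word_labelling s w"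
    by (rule word_labelling_eqI)
       (use d wordsD(1,2)[OF w] \<sigma> word_labelling_factor[OF wordsD(1,2)[OF w]] in
         \<open>auto simp: word_labelling_def\<close>)
qed

lemma factor_sign_unit: "factor_sign f \<in> {1, - 1}"
  by (auto simp: factor_sign_def split: factor.splits)

lemma prod_list_signs: "(\<Prod>f\<leftarrow>w. factor_sign f) \<in> {1, - 1}"
proof (induction w)
  case (Cons f w)
  then show ?case
    using factor_sign_unit[of f] by auto
qed simp

lemma factor_sign_X:
  assumes "C \<in> circles K s"
  shows "factor_sign (X_at C (C \<inter> G)) = 1" "factor_sign (X_at C (C - G)) = - 1"
  using orientations_eq(5)[OF assms] by (auto simp: factor_sign_def)

lemma words_flip:
  assumes w: "w \<in> words K s j" and k: "k < length w" "w ! k = X_at C ori"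
  shows "w[k := X_at C (mate K ` ori)] \<in> words K s j"
    "word_labelling s (w[k := X_at C (mate K ` ori)]) = word_labelling s w"
    "(\<Prod>f\<leftarrow>w[k := X_at C (mate K ` ori)]. factor_sign f) = - (\<Prod>f\<leftarrow>w. factor_sign f)"
    "map factor_circle (w[k := X_at C (mate K ` ori)]) = map factor_circle w"
proof -
  let ?u = "w[k := X_at C (mate K ` ori)]"
  have C: "C \<in> circles K s" and ori: "ori \<in> orientations K s C"
    using wordsD(2,3)[OF w] k nth_mem[OF k(1)] by force+
  note o = orientations_eq[OF C]
  have m: "map factor_circle ?u = map factor_circle w" "map factor_label ?u = map factor_label w"
    using k by (auto simp: map_update list_update_same_conv)
  then show "map factor_circle ?u = map factor_circle w"
    by simp
  show u: "?u \<in> words K s j"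
  proof (rule words_cong[OF w m])
    fix C' ori' assume "X_at C' ori' \<in> set ?u"
    then have "X_at C' ori' = X_at C (mate K ` ori) \<or> X_at C' ori' \<in> set w"
      using set_update_subset_insert by fastforce
    then show "ori' \<in> orientations K s C'"
      using wordsD(3)[OF w] ori o by auto
  qed
  show "word_labelling s ?u = word_labelling s w"
  proof (rule word_labelling_eqI[OF wordsD(1,2)[OF u]])
    show "word_labelling s w \<in> extensional (circles K s)"
      by (simp add: word_labelling_def)
    fix f assume "f \<in> set ?u"
    then have "f = X_at C (mate K ` ori) \<or> f \<in> set w"
      using set_update_subset_insert by fastforce
    then show "word_labelling s w (factor_circle f) = factor_label f"
      using word_labelling_factor[OF wordsD(1,2)[OF w]] nth_mem[OF k(1)] k(2) by force
  qed
  have "factor_sign (X_at C (mate K ` ori)) = - factor_sign (X_at C ori)"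
  proof -
    have "ori = C \<inter> G \<or> ori = C - G"
      using ori unfolding o(1) by blast
    then show ?thesis
      using factor_sign_X[OF C] o(2,3) by (elim disjE) simp_all
  qed
  then have "factor_sign (X_at C (mate K ` ori)) = - factor_sign (w ! k)"
    using k(2) by simp
  then show "(\<Prod>f\<leftarrow>?u. factor_sign f) = - (\<Prod>f\<leftarrow>w. factor_sign f)"
    using k(1) by (simp add: upd_conv_take_nth_drop id_take_nth_drop[of k w, symmetric])
       (metis (no_types, lifting) id_take_nth_drop list.simps(9) map_append mult_minus_left mult_minus_right
         prod_list.Cons prod_list.append)
qed

end

section \<open>Signed words as a presentation of the free module on the labellings\<close>

locale sign_system = coherent_diagram K G for K :: "'v diagram" and G :: "'v half_edge set" +
  fixes R :: "('r, 'x) ring_scheme" and vs :: "'v list"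
    and D :: "'v set \<Rightarrow> 'v half_edge set list \<Rightarrow> int"
  assumes cring: "cring R"
    and D_unit: "\<And>s c. s \<subseteq> classical K \<Longrightarrow> distinct c \<Longrightarrow> set c = circles K s \<Longrightarrow> D s c \<in> {1, - 1}"
    and D_alternating: "\<And>s. alternating (D s)"
    and D_merge: "\<And>s v c. s \<subseteq> classical K \<Longrightarrow> v \<in> classical K - s \<Longrightarrow> two_at s v \<Longrightarrow>
      set c \<subseteq> circles K s - {circ s (ul v), circ s (lr v)} \<Longrightarrow>
      D (insert v s) (circ (insert v s) (ul v) # c) =
        (- 1) ^ ones_before vs s v * D s (circ s (ul v) # circ s (lr v) # c)"
    and D_split: "\<And>s v c. s \<subseteq> classical K \<Longrightarrow> v \<in> classical K - s \<Longrightarrow> \<not> two_at s v \<Longrightarrow>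
      set c \<subseteq> circles K (insert v s) - {circ (insert v s) (ul v), circ (insert v s) (lr v)} \<Longrightarrow>
      corner_sign v * D (insert v s) (circ (insert v s) (ul v) # circ (insert v s) (lr v) # c) =
        (- 1) ^ ones_before vs s v * D s (circ s (ul v) # c)"
begin

interpretation R: cring R by (rule cring)

text \<open>The coefficient with which a word represents the standard basis element of its
  labelling: \<open>D\<close> accounts for the order of the factors, the product for their
  orientations.\<close>

definition word_sign :: "'v set \<Rightarrow> 'v half_edge factor list \<Rightarrow> int"
  where "word_sign s w = D s (map factor_circle w) * (\<Prod>f\<leftarrow>w. factor_sign f)"

lemma word_sign_unit:
  assumes "s \<subseteq> classical K" "w \<in> words K s j"
  shows "word_sign s w \<in> {1, - 1}"
  using D_unit[OF assms(1) wordsD(1)[OF assms(2)]] wordsD(2)[OF assms(2)] prod_list_signs[of w]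
  by (auto simp: word_sign_def)

lemma word_sign_permute:
  assumes "w \<in> words K s j" "\<sigma> permutes {..<length w}"
  shows "word_sign s (permute_list \<sigma> w) = sign \<sigma> * word_sign s w"
proof -
  have "D s (map factor_circle (permute_list \<sigma> w)) = sign \<sigma> * D s (map factor_circle w)"
    using alternatingD[OF D_alternating, of \<sigma> "map factor_circle w" s] assms(2)
    by (simp add: permute_list_map)
  moreover have "(\<Prod>f\<leftarrow>permute_list \<sigma> w. factor_sign f) = (\<Prod>f\<leftarrow>w. factor_sign f)"
    using assms(2) by (metis mset_map mset_permute_list prod_mset_prod_list)
  ultimately show ?thesis
    by (simp add: word_sign_def)
qed

lemma word_sign_flip:
  assumes "w \<in> words K s j" "k < length w" "w ! k = X_at C ori"
  shows "word_sign s (w[k := X_at C (mate K ` ori)]) = - word_sign s w"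
  using words_flip[OF assms] by (simp add: word_sign_def)

context
  fixes s :: "'v set" and j :: int
  assumes s: "s \<subseteq> classical K"
begin

abbreviation "F \<equiv> free_module R (words K s j)"
abbreviation "U \<equiv> free_module R (labellings K s j)"
abbreviation "e \<equiv> word_vector R K s j"
abbreviation "I \<equiv> span_module R F (word_relations R K s j)"

interpretation F: module R F by (rule module_free_module[OF cring])
interpretation U: module R U by (rule module_free_module[OF cring])

lemma e_carrier [simp]: "e w \<in> carrier F"
  by (simp add: word_vector_def basis_vector_carrier[OF cring])

lemma word_relations_carrier: "word_relations R K s j \<subseteq> carrier F"
  by (auto simp: word_relations_def Let_def)

lemma I_submodule: "submodule I R F"
  and relations_I: "word_relations R K s j \<subseteq> I"
  by (rule span_module[OF F.module_axioms word_relations_carrier])+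

text \<open>Up to a sign, the congruence modulo \<open>I\<close> of the two generators, each
  multiplied by its \<open>word_sign\<close>. Stated as a relation between words, it can be chained
  through intermediate words.\<close>

definition sign_equivalent :: "'v half_edge factor list \<Rightarrow> 'v half_edge factor list \<Rightarrow> bool"
  where "sign_equivalent w w' \<longleftrightarrow>
    e w \<ominus>\<^bsub>F\<^esub> sign_scalar R (word_sign s w * word_sign s w') \<odot>\<^bsub>F\<^esub> e w' \<in> I"

lemma sign_equivalent_refl:
  assumes "w \<in> words K s j"
  shows "sign_equivalent w w"
proof -
  have "word_sign s w * word_sign s w = 1"
    using word_sign_unit[OF s assms] by auto
  then have "e w \<ominus>\<^bsub>F\<^esub> sign_scalar R (word_sign s w * word_sign s w) \<odot>\<^bsub>F\<^esub> e w = \<zero>\<^bsub>F\<^esub>"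
    by (simp add: sign_scalar_def F.minus_eq F.r_neg)
  moreover have "\<zero>\<^bsub>F\<^esub> \<in> I"
    using subgroup.one_closed[OF submodule.axioms(1)[OF I_submodule]] by simp
  ultimately show ?thesis
    by (simp add: sign_equivalent_def)
qed

lemma sign_equivalent_trans:
  assumes w: "w \<in> words K s j" "w' \<in> words K s j" "w'' \<in> words K s j"
    and 1: "sign_equivalent w w'" and 2: "sign_equivalent w' w''"
  shows "sign_equivalent w w''"
proof -
  note I = F.submoduleE[OF I_submodule]
  let ?a = "sign_scalar R (word_sign s w * word_sign s w')"
    and ?b = "sign_scalar R (word_sign s w' * word_sign s w'')"
  note u = word_sign_unit[OF s w(1)] word_sign_unit[OF s w(2)] word_sign_unit[OF s w(3)]
  have "(word_sign s w * word_sign s w') * (word_sign s w' * word_sign s w'') = word_sign s w * word_sign s w''"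
    using u by auto
  moreover have "word_sign s w * word_sign s w' \<in> {1, - 1}" "word_sign s w' * word_sign s w'' \<in> {1, - 1}"
    using u by auto
  ultimately have ab: "sign_scalar R (word_sign s w * word_sign s w'') = ?a \<otimes>\<^bsub>R\<^esub> ?b"
    using R.sign_scalar_mult by metis
  have "(e w \<ominus>\<^bsub>F\<^esub> ?a \<odot>\<^bsub>F\<^esub> e w') \<oplus>\<^bsub>F\<^esub> ?a \<odot>\<^bsub>F\<^esub> (e w' \<ominus>\<^bsub>F\<^esub> ?b \<odot>\<^bsub>F\<^esub> e w'') \<in> I"
    using 1 2 by (intro I(4,5)) (auto simp: sign_equivalent_def)
  moreover have "(e w \<ominus>\<^bsub>F\<^esub> ?a \<odot>\<^bsub>F\<^esub> e w') \<oplus>\<^bsub>F\<^esub> ?a \<odot>\<^bsub>F\<^esub> (e w' \<ominus>\<^bsub>F\<^esub> ?b \<odot>\<^bsub>F\<^esub> e w'') =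
      e w \<ominus>\<^bsub>F\<^esub> (?a \<otimes>\<^bsub>R\<^esub> ?b) \<odot>\<^bsub>F\<^esub> e w''"
  proof -
    let ?x = "?a \<odot>\<^bsub>F\<^esub> e w'" and ?y = "?a \<odot>\<^bsub>F\<^esub> (?b \<odot>\<^bsub>F\<^esub> e w'')"
    have "?a \<odot>\<^bsub>F\<^esub> (e w' \<ominus>\<^bsub>F\<^esub> ?b \<odot>\<^bsub>F\<^esub> e w'') = ?x \<ominus>\<^bsub>F\<^esub> ?y"
      by (simp add: F.minus_eq F.smult_r_distr F.smult_r_minus)
    moreover have "(e w \<ominus>\<^bsub>F\<^esub> ?x) \<oplus>\<^bsub>F\<^esub> (?x \<ominus>\<^bsub>F\<^esub> ?y) = e w \<oplus>\<^bsub>F\<^esub> ((\<ominus>\<^bsub>F\<^esub> ?x \<oplus>\<^bsub>F\<^esub> ?x) \<oplus>\<^bsub>F\<^esub> (\<ominus>\<^bsub>F\<^esub> ?y))"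
      unfolding F.minus_eq by (subst F.a_assoc; simp) (subst F.a_assoc; simp)
    ultimately show ?thesis
      by (simp add: F.l_neg F.smult_assoc1 F.minus_eq)
  qed
  ultimately show ?thesis
    by (simp add: sign_equivalent_def ab)
qed

lemma sign_equivalent_permute:
  assumes w: "w \<in> words K s j" and \<sigma>: "\<sigma> permutes {..<length w}"
  shows "sign_equivalent (permute_list \<sigma> w) w"
proof -
  have "word_sign s (permute_list \<sigma> w) * word_sign s w = sign \<sigma>"
    using word_sign_permute[OF w \<sigma>] word_sign_unit[OF s w] by auto
  moreover have "[sign \<sigma>] \<cdot>\<^bsub>F\<^esub> e w = sign_scalar R (sign \<sigma>) \<odot>\<^bsub>F\<^esub> e w"
    by (rule F.add_pow_sign) (auto simp: sign_def)
  moreover have "e (permute_list \<sigma> w) \<ominus>\<^bsub>F\<^esub> [sign \<sigma>] \<cdot>\<^bsub>F\<^esub> e w \<in> I"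
    using relations_I w \<sigma> unfolding word_relations_def Let_def by blast
  ultimately show ?thesis
    by (simp add: sign_equivalent_def)
qed

lemma sign_equivalent_flip:
  assumes w: "w \<in> words K s j" and k: "k < length w" "w ! k = X_at C ori"
  shows "sign_equivalent (w[k := X_at C (mate K ` ori)]) w"
proof -
  have "word_sign s (w[k := X_at C (mate K ` ori)]) * word_sign s w = - 1"
    using word_sign_flip[OF assms] word_sign_unit[OF s w] by auto
  moreover have "e (w[k := X_at C (mate K ` ori)]) \<oplus>\<^bsub>F\<^esub> e w \<in> I"
    using relations_I assms unfolding word_relations_def Let_def by blast
  ultimately show ?thesis
    by (simp add: sign_equivalent_def sign_scalar_def F.smult_l_minus F.minus_eq)
qed

text \<open>The factors of \<open>w\<close> are replaced by those of \<open>w'\<close> one at a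
  time. Consecutive words \<open>?h k\<close> differ at most in the orientation of one
  \<open>X\<close>, which is a single defining relation.\<close>

lemma sign_equivalent_aligned:
  assumes w: "w \<in> words K s j" "w' \<in> words K s j"
    and eq: "map factor_circle w = map factor_circle w'" "map factor_label w = map factor_label w'"
  shows "sign_equivalent w w'"
proof -
  let ?h = "\<lambda>k. take k w' @ drop k w"
  have len: "length w = length w'"
    using eq(1) by (rule map_eq_imp_length_eq)
  have nth: "factor_circle (w ! i) = factor_circle (w' ! i)" "factor_label (w ! i) = factor_label (w' ! i)"
    if "i < length w" for i
    using eq that len by (metis nth_map)+
  have hw: "?h k \<in> words K s j" for k
  proof (rule words_cong[OF w(1)])
    show "map factor_circle (?h k) = map factor_circle w" "map factor_label (?h k) = map factor_label w"
      unfolding map_append take_map[symmetric] drop_map[symmetric] eq by simp_all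
    show "ori \<in> orientations K s C" if "X_at C ori \<in> set (?h k)" for C ori
      using that wordsD(3)[OF w(1)] wordsD(3)[OF w(2)] by (auto dest: in_set_takeD in_set_dropD)
  qed
  have step: "sign_equivalent (?h k) (?h (Suc k))" if k: "k < length w" for k
  proof -
    have upd: "?h k = (?h (Suc k))[k := w ! k]" "?h (Suc k) ! k = w' ! k" "k < length (?h (Suc k))"
      using k len by (auto simp: take_Suc_conv_app_nth list_update_append nth_append Cons_nth_drop_Suc)
    show ?thesis
    proof (cases "w ! k = w' ! k")
      case True
      then have "?h k = ?h (Suc k)"
        using upd by (metis list_update_id)
      then show ?thesis
        using sign_equivalent_refl[OF hw] by metis
    next
      case False
      then obtain C o1 o2 where X: "w ! k = X_at C o1" "w' ! k = X_at C o2" "o1 \<noteq> o2"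
        using nth[OF k] by (cases "w ! k"; cases "w' ! k") auto
      have "X_at C o1 \<in> set w" "X_at C o2 \<in> set w'"
        using X k len nth_mem by metis+
      then have o: "o1 \<in> orientations K s C" "o2 \<in> orientations K s C" and "factor_circle (X_at C o1) \<in> circles K s"
        using wordsD(3)[OF w(1)] wordsD(3)[OF w(2)] wordsD(2)[OF w(1)] by blast+
      then have C: "C \<in> circles K s"
        by simp
      have "o1 = mate K ` o2"
        using o X(3) orientations_eq(1-3)[OF C] by auto
      then show ?thesis
        using sign_equivalent_flip[OF hw upd(3)] upd X by metis
    qed
  qed
  have "sign_equivalent (?h k) (?h (length w))" if "k \<le> length w" for k
    using that
  proof (induction rule: inc_induct)
    case base
    show ?case by (rule sign_equivalent_refl[OF hw])
  next
    case (step k)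
    then show ?case
      using sign_equivalent_trans[OF hw hw hw] \<open>\<And>k. k < length w \<Longrightarrow> sign_equivalent (?h k) (?h (Suc k))\<close>
      by blast
  qed
  from this[of 0] show ?thesis
    using len by simp
qed

text \<open>Permuting \<open>w'\<close> puts its circles into the order of \<open>w\<close>; the
  common labelling then leaves only orientations to be adjusted.\<close>

lemma sign_equivalent_words:
  assumes w: "w \<in> words K s j" "w' \<in> words K s j" and l: "word_labelling s w = word_labelling s w'"
  shows "sign_equivalent w w'"
proof -
  have "mset (map factor_circle w) = mset (map factor_circle w')"
    using wordsD(1,2)[OF w(1)] wordsD(1,2)[OF w(2)]
    by (metis list.set_map set_eq_iff_mset_eq_distinct)
  then obtain \<sigma> where \<sigma>: "\<sigma> permutes {..<length (map factor_circle w')}"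
    "permute_list \<sigma> (map factor_circle w') = map factor_circle w"
    by (rule mset_eq_permutation)
  then have \<sigma>': "\<sigma> permutes {..<length w'}"
    by simp
  let ?u = "permute_list \<sigma> w'"
  note u = words_permute[OF w(2) \<sigma>']
  have c: "map factor_circle w = map factor_circle ?u"
    using \<sigma> \<sigma>' by (simp add: permute_list_map)
  have lab: "map factor_label v = map (word_labelling s v) (map factor_circle v)" if "v \<in> words K s j" for v
    using word_labelling_factor[OF wordsD(1,2)[OF that]] by simp
  have "map factor_label w = map factor_label ?u"
    unfolding lab[OF w(1)] lab[OF u(1)] c u(2) l ..
  from sign_equivalent_trans[OF w(1) u(1) w(2) sign_equivalent_aligned[OF w(1) u(1) c this]
      sign_equivalent_permute[OF w(2) \<sigma>']]
  show ?thesis .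
qed

definition word_map :: "('v half_edge factor list \<Rightarrow> 'r) \<Rightarrow> ('v half_edge set \<Rightarrow> label) \<Rightarrow> 'r"
  where "word_map = linear_extension (words K s j) U
    (\<lambda>w. sign_scalar R (word_sign s w) \<odot>\<^bsub>U\<^esub> basis_vector R (labellings K s j) (word_labelling s w))"

lemma word_map_hom: "word_map \<in> mod_hom R F U"
  unfolding word_map_def
  by (rule linear_extension_hom[OF cring finite_words U.module_axioms])
     (auto intro!: U.smult_closed basis_vector_carrier[OF cring])

lemma word_map_word:
  "w \<in> words K s j \<Longrightarrow> word_map (e w) =
    sign_scalar R (word_sign s w) \<odot>\<^bsub>U\<^esub> basis_vector R (labellings K s j) (word_labelling s w)"
  unfolding word_map_def word_vector_def
  by (rule linear_extension_basis[OF cring finite_words U.module_axioms])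
     (auto intro!: U.smult_closed basis_vector_carrier[OF cring])

text \<open>Permuting a word or reversing an orientation keeps the labelling and changes
  \<open>word_sign\<close> by exactly the sign in the relation.\<close>

lemma word_map_relations:
  assumes "x \<in> word_relations R K s j"
  shows "word_map x = \<zero>\<^bsub>U\<^esub>"
proof -
  note hom = mod_homD[OF word_map_hom]
  have key: "word_map (e u \<ominus>\<^bsub>F\<^esub> sign_scalar R k \<odot>\<^bsub>F\<^esub> e w) = \<zero>\<^bsub>U\<^esub>"
    if "w \<in> words K s j" "u \<in> words K s j" "word_labelling s u = word_labelling s w"
      "word_sign s u = k * word_sign s w" "k \<in> {1, - 1}" for u w k
  proof -
    have neg: "\<ominus>\<^bsub>F\<^esub> x = (\<ominus>\<^bsub>R\<^esub> \<one>\<^bsub>R\<^esub>) \<odot>\<^bsub>F\<^esub> x" if "x \<in> carrier F" for x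
      using that by (simp add: F.smult_l_minus)
    have "word_map (e u \<ominus>\<^bsub>F\<^esub> sign_scalar R k \<odot>\<^bsub>F\<^esub> e w) =
        word_map (e u) \<oplus>\<^bsub>U\<^esub> (\<ominus>\<^bsub>R\<^esub> \<one>\<^bsub>R\<^esub>) \<odot>\<^bsub>U\<^esub> (sign_scalar R k \<odot>\<^bsub>U\<^esub> word_map (e w))"
      using hom by (simp add: F.minus_eq neg)
    also have "sign_scalar R k \<odot>\<^bsub>U\<^esub> word_map (e w) = word_map (e u)"
      unfolding word_map_word[OF that(1)] word_map_word[OF that(2)] that(3,4)
      by (simp add: R.sign_scalar_mult[OF that(5) word_sign_unit[OF s that(1)]] U.smult_assoc1
          basis_vector_carrier[OF cring])
    also have "word_map (e u) \<oplus>\<^bsub>U\<^esub> (\<ominus>\<^bsub>R\<^esub> \<one>\<^bsub>R\<^esub>) \<odot>\<^bsub>U\<^esub> word_map (e u) = \<zero>\<^bsub>U\<^esub>"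
      using hom(1)[of "e u"] by (simp add: U.smult_l_minus U.r_neg)
    finally show ?thesis .
  qed
  consider (permute) \<sigma> w where "x = e (permute_list \<sigma> w) \<ominus>\<^bsub>F\<^esub> [sign \<sigma>] \<cdot>\<^bsub>F\<^esub> e w"
      "w \<in> words K s j" "\<sigma> permutes {..<length w}"
    | (flip) w k C ori where "x = e (w[k := X_at C (mate K ` ori)]) \<oplus>\<^bsub>F\<^esub> e w"
      "w \<in> words K s j" "k < length w" "w ! k = X_at C ori"
    using assms unfolding word_relations_def Let_def by blast
  then show ?thesis
  proof cases
    case permute
    have "[sign \<sigma>] \<cdot>\<^bsub>F\<^esub> e w = sign_scalar R (sign \<sigma>) \<odot>\<^bsub>F\<^esub> e w"
      by (rule F.add_pow_sign) (auto simp: sign_def)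
    moreover have "sign \<sigma> \<in> {1, - 1}"
      by (auto simp: sign_def)
    ultimately show ?thesis
      using key[OF permute(2) words_permute[OF permute(2,3)] word_sign_permute[OF permute(2,3)]]
      by (simp add: permute(1))
  next
    case flip
    have "x = e (w[k := X_at C (mate K ` ori)]) \<ominus>\<^bsub>F\<^esub> sign_scalar R (- 1) \<odot>\<^bsub>F\<^esub> e w"
      by (simp add: flip(1) sign_scalar_def F.smult_l_minus F.minus_eq)
    then show ?thesis
      using key[OF flip(2) words_flip(1,2)[OF flip(2-4)], of "- 1"] word_sign_flip[OF flip(2-4)] by simp
  qed
qed

lemma word_map_kernel: "x \<in> I \<Longrightarrow> word_map x = \<zero>\<^bsub>U\<^esub>"
  using span_module(3)[OF F.module_axioms word_relations_carrier
      mod_hom_kernel_submodule[OF F.module_axioms U.module_axioms word_map_hom]]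
    word_map_relations word_relations_carrier by blast

lemma word_labelling_surj: "word_labelling s ` words K s j = labellings K s j"
proof
  show "word_labelling s ` words K s j \<subseteq> labellings K s j"
    using word_labelling_in by auto
  show "labellings K s j \<subseteq> word_labelling s ` words K s j"
  proof
    fix l assume l: "l \<in> labellings K s j"
    from labelled_word[OF l circle_list(1,2), of "\<lambda>C. C \<inter> G"] show "l \<in> word_labelling s ` words K s j"
      using orientations_eq(1) by (metis imageI insertI1)
  qed
qed

lemma word_quotient: "module_quotient R F U I word_map"
  unfolding word_map_def
  by (rule signed_presentation[OF cring finite_words finite_labellings word_labelling_surj
        word_sign_unit[OF s] I_submodule])
     (use sign_equivalent_words word_map_kernel in
       \<open>auto simp: sign_equivalent_def word_vector_def word_map_def\<close>)

definition tensor_map :: "('v half_edge factor list \<Rightarrow> 'r) set \<Rightarrow> ('v half_edge set \<Rightarrow> label) \<Rightarrow> 'r"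
  where "tensor_map = induced_map word_map"

lemma ordered_tensor_module: "module R (ordered_tensor R K s j)"
  and tensor_map_hom: "tensor_map \<in> mod_hom R (ordered_tensor R K s j) (usual_tensor R K s j)"
  and tensor_map_bij: "bij_betw tensor_map (carrier (ordered_tensor R K s j)) (carrier (usual_tensor R K s j))"
  using module_quotient.module_Q[OF word_quotient] module_quotient.induced_hom[OF word_quotient]
    module_quotient.induced_bij[OF word_quotient]
  by (simp_all add: ordered_tensor_def Let_def tensor_map_def usual_tensor_def)

lemma wedge_carrier: "wedge R K s j w \<in> carrier (ordered_tensor R K s j)"
  using module_quotient.coset_in_Q[OF word_quotient e_carrier[of w]]
  by (simp add: ordered_tensor_def Let_def wedge_def)

lemma tensor_map_wedge:
  "w \<in> words K s j \<Longrightarrow> tensor_map (wedge R K s j w) =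
    sign_scalar R (word_sign s w) \<odot>\<^bsub>usual_tensor R K s j\<^esub>
      basis_vector R (labellings K s j) (word_labelling s w)"
  using module_quotient.induced_map_coset[OF word_quotient e_carrier[of w]] word_map_word[of w]
  by (simp add: tensor_map_def wedge_def Let_def usual_tensor_def)

end

end

section \<open>Partial differentials\<close>

text \<open>Existence comes from transporting \<open>g\<close> along \<open>\<Phi>\<close> and
  \<open>\<Psi>\<close>, uniqueness from having every basis vector, up to sign, among the values
  \<open>\<Phi> (m i)\<close>. \<open>Q\<close> stands for the conditions in the definition of the
  partial differential, which quantify over different data for a merge and for a split.\<close>

lemma linear_map_determined:
  fixes M :: "('r, 'm) module" and N :: "('r, 'n) module" and U :: "('r, 'u) module"
  assumes R: "cring R" and L: "finite L" and mods: "module R M" "module R N" "module R U"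
    and \<Phi>: "\<Phi> \<in> mod_hom R M (free_module R L)" "bij_betw \<Phi> (carrier M) (carrier (free_module R L))"
    and \<Psi>: "\<Psi> \<in> mod_hom R N U" "bij_betw \<Psi> (carrier N) (carrier U)"
    and g: "g \<in> mod_hom R (free_module R L) U"
    and m: "\<And>i. i \<in> X \<Longrightarrow> m i \<in> carrier M"
    and gen: "\<And>l. l \<in> L \<Longrightarrow> \<exists>i\<in>X. \<exists>k. \<Phi> (m i) = sign_scalar R k \<odot>\<^bsub>free_module R L\<^esub> basis_vector R L l"
    and n: "\<And>i. i \<in> X \<Longrightarrow> n i \<in> carrier N" "\<And>i. i \<in> X \<Longrightarrow> \<Psi> (n i) = g (\<Phi> (m i))"
    and Q: "\<And>d. Q d \<longleftrightarrow> (\<forall>i\<in>X. d (m i) = n i)"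
    and x: "x \<in> carrier M"
  defines "d \<equiv> THE d. d \<in> mod_hom R M N \<and> d \<in> extensional (carrier M) \<and> Q d"
  shows "d x \<in> carrier N" "\<Psi> (d x) = g (\<Phi> x)"
proof -
  let ?F = "free_module R L"
  interpret R: cring R by fact
  interpret M: module R M by fact
  interpret N: module R N by fact
  interpret U: module R U by fact
  interpret F: module R ?F by (rule module_free_module[OF R])
  let ?\<Phi>' = "the_inv_into (carrier M) \<Phi>" and ?\<Psi>' = "the_inv_into (carrier N) \<Psi>"
  have \<Phi>': "?\<Phi>' \<in> mod_hom R ?F M" and \<Psi>': "?\<Psi>' \<in> mod_hom R U N"
    by (rule mod_hom_the_inv[OF mods(1) \<Phi>], rule mod_hom_the_inv[OF mods(2) \<Psi>])
  have \<Psi>\<Psi>': "\<Psi> (?\<Psi>' y) = y" if "y \<in> carrier U" for y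
    by (rule f_the_inv_into_f_bij_betw[OF \<Psi>(2)]) (use that in simp)
  have inj: "inj_on \<Phi> (carrier M)" "inj_on \<Psi> (carrier N)"
    using \<Phi>(2) \<Psi>(2) by (simp_all add: bij_betw_def)
  have c: "(\<lambda>x. ?\<Psi>' (g (\<Phi> x))) \<in> mod_hom R M N"
    using mod_hom_compose[OF mod_hom_compose[OF \<Phi>(1) g] \<Psi>'] .
  define d0 where "d0 = (\<lambda>x\<in>carrier M. ?\<Psi>' (g (\<Phi> x)))"
  have d0: "d0 \<in> mod_hom R M N"
    using mod_homD[OF c] by (intro mod_homI) (simp_all add: d0_def)
  have \<Psi>d0: "\<Psi> (d0 x) = g (\<Phi> x)" if "x \<in> carrier M" for x
    using that \<Psi>\<Psi>' mod_homD(1)[OF g] mod_homD(1)[OF \<Phi>(1)] by (simp add: d0_def)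
  have d0n: "d0 (m i) = n i" if "i \<in> X" for i
    using \<Psi>d0[OF m[OF that]] n[OF that] mod_homD(1)[OF d0 m[OF that]]
    by (intro inj_onD[OF inj(2)]) simp_all
  have unique: "d' = d0" if d': "d' \<in> mod_hom R M N" "d' \<in> extensional (carrier M)" "Q d'" for d'
  proof (rule extensionalityI[OF d'(2)])
    show "d0 \<in> extensional (carrier M)"
      by (simp add: d0_def)
    have h: "(\<lambda>y. \<Psi> (d' (?\<Phi>' y))) \<in> mod_hom R ?F U"
      using mod_hom_compose[OF mod_hom_compose[OF \<Phi>' d'(1)] \<Psi>(1)] .
    have e: "\<Psi> (d' (?\<Phi>' (basis_vector R L l))) = g (basis_vector R L l)" if l: "l \<in> L" for l
    proof -
      obtain i k where i: "i \<in> X" "\<Phi> (m i) = sign_scalar R k \<odot>\<^bsub>?F\<^esub> basis_vector R L l"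
        using gen[OF l] by blast
      let ?y = "sign_scalar R k \<odot>\<^bsub>M\<^esub> m i"
      have y: "?y \<in> carrier M"
        using m[OF i(1)] by simp
      have "\<Phi> ?y = basis_vector R L l"
        using mod_homD(3)[OF \<Phi>(1) R.sign_scalar_closed m[OF i(1)]] i(2)
        by (simp add: F.sign_smult_twice basis_vector_carrier[OF R])
      then have inv: "?\<Phi>' (basis_vector R L l) = ?y" and ge: "g (basis_vector R L l) = g (\<Phi> ?y)"
        using the_inv_into_f_f[OF inj(1) y] by auto
      have "d' (m i) = n i"
        using d'(3) i(1) unfolding Q by blast
      then have "\<Psi> (d' ?y) = sign_scalar R k \<odot>\<^bsub>U\<^esub> g (\<Phi> (m i))"
        using mod_homD(3)[OF d'(1) R.sign_scalar_closed m[OF i(1)]]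
          mod_homD(3)[OF \<Psi>(1) R.sign_scalar_closed n(1)[OF i(1)]] n(2)[OF i(1)] by simp
      also have "\<dots> = g (\<Phi> ?y)"
        using mod_homD(3)[OF g R.sign_scalar_closed mod_homD(1)[OF \<Phi>(1) m[OF i(1)]]]
          mod_homD(3)[OF \<Phi>(1) R.sign_scalar_closed m[OF i(1)]] by simp
      finally show ?thesis
        using inv ge by simp
    qed
    fix x assume x: "x \<in> carrier M"
    have "\<Psi> (d' (?\<Phi>' (\<Phi> x))) = g (\<Phi> x)"
      by (rule mod_hom_free_module_eqI[OF R L mods(3) h g e mod_homD(1)[OF \<Phi>(1) x]])
    then have "\<Psi> (d' x) = \<Psi> (d0 x)"
      using the_inv_into_f_f[OF inj(1) x] \<Psi>d0[OF x] by simp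
    then show "d' x = d0 x"
      using mod_homD(1)[OF d'(1) x] mod_homD(1)[OF d0 x] by (intro inj_onD[OF inj(2)])
  qed
  have "d = d0"
    unfolding d_def
  proof (rule the_equality)
    show "d0 \<in> mod_hom R M N \<and> d0 \<in> extensional (carrier M) \<and> Q d0"
      using d0 d0n by (simp add: Q) (simp add: d0_def)
  qed (use unique in blast)
  then show "d x \<in> carrier N" "\<Psi> (d x) = g (\<Phi> x)"
    using mod_homD(1)[OF d0 x] \<Psi>d0[OF x] by simp_all
qed

section \<open>Words with the circles of a crossing in front\<close>

context sign_system
begin

lemma finite_classical: "finite (classical K)"
  using finite_crossings by (simp add: classical_def)

lemma local_factor_simps [simp]:
  "factor_circle (local_factor K s v C p) = C" "factor_label (local_factor K s v C p) = p"
  by (cases p; simp add: local_factor_def)+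

lemma local_factor_sign:
  assumes "v \<in> classical K" "C \<in> circles K s" "ul v \<in> C \<or> lr v \<in> C"
  shows "factor_sign (local_factor K s v C p) = (if p = Lab_X then corner_sign v else 1)"
  using local_orientation_eq[OF assms] factor_sign_X[OF assms(2)]
  by (cases p) (simp_all add: local_factor_def corner_sign_def, simp add: factor_sign_def)

lemma local_orientation_in:
  assumes "v \<in> classical K" "C \<in> circles K s" "ul v \<in> C \<or> lr v \<in> C"
  shows "local_orientation K s v C \<in> orientations K s C"
  using local_orientation_eq[OF assms] orientations_eq(1)[OF assms(2)] by simp

lemma local_factor_orientation:
  assumes "v \<in> classical K" "C \<in> circles K s" "ul v \<in> C \<or> lr v \<in> C" "X_at C' ori = local_factor K s v C p"
  shows "ori \<in> orientations K s C'"
  using assms(4) local_orientation_in[OF assms(1-3)] by (cases p) (auto simp: local_factor_def)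

text \<open>Both orientations are cut out by \<open>G\<close>, which does not depend on the
  state.\<close>

lemma orientations_unaffected:
  "C \<in> circles K s \<Longrightarrow> C \<in> circles K t \<Longrightarrow> orientations K t C = orientations K s C"
  by (simp add: orientations_eq(1))

text \<open>The wedges on which a partial differential is prescribed reach every basis vector up to
  sign, as its uniqueness demands.\<close>

lemma special_word:
  assumes l: "l \<in> labellings K s j" and v: "v \<in> classical K"
  obtains w where "two_at s v \<Longrightarrow>
      local_factor K s v (circ s (ul v)) (l (circ s (ul v))) #
      local_factor K s v (circ s (lr v)) (l (circ s (lr v))) # w \<in> words K s j \<and>
      word_labelling s (local_factor K s v (circ s (ul v)) (l (circ s (ul v))) #
      local_factor K s v (circ s (lr v)) (l (circ s (lr v))) # w) = l"
    "\<not> two_at s v \<Longrightarrow>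
      local_factor K s v (circ s (ul v)) (l (circ s (ul v))) # w \<in> words K s j \<and>
      word_labelling s (local_factor K s v (circ s (ul v)) (l (circ s (ul v))) # w) = l"
proof -
  let ?A = "circ s (ul v)" and ?B = "circ s (lr v)"
  obtain c where c: "distinct c" "set c = circles K s - {?A, ?B}"
    using finite_distinct_list[OF finite_Diff[OF finite_circles[of s]], of "{?A, ?B}"] by auto
  define ors where "ors C = (if C = ?A \<or> C = ?B then local_orientation K s v C else C \<inter> G)" for C
  have ors: "ors C \<in> orientations K s C" if "C \<in> circles K s" for C
  proof (cases "C = ?A \<or> C = ?B")
    case True
    then have "ul v \<in> C \<or> lr v \<in> C"
      using v self_in_circ[of "ul v" s] self_in_circ[of "lr v" s] by auto
    then show ?thesis
      using local_orientation_in[OF v that] True by (simp add: ors_def)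
  qed (simp add: ors_def orientations_eq(1)[OF that])
  have f: "labelled_factor ors l C = local_factor K s v C (l C)" if "C = ?A \<or> C = ?B" for C
    using that by (auto simp: labelled_factor_def local_factor_def ors_def split: label.splits)
  have AB: "?A \<in> circles K s" "?B \<in> circles K s"
    using v by simp_all
  then have ins: "insert ?A (insert ?B (circles K s - {?A, ?B})) = circles K s"
    by blast
  show thesis
  proof (rule that[of "map (labelled_factor ors l) c"])
    assume "two_at s v"
    then have "?A \<noteq> ?B"
      unfolding two_at_def .
    then have "distinct (?A # ?B # c)" "set (?A # ?B # c) = circles K s"
      using c ins by simp_all
    from labelled_word[OF l this ors] show "local_factor K s v ?A (l ?A) # local_factor K s v ?B (l ?B) #
        map (labelled_factor ors l) c \<in> words K s j \<and>
      word_labelling s (local_factor K s v ?A (l ?A) # local_factor K s v ?B (l ?B) #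
        map (labelled_factor ors l) c) = l"
      by (simp add: f)
  next
    assume "\<not> two_at s v"
    then have "?A = ?B"
      unfolding two_at_def by blast
    then have "distinct (?A # c)" "set (?A # c) = circles K s"
      using c ins by simp_all
    from labelled_word[OF l this ors] show "local_factor K s v ?A (l ?A) #
        map (labelled_factor ors l) c \<in> words K s j \<and>
      word_labelling s (local_factor K s v ?A (l ?A) # map (labelled_factor ors l) c) = l"
      by (simp add: f)
  qed
qed

text \<open>Every local \<open>X\<close> at \<open>v\<close> contributes
  \<open>corner_sign v\<close>, and a merge preserves the number of factors \<open>X\<close>. Hence
  the orientations contribute equally on both sides, and only the sign of \<open>D_merge\<close>
  remains.\<close>

lemma merge_word:
  assumes s: "s \<subseteq> classical K" and v: "v \<in> classical K - s" and two: "two_at s v"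
  defines "t \<equiv> insert v s"
  assumes W: "local_factor K s v (circ s (ul v)) p # local_factor K s v (circ s (lr v)) q # w \<in> words K s j"

    and r: "r \<in> m_terms p q"
  shows "local_factor K t v (circ t (ul v)) r # w \<in> words K t j"
    and "word_sign t (local_factor K t v (circ t (ul v)) r # w) = (- 1) ^ ones_before vs s v * word_sign s (local_factor K s v (circ s (ul v)) p # local_factor K s v (circ s (lr v)) q # w)"
    and "word_labelling t (local_factor K t v (circ t (ul v)) r # w) =
      restrict ((word_labelling s (local_factor K s v (circ s (ul v)) p # local_factor K s v (circ s (lr v)) q # w))(circ t (ul v) := r)) (circles K t)"
proof -
  let ?f1 = "local_factor K s v (circ s (ul v)) p" and ?f2 = "local_factor K s v (circ s (lr v)) q" and ?g = "local_factor K t v (circ t (ul v)) r"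
  let ?A = "circ s (ul v)" and ?B = "circ s (lr v)" and ?M = "circ t (ul v)"
  let ?c = "map factor_circle w"
  have vK: "v \<in> classical K" and t: "flip v s = t"
    using v by (auto simp: t_def flip_insert)
  have fin: "finite s"
    using s finite_classical by (rule finite_subset)
  note mc = merge_circles[OF vK two, unfolded t]
  note WD = wordsD[OF W]
  have c: "distinct ?c" "set ?c = circles K s - {?A, ?B}"
    using WD(1,2) by auto
  have D: "distinct (map factor_circle (?g # w))" "factor_circle ` set (?g # w) = circles K t"
    using c mc by auto
  \<comment> \<open>\<open>m\<close> lowers the degree by one, which the greater height of
    \<open>t\<close> makes up for.\<close>
  have deg: "label_degree r = label_degree p + label_degree q - 1"
    using r by (cases p; cases q; simp add: label_degree_def)
  have mem: "ul v \<in> ?A" "lr v \<in> ?B" "ul v \<in> ?M" "?A \<in> circles K s" "?B \<in> circles K s" "?M \<in> circles K t"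
    using vK by simp_all
  show W': "?g # w \<in> words K t j"
  proof -
    have "card t = Suc (card s)"
      using fin v by (simp add: t_def)
    then have "(\<Sum>f\<leftarrow>?g # w. label_degree (factor_label f)) + int (card t) = j"
      using WD(4) deg by simp
    moreover have "ori \<in> orientations K t C" if X: "X_at C ori \<in> set (?g # w)" for C ori
    proof (cases "X_at C ori = ?g")
      case True
      then show ?thesis
        using local_factor_orientation[OF vK mem(6)] mem(3) by blast
    next
      case False
      then have "X_at C ori \<in> set w"
        using X by auto
      moreover from this have "C \<in> set ?c"
        by force
      ultimately show ?thesis
        using orientations_unaffected[of C s t] WD(3)[of C ori] c(2) mc(1) by auto
    qed
    ultimately show ?thesis
      using D by (simp add: words_def)
  qed
  have "factor_sign ?g = factor_sign ?f1 * factor_sign ?f2"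
    using r mem local_factor_sign[OF vK] by (cases p; cases q) auto
  moreover have "D t (?M # ?c) = (- 1) ^ ones_before vs s v * D s (?A # ?B # ?c)"
    unfolding t_def by (rule D_merge[OF s v two]) (use c in auto)
  ultimately show "word_sign t (?g # w) = (- 1) ^ ones_before vs s v * word_sign s (?f1 # ?f2 # w)"
    by (simp add: word_sign_def)
  show "word_labelling t (?g # w) =
      restrict ((word_labelling s (?f1 # ?f2 # w))(?M := r)) (circles K t)"
  proof (rule word_labelling_eqI[OF D])
    fix f assume f: "f \<in> set (?g # w)"
    show "restrict ((word_labelling s (?f1 # ?f2 # w))(?M := r)) (circles K t) (factor_circle f) = factor_label f"
    proof (cases "f = ?g")
      case True
      then show ?thesis
        using mem by simp
    next
      case False
      then have "f \<in> set w"
        using f by auto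
      then have "factor_circle f \<in> set ?c"
        by simp
      then have "factor_circle f \<noteq> ?M" "factor_circle f \<in> circles K t"
        using mc(2) unfolding mc(1) c(2)[symmetric] by (metis, metis insertI2)
      moreover have "word_labelling s (?f1 # ?f2 # w) (factor_circle f) = factor_label f"
        by (rule word_labelling_factor[OF WD(1,2)]) (use \<open>f \<in> set w\<close> in simp)
      ultimately show ?thesis
        by simp
    qed
  qed simp
qed

text \<open>A split creates one more factor \<open>X\<close> than it consumes; the additional
  \<open>corner_sign v\<close> is the one absorbed by \<open>D_split\<close>.\<close>

lemma split_word:
  assumes s: "s \<subseteq> classical K" and v: "v \<in> classical K - s" and two: "\<not> two_at s v"
  defines "t \<equiv> insert v s"
  assumes W: "local_factor K s v (circ s (ul v)) p # w \<in> words K s j"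
    and r: "r \<in> Delta_terms p"
  shows "local_factor K t v (circ t (ul v)) (fst r) # local_factor K t v (circ t (lr v)) (snd r) # w
      \<in> words K t j"
    and "word_sign t (local_factor K t v (circ t (ul v)) (fst r) # local_factor K t v (circ t (lr v)) (snd r) # w) = (- 1) ^ ones_before vs s v * word_sign s (local_factor K s v (circ s (ul v)) p # w)"
    and "word_labelling t (local_factor K t v (circ t (ul v)) (fst r) # local_factor K t v (circ t (lr v)) (snd r) # w) =
      restrict ((word_labelling s (local_factor K s v (circ s (ul v)) p # w))(circ t (ul v) := fst r, circ t (lr v) := snd r)) (circles K t)"
proof -
  let ?g1 = "local_factor K t v (circ t (ul v)) (fst r)" and ?g2 = "local_factor K t v (circ t (lr v)) (snd r)" and ?f = "local_factor K s v (circ s (ul v)) p"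
  let ?A = "circ s (ul v)" and ?M = "circ t (ul v)" and ?N = "circ t (lr v)"
  let ?c = "map factor_circle w"
  have vK: "v \<in> classical K" and t: "flip v s = t" "flip v t = s"
    using v by (auto simp: t_def flip_insert flip_def)
  have twot: "two_at t v"
    using two_at_flip[OF vK, of s] two t by simp
  then have MN: "?M \<noteq> ?N"
    by (simp add: two_at_def)
  have fin: "finite s"
    using s finite_classical by (rule finite_subset)
  note mc = merge_circles[OF vK twot, unfolded t]
  note WD = wordsD[OF W]
  have mem: "ul v \<in> ?A" "ul v \<in> ?M" "lr v \<in> ?N" "?A \<in> circles K s" "?M \<in> circles K t" "?N \<in> circles K t"
    using vK by simp_all
  have "insert ?A (set ?c) = insert ?A (circles K t - {?M, ?N})" "?A \<notin> set ?c"
    using WD(1,2) unfolding mc(1) by simp_all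
  then have c: "distinct ?c" "set ?c = circles K t - {?M, ?N}"
    using WD(1) mc(2) insert_ident by (simp, metis)
  have cs: "set ?c \<subseteq> circles K s"
    unfolding c(2) mc(1) by (rule subset_insertI)
  have D: "distinct (map factor_circle (?g1 # ?g2 # w))" "factor_circle ` set (?g1 # ?g2 # w) = circles K t"
    using c MN mem(5,6) by (simp, simp add: insert_absorb insert_Diff_if) auto
  have deg: "label_degree (fst r) + label_degree (snd r) = label_degree p - 1"
    using r by (cases p) (auto simp: label_degree_def)
  show W': "?g1 # ?g2 # w \<in> words K t j"
  proof -
    have "card t = Suc (card s)"
      using fin v by (simp add: t_def)
    then have "(\<Sum>f\<leftarrow>?g1 # ?g2 # w. label_degree (factor_label f)) + int (card t) = j"
      using WD(4) deg by simp
    moreover have "ori \<in> orientations K t C" if X: "X_at C ori \<in> set (?g1 # ?g2 # w)" for C ori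
    proof (cases "X_at C ori = ?g1 \<or> X_at C ori = ?g2")
      case True
      then show ?thesis
        using local_factor_orientation[OF vK mem(5)] local_factor_orientation[OF vK mem(6)] mem(2,3) by blast
    next
      case False
      then have "X_at C ori \<in> set w"
        using X by auto
      moreover from this have "C \<in> set ?c"
        by force
      ultimately show ?thesis
        using orientations_unaffected[of C s t] WD(3)[of C ori] cs unfolding c(2)
        by (metis DiffD1 list.set_intros(2) subsetD)
    qed
    ultimately show ?thesis
      using D by (simp add: words_def)
  qed
  have "factor_sign ?g1 * factor_sign ?g2 = corner_sign v * factor_sign ?f"
    using r mem local_factor_sign[OF vK] by (cases p) auto
  moreover have "corner_sign v * D t (?M # ?N # ?c) = (- 1) ^ ones_before vs s v * D s (?A # ?c)"
    unfolding t_def by (rule D_split[OF s v two]) (use c in \<open>auto simp: t_def\<close>)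
  ultimately have "D t (?M # ?N # ?c) * (factor_sign ?g1 * factor_sign ?g2) =
      (- 1) ^ ones_before vs s v * D s (?A # ?c) * factor_sign ?f"
    by (simp add: mult.left_commute flip: mult.assoc)
  then show "word_sign t (?g1 # ?g2 # w) = (- 1) ^ ones_before vs s v * word_sign s (?f # w)"
    by (simp add: word_sign_def flip: mult.assoc)
  show "word_labelling t (?g1 # ?g2 # w) =
      restrict ((word_labelling s (?f # w))(?M := fst r, ?N := snd r)) (circles K t)"
  proof (rule word_labelling_eqI[OF D])
    fix f assume f: "f \<in> set (?g1 # ?g2 # w)"
    show "restrict ((word_labelling s (?f # w))(?M := fst r, ?N := snd r)) (circles K t) (factor_circle f) =
        factor_label f"
    proof (cases "f = ?g1 \<or> f = ?g2")
      case True
      then show ?thesis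
        using mem(5,6) MN by (elim disjE) simp_all
    next
      case False
      then have "f \<in> set w"
        using f by auto
      then have "factor_circle f \<in> set ?c"
        by simp
      then have "factor_circle f \<noteq> ?M" "factor_circle f \<noteq> ?N" "factor_circle f \<in> circles K t"
        unfolding c(2) by simp_all
      moreover have "word_labelling s (?f # w) (factor_circle f) = factor_label f"
        by (rule word_labelling_factor[OF WD(1,2)]) (use \<open>f \<in> set w\<close> in simp)
      ultimately show ?thesis
        by simp
    qed
  qed simp
qed

end

section \<open>Comparison of the partial differentials and of the two cubes\<close>

context sign_system
begin

text \<open>All terms of one value of \<open>m\<close> or \<open>\<Delta>\<close> carry the same
  word sign \<open>k\<close>, which can therefore be taken out of the sum.\<close>

lemma tensor_map_sum_wedges:
  assumes s: "s \<subseteq> classical K" and T: "finite T"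
    and u: "\<And>r. r \<in> T \<Longrightarrow> u r \<in> words K s j" "\<And>r. r \<in> T \<Longrightarrow> word_sign s (u r) = k"
      "\<And>r. r \<in> T \<Longrightarrow> word_labelling s (u r) = l r"
  shows "(\<Oplus>\<^bsub>ordered_tensor R K s j\<^esub> r\<in>T. wedge R K s j (u r)) \<in> carrier (ordered_tensor R K s j)"
    "tensor_map s j (\<Oplus>\<^bsub>ordered_tensor R K s j\<^esub> r\<in>T. wedge R K s j (u r)) =
      sign_scalar R k \<odot>\<^bsub>usual_tensor R K s j\<^esub>
        (\<Oplus>\<^bsub>usual_tensor R K s j\<^esub> r\<in>T. basis_vector R (labellings K s j) (l r))"
proof -
  let ?N = "ordered_tensor R K s j" and ?U = "usual_tensor R K s j"
  interpret R: cring R by (rule cring)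
  interpret N: module R ?N by (rule ordered_tensor_module[OF s])
  interpret U: module R ?U
    unfolding usual_tensor_def by (rule module_free_module[OF cring])
  have bv: "basis_vector R (labellings K s j) l \<in> carrier ?U" for l
    unfolding usual_tensor_def by (rule basis_vector_carrier[OF cring])
  show "(\<Oplus>\<^bsub>?N\<^esub> r\<in>T. wedge R K s j (u r)) \<in> carrier ?N"
    by (intro N.finsum_closed Pi_I wedge_carrier[OF s])
  have "tensor_map s j (\<Oplus>\<^bsub>?N\<^esub> r\<in>T. wedge R K s j (u r)) = (\<Oplus>\<^bsub>?U\<^esub> r\<in>T. tensor_map s j (wedge R K s j (u r)))"
    by (intro mod_hom_finsum[OF N.module_axioms U.module_axioms tensor_map_hom[OF s] T] Pi_I wedge_carrier[OF s])
  also have "\<dots> = (\<Oplus>\<^bsub>?U\<^esub> r\<in>T. sign_scalar R k \<odot>\<^bsub>?U\<^esub> basis_vector R (labellings K s j) (l r))"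
    using u by (intro U.finsum_cong' refl Pi_I U.smult_closed R.sign_scalar_closed bv) (simp add: tensor_map_wedge[OF s])
  also have "\<dots> = sign_scalar R k \<odot>\<^bsub>?U\<^esub> (\<Oplus>\<^bsub>?U\<^esub> r\<in>T. basis_vector R (labellings K s j) (l r))"
    by (rule U.finsum_smult_ldistr[symmetric]) (use T bv in auto)
  finally show "tensor_map s j (\<Oplus>\<^bsub>?N\<^esub> r\<in>T. wedge R K s j (u r)) =
      sign_scalar R k \<odot>\<^bsub>?U\<^esub> (\<Oplus>\<^bsub>?U\<^esub> r\<in>T. basis_vector R (labellings K s j) (l r))" .
qed

lemma finite_terms: "finite (m_terms p q)" "finite (Delta_terms p)"
  by (cases p; cases q; simp) (cases p; simp)

text \<open>On the wedges with prescribed values the identity is \<open>merge_word\<close> or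
  \<open>split_word\<close>; \<open>linear_map_determined\<close> extends it to the whole
  module.\<close>

lemma partial_differential_tensor_map:
  assumes s: "s \<subseteq> classical K" and v: "v \<in> classical K - s"
    and x: "x \<in> carrier (ordered_tensor R K s j)"
  shows "partial_differential R K s v j x \<in> carrier (ordered_tensor R K (insert v s) j)"
    "tensor_map (insert v s) j (partial_differential R K s v j x) =
      [((- 1 :: int) ^ ones_before vs s v)] \<cdot>\<^bsub>usual_tensor R K (insert v s) j\<^esub>
        usual_partial R K s v j (tensor_map s j x)"
proof -
  define t where "t = insert v s"
  let ?M = "ordered_tensor R K s j" and ?N = "ordered_tensor R K t j"
  let ?L = "labellings K s j" and ?U = "usual_tensor R K t j"
  let ?ob = "(- 1 :: int) ^ ones_before vs s v"
  let ?up = "usual_partial R K s v j"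
  have t: "t \<subseteq> classical K"
    using s v by (simp add: t_def)
  interpret R: cring R by (rule cring)
  interpret M: module R ?M by (rule ordered_tensor_module[OF s])
  interpret N: module R ?N by (rule ordered_tensor_module[OF t])
  interpret U: module R ?U
    unfolding usual_tensor_def by (rule module_free_module[OF cring])
  have bv: "basis_vector R (labellings K t j) l \<in> carrier ?U" for l
    unfolding usual_tensor_def by (rule basis_vector_carrier[OF cring])
  have ob: "?ob \<in> {1, - 1}"
    by (cases "even (ones_before vs s v)") auto
  define b where "b l = (if merges K s v
      then \<Oplus>\<^bsub>?U\<^esub> r\<in>m_terms (l (circ s (ul v))) (l (circ s (lr v))).
        basis_vector R (labellings K t j) (restrict (l(circ t (ul v) := r)) (circles K t))
      else if splits K s v
      then \<Oplus>\<^bsub>?U\<^esub> r\<in>Delta_terms (l (circ s (ul v))).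
        basis_vector R (labellings K t j) (restrict (l(circ t (ul v) := fst r, circ t (lr v) := snd r)) (circles K t))
      else \<zero>\<^bsub>?U\<^esub>)" for l
  have b: "b \<in> ?L \<rightarrow> carrier ?U"
    by (auto simp: b_def intro!: U.finsum_closed bv)
  have up: "?up = linear_extension ?L ?U b"
    unfolding usual_partial_def Let_def b_def[abs_def] first_circle_def second_circle_def t_def ..
  have up_hom: "?up \<in> mod_hom R (free_module R ?L) ?U"
    unfolding up by (rule linear_extension_hom[OF cring finite_labellings U.module_axioms b])
  have up_basis: "?up (basis_vector R ?L l) = b l" if "l \<in> ?L" for l
    unfolding up by (rule linear_extension_basis[OF cring finite_labellings U.module_axioms b that])
  \<comment> \<open>The usual partial differential together with its sign in the anticommutative
    cube.\<close>
  define g where "g = (\<lambda>y. sign_scalar R ?ob \<odot>\<^bsub>?U\<^esub> ?up y)"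
  have g: "g \<in> mod_hom R (free_module R ?L) ?U"
    unfolding g_def
  proof (rule mod_hom_compose[OF up_hom], rule mod_homI)
    fix a y assume "a \<in> carrier R" "y \<in> carrier ?U"
    then show "sign_scalar R ?ob \<odot>\<^bsub>?U\<^esub> (a \<odot>\<^bsub>?U\<^esub> y) = a \<odot>\<^bsub>?U\<^esub> (sign_scalar R ?ob \<odot>\<^bsub>?U\<^esub> y)"
      by (simp add: R.m_comm flip: U.smult_assoc1)
  qed (simp_all add: U.smult_r_distr)
  have gm: "g (tensor_map s j (wedge R K s j w)) = sign_scalar R (?ob * word_sign s w) \<odot>\<^bsub>?U\<^esub> b (word_labelling s w)"
    if w: "w \<in> words K s j" for w
  proof -
    note l = word_labelling_in[OF w]
    have "?up (tensor_map s j (wedge R K s j w)) = sign_scalar R (word_sign s w) \<odot>\<^bsub>?U\<^esub> b (word_labelling s w)"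
      unfolding tensor_map_wedge[OF s w] unfolding usual_tensor_def[of R K s j]
      using mod_homD(3)[OF up_hom R.sign_scalar_closed basis_vector_carrier[OF cring]] up_basis[OF l] by simp
    moreover have "b (word_labelling s w) \<in> carrier ?U"
      using b l by auto
    ultimately show ?thesis
      by (simp add: g_def R.sign_scalar_mult[OF ob word_sign_unit[OF s w]] U.smult_assoc1)
  qed
  note tm = tensor_map_hom[OF s, of j, unfolded usual_tensor_def] tensor_map_bij[OF s, of j, unfolded usual_tensor_def]
    tensor_map_hom[OF t, of j] tensor_map_bij[OF t, of j]
  let ?pd = "partial_differential R K s v j"
  note determined = linear_map_determined[OF cring finite_labellings M.module_axioms N.module_axioms
      U.module_axioms tm g]
  have main: "?pd x \<in> carrier ?N \<and> tensor_map t j (?pd x) = g (tensor_map s j x)"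
  proof (cases "two_at s v")
    case True
    then have ms: "merges K s v"
      using merges_iff v by blast
    let ?W = "\<lambda>p q w. local_factor K s v (circ s (ul v)) p # local_factor K s v (circ s (lr v)) q # w"
    let ?G = "\<lambda>r w. local_factor K t v (circ t (ul v)) r # w"
    let ?Q = "\<lambda>d. \<forall>p q w. ?W p q w \<in> words K s j \<longrightarrow>
      d (wedge R K s j (?W p q w)) = (\<Oplus>\<^bsub>?N\<^esub> r\<in>m_terms p q. wedge R K t j (?G r w))"
    \<comment> \<open>\<open>X\<close> indexes the conditions that single out the partial
      differential: it has to send \<open>m i\<close> to \<open>n i\<close>.\<close>
    define X where "X = {(p, q, w). ?W p q w \<in> words K s j}"
    define m where "m = (\<lambda>(p, q, w). wedge R K s j (?W p q w))"
    define n where "n = (\<lambda>(p, q, w). \<Oplus>\<^bsub>?N\<^esub> r\<in>m_terms p q. wedge R K t j (?G r w))"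
    have pd: "?pd = (THE d. d \<in> mod_hom R ?M ?N \<and> d \<in> extensional (carrier ?M) \<and> ?Q d)"
      using ms by (simp add: partial_differential_def Let_def first_circle_def second_circle_def t_def)
    have val: "n i \<in> carrier ?N" "tensor_map t j (n i) = g (tensor_map s j (m i))" if iX: "i \<in> X" for i
    proof -
      obtain p q w where i: "i = (p, q, w)" and W: "?W p q w \<in> words K s j"
        using iX by (auto simp: X_def)
      let ?l = "word_labelling s (?W p q w)"
      have "?l (circ s (ul v)) = p" "?l (circ s (lr v)) = q"
        using word_labelling_factor[OF wordsD(1,2)[OF W], of "local_factor K s v (circ s (ul v)) p"]
          word_labelling_factor[OF wordsD(1,2)[OF W], of "local_factor K s v (circ s (lr v)) q"] by simp_all
      then have "b ?l = (\<Oplus>\<^bsub>?U\<^esub> r\<in>m_terms p q. basis_vector R (labellings K t j)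
          (restrict (?l(circ t (ul v) := r)) (circles K t)))"
        using ms by (simp add: b_def)
      then show "n i \<in> carrier ?N" "tensor_map t j (n i) = g (tensor_map s j (m i))"
        using tensor_map_sum_wedges[OF t finite_terms(1) merge_word[OF s v True W, folded t_def], of p q "\<lambda>r. r"]
        by (simp_all add: i m_def n_def gm[OF W])
    qed
    have gen: "\<exists>i\<in>X. \<exists>k. tensor_map s j (m i) =
        sign_scalar R k \<odot>\<^bsub>free_module R ?L\<^esub> basis_vector R ?L l" if l: "l \<in> ?L" for l
    proof -
      obtain w where w: "?W (l (circ s (ul v))) (l (circ s (lr v))) w \<in> words K s j"
        "word_labelling s (?W (l (circ s (ul v))) (l (circ s (lr v))) w) = l"
        using special_word[OF l, of v] v True by (metis DiffD1)
      then show ?thesis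
        using tensor_map_wedge[OF s w(1)] unfolding usual_tensor_def
        by (intro bexI[of _ "(l (circ s (ul v)), l (circ s (lr v)), w)"]) (auto simp: X_def m_def)
    qed
    have mc: "m i \<in> carrier ?M" if "i \<in> X" for i
      using wedge_carrier[OF s] by (cases i) (auto simp: m_def)
    have Q: "?Q d \<longleftrightarrow> (\<forall>i\<in>X. d (m i) = n i)" for d
      by (auto simp: X_def m_def n_def)
    show ?thesis
      unfolding pd by (intro conjI determined(1,2)[of X m n, OF mc gen val Q x])
  next
    case False
    then have ms: "\<not> merges K s v" "splits K s v"
      using merges_iff v by blast+
    let ?W = "\<lambda>p w. local_factor K s v (circ s (ul v)) p # w"
    let ?G = "\<lambda>r w. local_factor K t v (circ t (ul v)) (fst r) # local_factor K t v (circ t (lr v)) (snd r) # w"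
    let ?Q = "\<lambda>d. \<forall>p w. ?W p w \<in> words K s j \<longrightarrow>
      d (wedge R K s j (?W p w)) = (\<Oplus>\<^bsub>?N\<^esub> r\<in>Delta_terms p. wedge R K t j (?G r w))"
    define X where "X = {(p, w). ?W p w \<in> words K s j}"
    define m where "m = (\<lambda>(p, w). wedge R K s j (?W p w))"
    define n where "n = (\<lambda>(p, w). \<Oplus>\<^bsub>?N\<^esub> r\<in>Delta_terms p. wedge R K t j (?G r w))"
    have pd: "?pd = (THE d. d \<in> mod_hom R ?M ?N \<and> d \<in> extensional (carrier ?M) \<and> ?Q d)"
      using ms by (simp add: partial_differential_def Let_def first_circle_def second_circle_def t_def)
    have val: "n i \<in> carrier ?N" "tensor_map t j (n i) = g (tensor_map s j (m i))" if iX: "i \<in> X" for i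
    proof -
      obtain p w where i: "i = (p, w)" and W: "?W p w \<in> words K s j"
        using iX by (auto simp: X_def)
      let ?l = "word_labelling s (?W p w)"
      have "?l (circ s (ul v)) = p"
        using word_labelling_factor[OF wordsD(1,2)[OF W], of "local_factor K s v (circ s (ul v)) p"] by simp
      then have "b ?l = (\<Oplus>\<^bsub>?U\<^esub> r\<in>Delta_terms p. basis_vector R (labellings K t j)
          (restrict (?l(circ t (ul v) := fst r, circ t (lr v) := snd r)) (circles K t)))"
        using ms by (simp add: b_def)
      then show "n i \<in> carrier ?N" "tensor_map t j (n i) = g (tensor_map s j (m i))"
        using tensor_map_sum_wedges[OF t finite_terms(2) split_word[OF s v False W, folded t_def], of p "\<lambda>r. r"]
        by (simp_all add: i m_def n_def gm[OF W])
    qed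
    have gen: "\<exists>i\<in>X. \<exists>k. tensor_map s j (m i) =
        sign_scalar R k \<odot>\<^bsub>free_module R ?L\<^esub> basis_vector R ?L l" if l: "l \<in> ?L" for l
    proof -
      obtain w where w: "?W (l (circ s (ul v))) w \<in> words K s j"
        "word_labelling s (?W (l (circ s (ul v))) w) = l"
        using special_word[OF l, of v] v False by (metis DiffD1)
      then show ?thesis
        using tensor_map_wedge[OF s w(1)] unfolding usual_tensor_def
        by (intro bexI[of _ "(l (circ s (ul v)), w)"]) (auto simp: X_def m_def)
    qed
    have mc: "m i \<in> carrier ?M" if "i \<in> X" for i
      using wedge_carrier[OF s] by (cases i) (auto simp: m_def)
    have Q: "?Q d \<longleftrightarrow> (\<forall>i\<in>X. d (m i) = n i)" for d
      by (auto simp: X_def m_def n_def)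
    show ?thesis
      unfolding pd by (intro conjI determined(1,2)[of X m n, OF mc gen val Q x])
  qed
  then show "partial_differential R K s v j x \<in> carrier (ordered_tensor R K (insert v s) j)"
    by (simp add: t_def)
  have "?up (tensor_map s j x) \<in> carrier ?U"
    by (rule mod_homD(1)[OF up_hom mod_homD(1)[OF tm(1) x]])
  then have "g (tensor_map s j x) = [?ob] \<cdot>\<^bsub>?U\<^esub> ?up (tensor_map s j x)"
    unfolding g_def by (rule U.add_pow_sign[OF ob, symmetric])
  then show "tensor_map (insert v s) j (partial_differential R K s v j x) =
      [?ob] \<cdot>\<^bsub>usual_tensor R K (insert v s) j\<^esub> ?up (tensor_map s j x)"
    using main by (simp add: t_def)
qed

lemma Kh_isomorphic: "mod_isomorphic R (Kh R K i j) (usual_Kh R K vs i j)"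
  unfolding Kh_def usual_Kh_def
proof (rule cube_homology_isomorphic[OF finite_classical])
  let ?j = "j - int (n_plus K) + 2 * int (n_minus K)"
  fix s assume s: "s \<subseteq> classical K"
  show "module R (ordered_tensor R K s ?j)"
    by (rule ordered_tensor_module[OF s])
  show "module R (usual_tensor R K s ?j)"
    unfolding usual_tensor_def by (rule module_free_module[OF cring])
  show "tensor_map s ?j \<in> mod_hom R (ordered_tensor R K s ?j) (usual_tensor R K s ?j)"
    by (rule tensor_map_hom[OF s])
  show "bij_betw (tensor_map s ?j) (carrier (ordered_tensor R K s ?j)) (carrier (usual_tensor R K s ?j))"
    by (rule tensor_map_bij[OF s])
  fix v x assume "v \<in> classical K - s" "x \<in> carrier (ordered_tensor R K s ?j)"
  from partial_differential_tensor_map[OF s this]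
  show "partial_differential R K s v ?j x \<in> carrier (ordered_tensor R K (insert v s) ?j)"
    "tensor_map (insert v s) ?j (partial_differential R K s v ?j x) =
      [((- 1 :: int) ^ ones_before vs s v)] \<cdot>\<^bsub>usual_tensor R K (insert v s) ?j\<^esub>
        usual_partial R K s v ?j (tensor_map s ?j x)" .
qed

end

theorem theorem4:
  fixes R :: "('r, 'x) ring_scheme" and K :: "'v diagram" and vs :: "'v list"
  assumes "cring R"
    and "virtual_diagram K"
    and "orientable_atom (atom_of K)"
    and "distinct vs" and "set vs = classical K"
  shows "\<forall>i j. mod_isomorphic R (Kh R K i j) (usual_Kh R K vs i j)"
proof -
  interpret valid_diagram K
    by unfold_locales fact
  obtain G where "coherent G"
    using assms(3) by (rule orientable_imp_coherent)
  then interpret coherent_diagram K G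
    by unfold_locales
  obtain D where "sign_system K G R vs D"
  proof (rule coherent_signs[OF assms(5)], goal_cases)
    case (1 D)
    have "sign_system_axioms K G R vs D"
      by (rule sign_system_axioms.intro) (rule assms(1) 1; assumption)+
    then show ?case
      by (intro that sign_system.intro coherent_diagram_axioms)
  qed
  then show ?thesis
    by (simp add: sign_system.Kh_isomorphic)
qed

end
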